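(* Let $W_h\subset W_{\mathrm{per}}(Y;\mathbb{R}^n)$, $U_h\subset H^1_{\mathrm{per}}(Y)$ and $M_h\subset U_h\cap M$ be closed linear subspaces and $X_h:=W_h\times U_h$. Let $(m,(w,u))\in M\times X$ be the (unique) solution of $$a\big((w,u),(w',u')\big)+b\big(m,(w',u')\big)=0\quad\forall (w',u')\in X,\qquad b\big(m',(w,u)\big)=0\quad\forall m'\in M,$$ and let $(m_h,(w_h,u_h))\in M_h\times X_h$ be the (unique) solution of $$a\big((w_h,u_h),(w_h',u_h')\big)+b\big(m_h,(w_h',u_h')\big)=0\quad\forall (w_h',u_h')\in X_h,\qquad b\big(m_h',(w_h,u_h)\big)=0\quad\forall m_h'\in M_h.$$ Then we have the error bound $$|\!|\!|(w-w_h,u-u_h)|\!|\!|_\lambda^2\le 2C_M^{-1}\Big(C_M^{-1}\|F_\gamma[(w_h,u_h)]\|_{L^2(Y)}^2+\sigma_1\|\mathrm{rot}(w_h)\|_{L^2(Y)}^2+\sigma_2\|w_h-\nabla u_h\|_{L^2(Y)}^2\Big)$$ and the efficiency estimate $$\tfrac12\|F_\gamma[(w_h,u_h)]\|_{L^2(Y)}^2+\sigma_1\|\mathrm{rot}(w_h)\|_{L^2(Y)}^2+\sigma_2\|w_h-\nabla u_h\|_{L^2(Y)}^2\le\Big(C_L+\frac{1-\delta}{2}\Big)|\!|\!|(w-w_h,u-u_h)|\!|\!|_\lambda^2,$$ where $C_M:=\frac14(1-\sqrt{1-\delta})$ and $C_L:=2+\sqrt2\sqrt{1-\delta}+\sig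ma_1+\tilde\sigma_2\big(\frac12+\frac{n}{\pi^2}\lambda\big)$.
   Context: Let $n\in\{2,3\}$, $Y:=(0,1)^n$, $\Lambda$ a compact metric space, $\mathcal{S}^{n\times n}$ the real symmetric $n\times n$ matrices. Let $A=(a_{ij}):\mathbb{R}^n\times\Lambda\to\mathcal{S}^{n\times n}$, $b=(b_i):\mathbb{R}^n\times\Lambda\to\mathbb{R}^n$, $c,f:\mathbb{R}^n\times\Lambda\to\mathbb{R}$ be $Y$-periodic in $y\in\mathbb{R}^n$ and uniformly continuous on $\mathbb{R}^n\times\Lambda$; write $A^\alpha:=A(\cdot,\alpha)$, and similarly $b^\alpha,c^\alpha,f^\alpha$. Assume $\inf_{\mathbb{R}^n\times\Lambda}c>0$; that there are $\zeta_1,\zeta_2>0$ with $\zeta_1|\xi|^2\le A(y,\alpha)\xi\cdot\xi\le\zeta_2|\xi|^2$ for all $y,\xi\in\mathbb{R}^n$, $\alpha\in\Lambda$; and the Cordes condition: for some constants $\lambda>0$, $\delta\in(0,1)$, $$|A|^2+\frac{|b|^2}{2\lambda}+\frac{c^2}{\lambda^2}\le\frac{1}{n+\delta}\Big(\mathrm{tr}(A)+\frac{c}{\lambda}\Big)^2\quad\text{in }\mathbb{R}^n\times\Lambda,$$ with $|A|$ the Frobenius norm. Define $\gamma:=\big(|A|^2+\frac{|b|^2}{2\lambda}+\frac{c^2}{\lambda^2}\big)^{-1}\big(\mathrm{tr}(A)+\frac{c}{\lambda}\big)$, $\gamma^\alpha:=\gamma(\cdot,\alpha)$. $H^k_{\mathrm{per}}(Y)$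 denotes the Sobolev space of $Y$-periodic functions. $W_{\mathrm{per}}(Y):=\{v\in H^1_{\mathrm{per}}(Y):\int_Y v=0\}$, $W_{\mathrm{per}}(Y;\mathbb{R}^n):=(W_{\mathrm{per}}(Y))^n$, $X:=W_{\mathrm{per}}(Y;\mathbb{R}^n)\times H^1_{\mathrm{per}}(Y)$, and $M\subset W_{\mathrm{per}}(Y)$ is a fixed closed linear subspace. $Dw$ is the Jacobian of $w$, $\mathrm{rot}(w):=\partial_2w_1-\partial_1w_2$ if $n=2$, and $\mathrm{rot}(w):=(\partial_2w_3-\partial_3w_2,\partial_3w_1-\partial_1w_3,\partial_1w_2-\partial_2w_1)$ if $n=3$. For $(w,u)\in X$: $$F_\gamma[(w,u)]:=\sup_{\alpha\in\Lambda}\{\gamma^\alpha(-A^\alpha:Dw-b^\alpha\cdot\nabla u+c^\alpha u-f^\alpha)\},\qquad L_\lambda(w,u):=-\nabla\cdot w+\lambda u,$$ $$|\!|\!|(w,u)|\!|\!|_\lambda^2:=\|Dw\|_{L^2(Y)}^2+2\lambda\|\nabla u\|_{L^2(Y)}^2+\lambda^2\|u\|_{L^2(Y)}^2.$$ Constants: $\sigma_1:=1-\frac12\sqrt{1-\delta}$, $\tilde\sigma_2:=\frac{1-\sqrt{1-\delta}}{2}+\frac{1}{4(1-\sqrt{1-\delta})}$, $\sigma_2:=\lambda\tilde\sigma_2$. The form $a:X\times X\to\mathbb{R}$ (nonlinear in the first, linear in the second argument) and the bilinear form $b:M\times X\to\mathbb{R}$ (not to be confused with the coefficient $b^\alpha$)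 are $$a((w,u),(w',u')):=\int_Y F_\gamma[(w,u)]\,L_\lambda(w',u')+\sigma_1\int_Y\mathrm{rot}(w)\cdot\mathrm{rot}(w')+\sigma_2\int_Y(\nabla u-w)\cdot(\nabla u'-w'),$$ $$b(m,(w,u)):=\int_Y\nabla m\cdot(\nabla u-w).$$ *)

theory Defs
  imports "HOL-Analysis.Analysis"
begin

text \<open>
  The dimension is n = CARD('n). The sort \<^class>\<open>comm_ring_1\<close> on the index type serves only to
  make the numerals 1, 2, 3 available as coordinate indices, as for the library's types 2 and 3.
  A commutative unital ring with n = 2 or n = 3 elements is the ring of integers modulo n, so these
  numerals denote n pairwise different indices (with 2 = 0 if n = 2 and 3 = 0 if n = 3).
\<close>

section \<open>Periodic Sobolev spaces\<close>

definition unit_cell :: "(real^'n) set" where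
  "unit_cell = {x. \<forall>i. 0 < x $ i \<and> x $ i < 1}"

abbreviation cell_measure :: "(real^'n) measure" where
  "cell_measure \<equiv> lebesgue_on unit_cell"

definition cell_periodic :: "(real^'n \<Rightarrow> 'b) \<Rightarrow> bool" where
  "cell_periodic f \<longleftrightarrow> (\<forall>x i. f (x + axis i 1) = f x)"

definition partial_deriv :: "'n \<Rightarrow> (real^'n \<Rightarrow> real) \<Rightarrow> real^'n \<Rightarrow> real" where
  "partial_deriv i f x = frechet_derivative f (at x) (axis i 1)"

primrec C_k :: "nat \<Rightarrow> (real^'n \<Rightarrow> real) \<Rightarrow> bool" where
  "C_k 0 f \<longleftrightarrow> continuous_on UNIV f"
| "C_k (Suc k) f \<longleftrightarrow>
     (\<forall>x. f differentiable (at x)) \<and> (\<forall>i. C_k k (partial_deriv i f))"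

definition C_inf_per :: "(real^'n \<Rightarrow> real) set" where
  "C_inf_per = {\<phi>. cell_periodic \<phi> \<and> (\<forall>k. C_k k \<phi>)}"

text \<open>
  Elements of the function spaces are everywhere periodic representatives; functions that agree
  almost everywhere are not identified.
\<close>

definition L2_per :: "(real^'n \<Rightarrow> 'b::euclidean_space) set" where
  "L2_per = {f. cell_periodic f \<and> f \<in> borel_measurable cell_measure \<and>
     integrable cell_measure (\<lambda>y. (norm (f y))\<^sup>2)}"

definition L2_norm :: "(real^'n \<Rightarrow> 'b::euclidean_space) \<Rightarrow> real" where
  "L2_norm f = sqrt (LINT y|cell_measure. (norm (f y))\<^sup>2)"

definition is_weak_grad :: "(real^'n \<Rightarrow> real) \<Rightarrow> (real^'n \<Rightarrow> real^'n) \<Rightarrow> bool" where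
  "is_weak_grad u g \<longleftrightarrow> g \<in> L2_per \<and>
     (\<forall>\<phi>\<in>C_inf_per. \<forall>i. (LINT y|cell_measure. u y * partial_deriv i \<phi> y) =
        - (LINT y|cell_measure. g y $ i * \<phi> y))"

definition H1_per :: "(real^'n \<Rightarrow> real) set" where
  "H1_per = {u \<in> L2_per. \<exists>g. is_weak_grad u g}"

text \<open>
  The weak gradient of an element of \<^term>\<open>H1_per\<close> is unique only up to null sets; an
  arbitrary representative is chosen.
\<close>

definition grad :: "(real^'n \<Rightarrow> real) \<Rightarrow> real^'n \<Rightarrow> real^'n" where
  "grad u = (SOME g. is_weak_grad u g)"

definition Jac :: "(real^'n \<Rightarrow> real^'n) \<Rightarrow> real^'n \<Rightarrow> real^'n^'n" where
  "Jac w y = (\<chi> i. grad (\<lambda>x. w x $ i) y)"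

definition W_per :: "(real^'n \<Rightarrow> real) set" where
  "W_per = {v \<in> H1_per. (LINT y|cell_measure. v y) = 0}"

definition W_per_vec :: "(real^'n \<Rightarrow> real^'n) set" where
  "W_per_vec = {w. \<forall>i. (\<lambda>x. w x $ i) \<in> W_per}"

definition X_space :: "((real^'n \<Rightarrow> real^'n) \<times> (real^'n \<Rightarrow> real)) set" where
  "X_space = W_per_vec \<times> H1_per"

definition H1_norm :: "(real^'n \<Rightarrow> real) \<Rightarrow> real" where
  "H1_norm u = sqrt ((L2_norm u)\<^sup>2 + (L2_norm (grad u))\<^sup>2)"

definition H1_norm_vec :: "(real^'n \<Rightarrow> real^'n) \<Rightarrow> real" where
  "H1_norm_vec w = sqrt ((L2_norm w)\<^sup>2 + (L2_norm (Jac w))\<^sup>2)"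

text \<open>
  Sequential closedness with respect to the (semi)norm \<open>nrm\<close> on \<open>H\<close>; taking constant sequences,
  it includes closedness under modification on null sets.
\<close>

definition closed_linear_subspace ::
    "('a \<Rightarrow> 'b::real_vector) set \<Rightarrow> (('a \<Rightarrow> 'b) \<Rightarrow> real) \<Rightarrow> ('a \<Rightarrow> 'b) set \<Rightarrow> bool" where
  "closed_linear_subspace H nrm V \<longleftrightarrow>
     V \<subseteq> H \<and> (\<lambda>x. 0) \<in> V \<and>
     (\<forall>u\<in>V. \<forall>v\<in>V. (\<lambda>x. u x + v x) \<in> V) \<and>
     (\<forall>r. \<forall>u\<in>V. (\<lambda>x. r *\<^sub>R u x) \<in> V) \<and>
     (\<forall>v\<in>H. \<forall>s. (\<forall>k::nat. s k \<in> V) \<and> (\<lambda>k. nrm (\<lambda>x. s k x - v x)) \<longlonglongrightarrow> 0 \<longrightarrow> v \<in> V)"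

section \<open>Differential operators\<close>

definition divergence :: "(real^'n \<Rightarrow> real^'n) \<Rightarrow> real^'n \<Rightarrow> real" where
  "divergence w y = trace (Jac w y)"

text \<open>
  With J = Jac w y, the entry J $ i $ j is the j-th partial derivative of the i-th component of w.
  In dimension 2 the rotation is scalar; it is stored as the last entry of a vector whose other
  entries vanish, which preserves products and absolute values.
\<close>

definition rot :: "(real^'n::{finite,comm_ring_1} \<Rightarrow> real^'n::{finite,comm_ring_1}) \<Rightarrow> real^'n::{finite,comm_ring_1} \<Rightarrow> real^3" where
  "rot w y = (let J = Jac w y in
     if CARD('n) = 2 then vector [0, 0, J $ 1 $ 2 - J $ 2 $ 1]
     else vector [J $ 3 $ 2 - J $ 2 $ 3, J $ 1 $ 3 - J $ 3 $ 1, J $ 2 $ 1 - J $ 1 $ 2])"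

definition L_op :: "real \<Rightarrow> (real^'n \<Rightarrow> real^'n) \<times> (real^'n \<Rightarrow> real) \<Rightarrow> real^'n \<Rightarrow> real" where
  "L_op lam = (\<lambda>(w, u) y. - divergence w y + lam * u y)"

definition triple_norm :: "real \<Rightarrow> (real^'n \<Rightarrow> real^'n) \<times> (real^'n \<Rightarrow> real) \<Rightarrow> real" where
  "triple_norm lam = (\<lambda>(w, u). sqrt ((L2_norm (Jac w))\<^sup>2 + 2 * lam * (L2_norm (grad u))\<^sup>2
     + lam\<^sup>2 * (L2_norm u)\<^sup>2))"

section \<open>The Hamilton-Jacobi-Bellman operator and the mixed formulation\<close>

text \<open>
  For real matrices, \<open>norm\<close> is the Frobenius norm and \<open>\<bullet>\<close> the Frobenius inner product.
\<close>

definition cordes_sum ::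
    "(real^'n \<Rightarrow> 'l \<Rightarrow> real^'n^'n) \<Rightarrow> (real^'n \<Rightarrow> 'l \<Rightarrow> real^'n) \<Rightarrow> (real^'n \<Rightarrow> 'l \<Rightarrow> real) \<Rightarrow>
     real \<Rightarrow> real^'n \<Rightarrow> 'l \<Rightarrow> real" where
  "cordes_sum A b c lam y \<alpha> =
     (norm (A y \<alpha>))\<^sup>2 + (norm (b y \<alpha>))\<^sup>2 / (2 * lam) + (c y \<alpha>)\<^sup>2 / lam\<^sup>2"

definition gamma_fun ::
    "(real^'n \<Rightarrow> 'l \<Rightarrow> real^'n^'n) \<Rightarrow> (real^'n \<Rightarrow> 'l \<Rightarrow> real^'n) \<Rightarrow> (real^'n \<Rightarrow> 'l \<Rightarrow> real) \<Rightarrow>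
     real \<Rightarrow> real^'n \<Rightarrow> 'l \<Rightarrow> real" where
  "gamma_fun A b c lam y \<alpha> = inverse (cordes_sum A b c lam y \<alpha>) * (trace (A y \<alpha>) + c y \<alpha> / lam)"

definition F_gamma ::
    "'l set \<Rightarrow> (real^'n \<Rightarrow> 'l \<Rightarrow> real^'n^'n) \<Rightarrow> (real^'n \<Rightarrow> 'l \<Rightarrow> real^'n) \<Rightarrow>
     (real^'n \<Rightarrow> 'l \<Rightarrow> real) \<Rightarrow> (real^'n \<Rightarrow> 'l \<Rightarrow> real) \<Rightarrow> real \<Rightarrow>
     (real^'n \<Rightarrow> real^'n) \<times> (real^'n \<Rightarrow> real) \<Rightarrow> real^'n \<Rightarrow> real" where
  "F_gamma \<Lambda> A b c f lam = (\<lambda>(w, u) y.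
     SUP \<alpha>\<in>\<Lambda>. gamma_fun A b c lam y \<alpha> *
       (- (A y \<alpha> \<bullet> Jac w y) - b y \<alpha> \<bullet> grad u y + c y \<alpha> * u y - f y \<alpha>))"

definition sigma1 :: "real \<Rightarrow> real" where
  "sigma1 \<delta> = 1 - 1/2 * sqrt (1 - \<delta>)"

definition sigma2_tilde :: "real \<Rightarrow> real" where
  "sigma2_tilde \<delta> = (1 - sqrt (1 - \<delta>)) / 2 + 1 / (4 * (1 - sqrt (1 - \<delta>)))"

definition sigma2 :: "real \<Rightarrow> real \<Rightarrow> real" where
  "sigma2 \<delta> lam = lam * sigma2_tilde \<delta>"

definition C_M :: "real \<Rightarrow> real" where
  "C_M \<delta> = 1/4 * (1 - sqrt (1 - \<delta>))"

definition C_L :: "nat \<Rightarrow> real \<Rightarrow> real \<Rightarrow> real" where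
  "C_L n \<delta> lam = 2 + sqrt 2 * sqrt (1 - \<delta>) + sigma1 \<delta>
     + sigma2_tilde \<delta> * (1/2 + real n / pi\<^sup>2 * lam)"

definition a_form ::
    "'l set \<Rightarrow> (real^'n::{finite,comm_ring_1} \<Rightarrow> 'l \<Rightarrow> real^'n::{finite,comm_ring_1}^'n::{finite,comm_ring_1}) \<Rightarrow>
     (real^'n::{finite,comm_ring_1} \<Rightarrow> 'l \<Rightarrow> real^'n::{finite,comm_ring_1}) \<Rightarrow> (real^'n::{finite,comm_ring_1} \<Rightarrow> 'l \<Rightarrow> real) \<Rightarrow> (real^'n::{finite,comm_ring_1} \<Rightarrow> 'l \<Rightarrow> real) \<Rightarrow>
     real \<Rightarrow> real \<Rightarrow>
     (real^'n::{finite,comm_ring_1} \<Rightarrow> real^'n::{finite,comm_ring_1}) \<times> (real^'n::{finite,comm_ring_1} \<Rightarrow> real) \<Rightarrow>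
     (real^'n::{finite,comm_ring_1} \<Rightarrow> real^'n::{finite,comm_ring_1}) \<times> (real^'n::{finite,comm_ring_1} \<Rightarrow> real) \<Rightarrow> real" where
  "a_form \<Lambda> A b c f lam \<delta> = (\<lambda>(w, u) (w', u').
     (LINT y|cell_measure. F_gamma \<Lambda> A b c f lam (w, u) y * L_op lam (w', u') y)
     + sigma1 \<delta> * (LINT y|cell_measure. rot w y \<bullet> rot w' y)
     + sigma2 \<delta> lam * (LINT y|cell_measure. (grad u y - w y) \<bullet> (grad u' y - w' y)))"

definition b_form ::
    "(real^'n \<Rightarrow> real) \<Rightarrow> (real^'n \<Rightarrow> real^'n) \<times> (real^'n \<Rightarrow> real) \<Rightarrow> real" where
  "b_form m = (\<lambda>(w, u). LINT y|cell_measure. grad m y \<bullet> (grad u y - w y))"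

end

theory Submission
  imports Defs
begin

text \<open>
  Testing the continuous equation with \<open>(\<nabla>v, v)\<close> for trigonometric v kills the rot, defect and
  multiplier terms and leaves a positive multiple of a Fourier coefficient of \<open>F[(w, u)]\<close>; hence
  \<open>F[(w, u)] = 0\<close>, and testing with \<open>(w, u)\<close> itself then gives \<open>rot w = 0\<close> and \<open>\<nabla>u = w\<close>.
  The residual quantities of \<open>(w\<^sub>h, u\<^sub>h)\<close> are therefore those of the error e, up to sign. By the
  Cordes condition \<open>F[(w\<^sub>h, u\<^sub>h)] + L e\<close> is bounded pointwise by \<open>sqrt (1 - \<delta>)\<close> times the integrand
  of the triple norm of e, and both bounds follow from Young's inequality and the identity
  \<open>\<parallel>Dw\<parallel>\<^sup>2 = \<parallel>div w\<parallel>\<^sup>2 + \<parallel>rot w\<parallel>\<^sup>2\<close>. This identity, integration by parts and the Poincare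
  inequality are read off from Parseval's identity, since the weak gradient acts on Fourier
  coefficients by multiplication with the frequency.
\<close>

section \<open>Integration over the unit cell\<close>

text \<open>The pair \<open>(\<nabla>v, v)\<close> is singled out because \<open>L\<close> maps it
  to \<open>-\<Delta>v + lam v\<close>, and a wave is an eigenfunction of this operator with an
  eigenvalue of at least \<open>lam\<close>. Completeness of the waves therefore takes the place of
  elliptic regularity. The obstacle throughout is that \<open>grad\<close> picks an arbitrary
  representative, so gradients are known only almost everywhere; Fourier coefficients determine them
  exactly to that extent. Everything is kept real: shifting the phase of a cosine by
  \<open>pi/2\<close> plays the role of multiplication by the imaginary unit. The constants are made
  for Young's inequality. With \<open>s = sqrt (1 - \<delta>)\<close>, the share
  \<open>(1 - s) / 2\<close> of the squared triple norm survives absorption, which explains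
  \<open>C_M\<close>, a quarter of \<open>1 - s\<close>. Four times the summand
  \<open>lam / (4 * (1 - s))\<close> of \<open>sigma2\<close> is exactly the coefficient that the
  squared defect receives when its product with the gradient error is split.\<close>

lemma unit_cell_eq_box: "(unit_cell :: (real^'n) set) = box 0 (\<chi> i. 1)"
  by (auto simp: unit_cell_def mem_box_cart)

lemma unit_cell_subset_cbox: "(unit_cell :: (real^'n) set) \<subseteq> cbox 0 (\<chi> i. 1)"
  unfolding unit_cell_eq_box by (rule box_subset_cbox)

lemma unit_cell_sets [measurable, simp]: "(unit_cell :: (real^'n) set) \<in> sets lebesgue"
  "(unit_cell :: (real^'n) set) \<in> sets borel"
  unfolding unit_cell_eq_box by auto

lemma emeasure_unit_cell: "emeasure lebesgue (unit_cell :: (real^'n) set) = 1"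
proof -
  have "measure lebesgue (cbox (0::real^'n) (\<chi> i. 1)) = 1"
    using content_cbox_cart[of 0 "(\<chi> i. 1)::real^'n"] interval_ne_empty_cart(1)[of 0 "(\<chi> i. 1)::real^'n"]
    by simp
  then have "measure lebesgue (unit_cell :: (real^'n) set) = 1"
    unfolding unit_cell_eq_box by (simp add: measure_lborel_box_eq measure_lborel_cbox_eq)
  moreover have "(unit_cell :: (real^'n) set) \<in> lmeasurable"
    unfolding unit_cell_eq_box by simp
  ultimately show ?thesis
    by (simp add: emeasure_eq_measure2 fmeasurableD2)
qed

lemma space_cell_measure [simp]: "space (cell_measure :: (real^'n) measure) = unit_cell"
  by (simp add: space_restrict_space)

lemma finite_measure_cell: "finite_measure (cell_measure :: (real^'n) measure)"
proof
  show "emeasure (cell_measure :: (real^'n) measure) (space cell_measure) \<noteq> \<infinity>"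
    using emeasure_unit_cell[where 'n='n] by (simp add: emeasure_restrict_space)
qed

lemma measure_cell [simp]: "measure (cell_measure :: (real^'n) measure) unit_cell = 1"
  using emeasure_unit_cell[where 'n='n] by (simp add: measure_def emeasure_restrict_space)

lemma continuous_measurable_cell:
  fixes g :: "real^'n \<Rightarrow> 'b::euclidean_space"
  assumes "continuous_on UNIV g"
  shows "g \<in> borel_measurable cell_measure"
proof -
  have "g \<in> borel_measurable borel"
    using assms by (rule borel_measurable_continuous_onI)
  then have "g \<in> borel_measurable lebesgue"
    by (simp add: measurable_completion)
  then show ?thesis
    by (rule measurable_restrict_space1)
qed

lemma bounded_integrable_cell:
  fixes g :: "real^'n \<Rightarrow> 'b::euclidean_space"
  assumes "g \<in> borel_measurable cell_measure" "\<And>x. x \<in> unit_cell \<Longrightarrow> norm (g x) \<le> B"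
  shows "integrable cell_measure g"
  by (rule finite_measure.integrable_const_bound[OF finite_measure_cell, of _ B])
     (use assms in \<open>auto intro!: AE_I2\<close>)

text \<open>The cube of side 2, not the cell, is used so that the bound also covers
  \<open>x + axis i t\<close> for \<open>x\<close> in the cell and \<open>0 \<le> t \<le> 1\<close>,
  as difference quotients require.\<close>

lemma continuous_bounded_cell:
  fixes g :: "real^'n \<Rightarrow> 'b::real_normed_vector"
  assumes "continuous_on UNIV g"
  obtains B where "\<And>x. x \<in> cbox 0 (\<chi> i. 2) \<Longrightarrow> norm (g x) \<le> B"
proof -
  have "compact (g ` cbox 0 (\<chi> i. 2))"
    using assms by (intro compact_continuous_image) (auto intro: continuous_on_subset)
  then have "bounded (g ` cbox 0 (\<chi> i. 2))"
    by (rule compact_imp_bounded)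
  then show ?thesis
    using that by (auto simp: bounded_iff)
qed

lemma unit_cell_subset_cbox2: "(unit_cell :: (real^'n) set) \<subseteq> cbox 0 (\<chi> i. 2)"
proof
  fix x :: "real^'n" assume "x \<in> unit_cell"
  then have x: "0 < x $ i \<and> x $ i < 1" for i by (simp add: unit_cell_def)
  have "0 \<le> x $ i \<and> x $ i \<le> 2" for i using x[of i] by linarith
  then show "x \<in> cbox 0 (\<chi> i. 2)" by (simp add: mem_box_cart)
qed

lemma continuous_integrable_cell:
  fixes g :: "real^'n \<Rightarrow> 'b::euclidean_space"
  assumes "continuous_on UNIV g"
  shows "integrable cell_measure g"
proof -
  obtain B where "\<And>x. x \<in> cbox 0 (\<chi> i. 2) \<Longrightarrow> norm (g x) \<le> B"
    using continuous_bounded_cell[OF assms] by blast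
  then show ?thesis
    using bounded_integrable_cell[OF continuous_measurable_cell[OF assms]] unit_cell_subset_cbox2 by blast
qed

lemma bounded_support_integrable_lborel:
  fixes g :: "real^'n \<Rightarrow> real"
  assumes "continuous_on UNIV g" "S \<in> sets borel" "S \<subseteq> cbox a b"
  shows "integrable lborel (\<lambda>x. indicator S x * g x)"
proof -
  have "integrable lborel (\<lambda>x. indicator (cbox a b) x *\<^sub>R g x)"
    using borel_integrable_compact[OF compact_cbox, of a b g] assms(1)
    by (auto intro: continuous_on_subset)
  then have "integrable lborel (\<lambda>x. indicator S x *\<^sub>R (indicator (cbox a b) x *\<^sub>R g x))"
    by (rule integrable_mult_indicator[rotated]) (use assms(2) in simp)
  moreover have "indicator S x *\<^sub>R (indicator (cbox a b) x *\<^sub>R g x) = indicator S x * g x" for x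
    using assms(3) by (auto simp: indicator_def)
  ultimately show ?thesis by (simp only:)
qed

text \<open>A fundamental domain of the integer translations: its translates tile space without
  overlap, so cutting off and moving slabs is an exact identity of indicator functions, with no null
  sets to discard.\<close>

definition half_open_cell :: "(real^'n) set" where
  "half_open_cell = {x. \<forall>i. 0 \<le> x $ i \<and> x $ i < 1}"

lemma half_open_cell_subset: "(half_open_cell :: (real^'n) set) \<subseteq> cbox 0 (\<chi> i. 1)"
  by (auto simp: half_open_cell_def mem_box_cart less_imp_le)

lemma half_open_cell_sets [measurable]: "(half_open_cell :: (real^'n) set) \<in> sets borel"
  unfolding half_open_cell_def by measurable

text \<open>The two cells differ only within the frontier of a box, a null set. The right-hand side
  is taken over \<open>lborel\<close>, where translation invariance is available.\<close>

lemma cell_integral_eq_half_open: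
  fixes g :: "real^'n \<Rightarrow> real"
  assumes "continuous_on UNIV g"
  shows "(LINT x|cell_measure. g x) = (LINT x|lborel. indicator half_open_cell x * g x)"
proof -
  have m: "g \<in> borel_measurable borel"
    using assms by (rule borel_measurable_continuous_onI)
  have "(LINT x|cell_measure. g x) = (LINT x|lebesgue. indicator unit_cell x * g x)"
    by (simp add: integral_restrict_space)
  also have "\<dots> = (LINT x|lborel. indicator unit_cell x * g x)"
    using m by (intro integral_completion) measurable
  also have "\<dots> = (LINT x|lborel. indicator half_open_cell x * g x)"
  proof (intro integral_cong_AE)
    have "emeasure lborel (cbox (0::real^'n) (\<chi> i. 1) - box 0 (\<chi> i. 1)) = 0"
      using negligible_frontier_interval[of "0::real^'n" "\<chi> i. 1"]
      by (simp add: negligible_iff_null_sets null_sets_def)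
    then have "AE x in lborel. x \<notin> cbox (0::real^'n) (\<chi> i. 1) - box 0 (\<chi> i. 1)"
      by (intro AE_not_in) (auto simp: null_sets_def)
    then show "AE x in lborel. indicator unit_cell x * g x = indicator half_open_cell x * g x"
    proof eventually_elim
      case (elim x)
      have "x \<in> unit_cell \<longleftrightarrow> x \<in> half_open_cell"
        using elim half_open_cell_subset unfolding unit_cell_eq_box[symmetric]
        by (auto simp: unit_cell_def half_open_cell_def less_imp_le)
      then show ?case by (simp add: indicator_def)
    qed
  qed (use m in measurable)
  finally show ?thesis .
qed

section \<open>Translation invariance and integrals of partial derivatives\<close>

lemma lborel_integral_translate:
  fixes h :: "real^'n \<Rightarrow> real"
  assumes "h \<in> borel_measurable borel"
  shows "(LINT x|lborel. h (c + x)) = (LINT x|lborel. h x)"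
proof -
  have "(LINT x|lborel. h x) = (LINT x|distr lborel borel ((+) c). h x)"
    by (simp add: lborel_distr_plus)
  also have "\<dots> = (LINT x|lborel. h (c + x))"
    by (rule integral_distr) (use assms in auto)
  finally show ?thesis by simp
qed

text \<open>Moving the half-open cell by \<open>t\<close> in direction \<open>i\<close> loses the
  slab \<open>S\<close> and gains its copy moved by \<open>axis i 1\<close>; periodicity makes
  \<open>g\<close> agree on the two slabs.\<close>

lemma cell_integral_translate:
  fixes g :: "real^'n \<Rightarrow> real"
  assumes g: "continuous_on UNIV g" and per: "cell_periodic g" and t: "0 \<le> t" "t \<le> 1"
  shows "(LINT x|cell_measure. g (x + axis i t)) = (LINT x|cell_measure. g x)"
proof -
  let ?H = "half_open_cell :: (real^'n) set"
  define S where "S = {x \<in> ?H. x $ i < t}"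
  have S [measurable]: "S \<in> sets borel" unfolding S_def by measurable
  have m [measurable]: "g \<in> borel_measurable borel"
    using g by (rule borel_measurable_continuous_onI)
  have per': "g (axis i 1 + x) = g x" for x
    using per by (simp add: cell_periodic_def add.commute)
  have ind: "indicator ?H (x - axis i t) = (indicator ?H x + indicator S (x - axis i 1) - indicator S x :: real)" for x
  proof -
    have H: "x - axis i s \<in> ?H \<longleftrightarrow> s \<le> x $ i \<and> x $ i < 1 + s \<and> (\<forall>j. j \<noteq> i \<longrightarrow> 0 \<le> x $ j \<and> x $ j < 1)" for s
    proof -
      have "(0 \<le> (x - axis i s) $ j \<and> (x - axis i s) $ j < 1) \<longleftrightarrow>
        (if j = i then s \<le> x $ i \<and> x $ i < 1 + s else 0 \<le> x $ j \<and> x $ j < 1)" for j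
        by (auto simp: axis_def)
      then show ?thesis unfolding half_open_cell_def mem_Collect_eq by metis
    qed
    have "x - axis i 1 \<in> S \<longleftrightarrow> 1 \<le> x $ i \<and> x $ i < 1 + t \<and> (\<forall>j. j \<noteq> i \<longrightarrow> 0 \<le> x $ j \<and> x $ j < 1)"
      using H[of 1] t unfolding S_def by (auto simp: axis_def)
    moreover have "x \<in> S \<longleftrightarrow> 0 \<le> x $ i \<and> x $ i < t \<and> (\<forall>j. j \<noteq> i \<longrightarrow> 0 \<le> x $ j \<and> x $ j < 1)"
      using H[of 0] t unfolding S_def by (auto simp: axis_def zero_vec_def[symmetric])
    moreover have "x \<in> ?H \<longleftrightarrow> 0 \<le> x $ i \<and> x $ i < 1 \<and> (\<forall>j. j \<noteq> i \<longrightarrow> 0 \<le> x $ j \<and> x $ j < 1)"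
      unfolding half_open_cell_def by auto
    ultimately show ?thesis
      using H[of t] t unfolding indicator_def by auto
  qed
  have cont: "continuous_on UNIV (\<lambda>x. g (x + axis i t))"
    by (intro continuous_on_compose2[OF g]) (auto intro!: continuous_intros)
  have "(LINT x|cell_measure. g (x + axis i t)) = (LINT x|lborel. indicator ?H x * g (x + axis i t))"
    by (rule cell_integral_eq_half_open[OF cont])
  also have "\<dots> = (LINT x|lborel. (\<lambda>x. indicator ?H (x - axis i t) * g x) (axis i t + x))"
    by (simp add: add.commute)
  also have "\<dots> = (LINT x|lborel. indicator ?H (x - axis i t) * g x)"
    by (rule lborel_integral_translate) measurable
  also have "\<dots> = (LINT x|lborel. indicator ?H x * g x + (indicator S (x - axis i 1) * g x - indicator S x * g x))"
    by (simp add: ind algebra_simps)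
  also have "\<dots> = (LINT x|lborel. indicator ?H x * g x) + ((LINT x|lborel. indicator S (x - axis i 1) * g x) - (LINT x|lborel. indicator S x * g x))"
  proof -
    have Ssub: "S \<subseteq> cbox 0 (\<chi> i. 1)" using half_open_cell_subset unfolding S_def by blast
    have 1: "integrable lborel (\<lambda>x. indicator ?H x * g x)"
      by (rule bounded_support_integrable_lborel[OF g _ half_open_cell_subset]) measurable
    have 2: "integrable lborel (\<lambda>x. indicator S x * g x)"
      by (rule bounded_support_integrable_lborel[OF g S Ssub])
    have S': "{x. x - axis i 1 \<in> S} \<subseteq> cbox 0 (\<chi> i. 2)"
    proof
      fix x assume "x \<in> {x. x - axis i 1 \<in> S}"
      then have *: "0 \<le> (x - axis i 1) $ j \<and> (x - axis i 1) $ j < 1" for j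
        unfolding S_def half_open_cell_def by blast
      have "0 \<le> x $ j \<and> x $ j \<le> 2" for j
        using *[of j] by (auto simp: axis_def split: if_splits)
      then show "x \<in> cbox 0 (\<chi> i. 2)" by (auto simp: mem_box_cart)
    qed
    have "integrable lborel (\<lambda>x. indicator {x. x - axis i 1 \<in> S} x * g x)"
      by (rule bounded_support_integrable_lborel[OF g _ S']) measurable
    moreover have "indicator {x. x - axis i 1 \<in> S} x = (indicator S (x - axis i 1) :: real)" for x
      by (simp add: indicator_def)
    ultimately have 3: "integrable lborel (\<lambda>x. indicator S (x - axis i 1) * g x)"
      by simp
    show ?thesis using 1 2 3 by simp
  qed
  also have "(LINT x|lborel. indicator S (x - axis i 1) * g x) = (LINT x|lborel. indicator S x * g x)"
  proof -
    have "(LINT x|lborel. indicator S (x - axis i 1) * g x) =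
      (LINT x|lborel. indicator S (axis i 1 + x - axis i 1) * g (axis i 1 + x))"
      by (rule lborel_integral_translate[symmetric]) measurable
    then show ?thesis by (simp add: per')
  qed
  finally show ?thesis
    by (simp add: cell_integral_eq_half_open[OF g])
qed

lemma axis_scaleR: "axis i (t::real) = t *\<^sub>R axis i 1"
  by (simp add: axis_def vec_eq_iff)

lemma has_derivative_partial_deriv:
  assumes "f differentiable (at (x + axis i t))"
  shows "((\<lambda>t. f (x + axis i t)) has_real_derivative partial_deriv i f (x + axis i t)) (at t)"
proof -
  let ?D = "frechet_derivative f (at (x + axis i t))"
  have D: "(f has_derivative ?D) (at (x + axis i t))"
    using assms frechet_derivative_works by blast
  have "((\<lambda>t. x + axis i t) has_derivative (\<lambda>s. axis i s)) (at t)"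
    by (subst (1 2) axis_scaleR) (auto intro!: derivative_eq_intros)
  then have "((\<lambda>t. f (x + axis i t)) has_derivative (\<lambda>s. ?D (axis i s))) (at t)"
    using D by (rule has_derivative_compose)
  moreover have "?D (axis i s) = s * partial_deriv i f (x + axis i t)" for s
    using linear_cmul[OF has_derivative_linear[OF D], of s "axis i 1"]
    by (simp add: partial_deriv_def axis_scaleR[of i s])
  ultimately show ?thesis
    by (simp add: has_field_derivative_def mult.commute[of _ "partial_deriv i f (x + axis i t)"])
qed

text \<open>By translation invariance every difference quotient in direction \<open>i\<close> has
  integral zero. The mean value theorem bounds the quotients by a bound of the derivative on the
  cube of side 2, so dominated convergence passes to the limit.\<close>

lemma cell_integral_partial_deriv_zero:
  fixes f :: "real^'n \<Rightarrow> real"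
  assumes per: "cell_periodic f" and diff: "\<And>x. f differentiable (at x)"
    and cont: "continuous_on UNIV (partial_deriv i f)"
  shows "(LINT x|cell_measure. partial_deriv i f x) = 0"
proof -
  define \<epsilon> where "\<epsilon> n = inverse (real (Suc n))" for n
  have e: "\<epsilon> n > 0" "\<epsilon> n \<le> 1" for n unfolding \<epsilon>_def by (auto simp: inverse_le_1_iff)
  have e0: "\<epsilon> \<longlonglongrightarrow> 0" unfolding \<epsilon>_def using LIMSEQ_inverse_real_of_nat by simp
  have f: "continuous_on UNIV f"
    using diff by (simp add: continuous_on_eq_continuous_at differentiable_imp_continuous_within)
  define s where "s n x = (f (x + axis i (\<epsilon> n)) - f x) / \<epsilon> n" for n x
  have fs: "continuous_on UNIV (\<lambda>x. f (x + axis i t))" for t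
    by (intro continuous_on_compose2[OF f]) (auto intro!: continuous_intros)
  have s: "continuous_on UNIV (s n)" for n
    unfolding s_def using e[of n] by (intro continuous_intros fs f) auto
  have s0: "(LINT x|cell_measure. s n x) = 0" for n
  proof -
    have "(LINT x|cell_measure. s n x) = ((LINT x|cell_measure. f (x + axis i (\<epsilon> n))) - (LINT x|cell_measure. f x)) / \<epsilon> n"
      unfolding s_def using continuous_integrable_cell[OF fs] continuous_integrable_cell[OF f] by simp
    then show ?thesis
      using cell_integral_translate[OF f per, of "\<epsilon> n" i] e[of n] by simp
  qed
  obtain B where B: "\<And>x. x \<in> cbox 0 (\<chi> i. 2) \<Longrightarrow> norm (partial_deriv i f x) \<le> B"
    using continuous_bounded_cell[OF cont] by blast
  have "(\<lambda>n. LINT x|cell_measure. s n x) \<longlonglongrightarrow> (LINT x|cell_measure. partial_deriv i f x)"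
  proof (rule integral_dominated_convergence[where w = "\<lambda>_. B"])
    show "AE x in cell_measure. (\<lambda>n. s n x) \<longlonglongrightarrow> partial_deriv i f x"
    proof (rule AE_I2)
      fix x :: "real^'n"
      have "((\<lambda>t. f (x + axis i t)) has_real_derivative partial_deriv i f (x + axis i 0)) (at 0)"
        by (rule has_derivative_partial_deriv) (rule diff)
      then have "((\<lambda>h. (f (x + axis i (0 + h)) - f (x + axis i 0)) / h) \<longlongrightarrow> partial_deriv i f (x + axis i 0)) (at 0)"
        by (rule DERIV_D)
      then have *: "((\<lambda>h. (f (x + axis i h) - f x) / h) \<longlongrightarrow> partial_deriv i f x) (at 0)"
        by (simp add: axis_eq_0_iff[THEN iffD2])
      have "filterlim \<epsilon> (at 0) sequentially"
        using e0 e(1) by (intro filterlim_atI) (auto simp: less_imp_neq[symmetric] intro!: always_eventually)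
      from filterlim_compose[OF * this] show "(\<lambda>n. s n x) \<longlonglongrightarrow> partial_deriv i f x"
        by (simp add: s_def)
    qed
    show "AE x in cell_measure. norm (s n x) \<le> B" for n
    proof (rule AE_I2)
      fix x :: "real^'n" assume "x \<in> space cell_measure"
      then have x: "\<forall>j. 0 < x $ j \<and> x $ j < 1" by (simp add: unit_cell_def)
      have "\<exists>z. 0 < z \<and> z < \<epsilon> n \<and> f (x + axis i (\<epsilon> n)) - f (x + axis i 0) = (\<epsilon> n - 0) * partial_deriv i f (x + axis i z)"
        by (rule MVT2[OF e(1)]) (auto intro: has_derivative_partial_deriv diff)
      then obtain z where z: "0 < z" "z < \<epsilon> n" "f (x + axis i (\<epsilon> n)) - f x = \<epsilon> n * partial_deriv i f (x + axis i z)"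
        by (auto simp: axis_eq_0_iff[THEN iffD2])
      have "s n x = partial_deriv i f (x + axis i z)"
        using z e[of n] by (simp add: s_def)
      moreover have "x + axis i z \<in> cbox 0 (\<chi> i. 2)"
      proof -
        have "0 \<le> (x + axis i z) $ j \<and> (x + axis i z) $ j \<le> 2" for j
          using x[rule_format, of j] z e(2)[of n] by (auto simp: axis_def)
        then show ?thesis by (auto simp: mem_box_cart)
      qed
      ultimately show "norm (s n x) \<le> B" using B by auto
    qed
    show "integrable cell_measure (\<lambda>_::real^'n. B)"
      by (rule continuous_integrable_cell) auto
  qed (auto intro!: continuous_measurable_cell s cont)
  then show ?thesis using s0 LIMSEQ_unique[OF _ tendsto_const] by simp
qed

section \<open>Trigonometric polynomials and square-integrable functions\<close>

text \<open>The integer vectors, embedded in \<open>real^'n\<close> so that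
  \<open>k \<bullet> x\<close> makes sense as an inner product.\<close>

definition freqs :: "(real^'n) set" where
  "freqs = {k. \<forall>i. k $ i \<in> \<int>}"

text \<open>The phase keeps everything real while closing the family under differentiation: phase 0
  is the cosine, phase \<open>pi/2\<close> is minus the sine, and each derivative shifts the phase
  by \<open>pi/2\<close>.\<close>

definition wave :: "real^'n \<Rightarrow> real \<Rightarrow> real^'n \<Rightarrow> real" where
  "wave k t x = cos (2 * pi * (k \<bullet> x) + t)"

lemma freqs_0 [simp]: "0 \<in> freqs"
  and freqs_uminus: "k \<in> freqs \<Longrightarrow> - k \<in> freqs"
  and freqs_add: "k \<in> freqs \<Longrightarrow> l \<in> freqs \<Longrightarrow> k + l \<in> freqs"
  and freqs_diff: "k \<in> freqs \<Longrightarrow> l \<in> freqs \<Longrightarrow> k - l \<in> freqs"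
  and freqs_axis: "axis i 1 \<in> freqs"
  by (auto simp: freqs_def axis_def)

lemma continuous_on_wave [continuous_intros]: "continuous_on S (wave k t)"
  unfolding wave_def by (intro continuous_intros)

lemma cell_periodic_wave: "k \<in> freqs \<Longrightarrow> cell_periodic (wave k t)"
  unfolding cell_periodic_def wave_def freqs_def
proof (intro allI)
  fix x i assume "k \<in> {k. \<forall>i. k $ i \<in> \<int>}"
  then obtain m where m: "k $ i = of_int m" by (auto elim: Ints_cases)
  have "2 * pi * (k \<bullet> (x + axis i 1)) + t = (2 * pi * (k \<bullet> x) + t) + 2 * pi * of_int m"
    by (simp add: inner_add_right inner_axis m algebra_simps)
  then show "cos (2 * pi * (k \<bullet> (x + axis i 1)) + t) = cos (2 * pi * (k \<bullet> x) + t)"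
    by (simp only: sin_cos_eq_iff[of _ "2 * pi * (k \<bullet> x) + t", THEN iffD2, OF exI[of _ m]])
qed

lemma has_derivative_wave:
  "((\<lambda>x. r * wave k t x) has_derivative (\<lambda>h. (2 * pi * r * (k \<bullet> h)) * wave k (t + pi/2) x)) (at x)"
proof -
  have "((\<lambda>x. r * wave k t x) has_derivative (\<lambda>h. r * (- sin (2 * pi * (k \<bullet> x) + t) * (2 * pi * (k \<bullet> h))))) (at x)"
    unfolding wave_def by (auto intro!: derivative_eq_intros)
  moreover have "wave k (t + pi/2) x = - sin (2 * pi * (k \<bullet> x) + t)"
    by (simp add: wave_def minus_sin_cos_eq add.assoc)
  ultimately show ?thesis by (simp add: mult_ac)
qed

lemma partial_deriv_wave:
  "partial_deriv i (\<lambda>x. r * wave k t x) = (\<lambda>x. (2 * pi * r * (k $ i)) * wave k (t + pi/2) x)"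
  unfolding partial_deriv_def
  by (rule ext, subst frechet_derivative_at[OF has_derivative_wave, symmetric]) (simp add: inner_axis)

lemma wave_differentiable: "(\<lambda>x. r * wave k t x) differentiable (at x)"
  using has_derivative_wave differentiable_def by blast

lemma C_k_wave: "C_k n (\<lambda>x. r * wave k t x)"
proof (induction n arbitrary: r t)
  case 0
  then show ?case by (auto intro!: continuous_intros)
next
  case (Suc n)
  show ?case
    unfolding C_k.simps partial_deriv_wave using Suc wave_differentiable by blast
qed

lemma C_inf_per_wave: "k \<in> freqs \<Longrightarrow> (\<lambda>x. r * wave k t x) \<in> C_inf_per"
  using cell_periodic_wave[of k t] C_k_wave by (auto simp: C_inf_per_def cell_periodic_def)

text \<open>For \<open>k \<noteq> 0\<close> the wave is itself a partial derivative of a periodic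
  wave, taken in a direction with \<open>k $ i \<noteq> 0\<close>.\<close>

lemma cell_integral_wave:
  assumes k: "k \<in> freqs"
  shows "(LINT x|cell_measure. wave k t x) = (if k = 0 then cos t else 0)"
proof (cases "k = 0")
  case True
  then show ?thesis by (simp add: wave_def)
next
  case False
  then obtain i where i: "k $ i \<noteq> 0" by (auto simp: vec_eq_iff)
  define r where "r = 1 / (2 * pi * k $ i)"
  have r: "2 * pi * r * k $ i = 1" using i by (simp add: r_def)
  have pd: "partial_deriv i (\<lambda>x. r * wave k (t - pi/2) x) = wave k t"
    unfolding partial_deriv_wave r by simp
  have "(LINT x|cell_measure. partial_deriv i (\<lambda>x. r * wave k (t - pi/2) x) x) = 0"
    using cell_periodic_wave[OF k]
    by (intro cell_integral_partial_deriv_zero wave_differentiable)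
       (auto simp: cell_periodic_def pd intro!: continuous_intros)
  then show ?thesis using False by (simp add: pd)
qed

lemma wave_mult: "wave k s x * wave l t x = (wave (k - l) (s - t) x + wave (k + l) (s + t) x) / 2"
  unfolding wave_def cos_times_cos by (simp add: inner_diff_left inner_add_left algebra_simps)

text \<open>Products are not among the rules; the product-to-sum formula gives closure under them
  (\<open>trig_mult\<close>), and this makes the set an algebra as Stone-Weierstrass
  requires.\<close>

inductive_set trig_polys :: "(real^'n \<Rightarrow> real) set" where
  trig_wave: "k \<in> freqs \<Longrightarrow> wave k t \<in> trig_polys"
| trig_add: "p \<in> trig_polys \<Longrightarrow> q \<in> trig_polys \<Longrightarrow> (\<lambda>x. p x + q x) \<in> trig_polys"
| trig_scale: "p \<in> trig_polys \<Longrightarrow> (\<lambda>x. r * p x) \<in> trig_polys"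

lemma trig_mult_wave:
  assumes "q \<in> trig_polys" "k \<in> freqs"
  shows "(\<lambda>x. wave k s x * q x) \<in> trig_polys"
  using assms(1)
proof induction
  case (trig_wave l t)
  have "(\<lambda>x. wave k s x * wave l t x) = (\<lambda>x. (1/2) * (wave (k - l) (s - t) x + wave (k + l) (s + t) x))"
    by (simp add: wave_mult)
  also have "\<dots> \<in> trig_polys"
    by (intro trig_polys.intros freqs_add freqs_diff assms trig_wave)
  finally show ?case .
next
  case (trig_add p q)
  then show ?case using trig_polys.trig_add by (auto simp: distrib_left)
next
  case (trig_scale p r)
  have "(\<lambda>x. wave k s x * (r * p x)) = (\<lambda>x. r * (wave k s x * p x))" by (simp add: mult_ac)
  then show ?case using trig_polys.trig_scale[OF trig_scale.IH] by simp
qed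

lemma trig_mult:
  assumes "p \<in> trig_polys" "q \<in> trig_polys"
  shows "(\<lambda>x. p x * q x) \<in> trig_polys"
  using assms(1)
proof induction
  case (trig_wave l t)
  then show ?case using trig_mult_wave assms(2) by blast
next
  case (trig_add p q)
  then show ?case using trig_polys.trig_add by (auto simp: distrib_right)
next
  case (trig_scale p r)
  then show ?case using trig_polys.trig_scale by (auto simp: mult.assoc)
qed

lemma trig_const: "(\<lambda>x. c) \<in> trig_polys"
proof -
  have "(\<lambda>x. c * wave 0 0 x) \<in> trig_polys" by (intro trig_polys.intros freqs_0)
  then show ?thesis by (simp add: wave_def)
qed

lemma trig_continuous: "p \<in> trig_polys \<Longrightarrow> continuous_on S p"
  by (induction rule: trig_polys.induct) (auto intro!: continuous_intros)

text \<open>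
  The two sums are the real and the imaginary part of the complex trigonometric polynomial with
  coefficients \<open>\<alpha> k + \<i> \<beta> k\<close>.
\<close>

lemma trig_poly_coefficients:
  assumes "p \<in> trig_polys"
  shows "\<exists>K0 \<alpha> \<beta>. finite K0 \<and> K0 \<subseteq> freqs \<and> (\<forall>K x. finite K \<longrightarrow> K0 \<subseteq> K \<longrightarrow>
    p x = (\<Sum>k\<in>K. \<alpha> k * wave k 0 x + \<beta> k * wave k (pi/2) x) \<and>
    0 = (\<Sum>k\<in>K. \<beta> k * wave k 0 x - \<alpha> k * wave k (pi/2) x))"
  using assms
proof induction
  case (trig_wave k t)
  \<comment> \<open>A cosine with phase \<open>t\<close> is half of \<open>exp (i t)\<close> times
    the exponential of frequency \<open>k\<close>, plus the conjugate at \<open>- k\<close>. The two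
    contributions are added rather than chosen by cases, so that \<open>k = 0\<close>, where both
    frequencies coincide, is covered.\<close>
  define \<alpha> where "\<alpha> j = (if j = k then cos t / 2 else 0) + (if j = - k then cos t / 2 else 0)" for j
  define \<beta> where "\<beta> j = (if j = k then sin t / 2 else 0) + (if j = - k then - sin t / 2 else 0)" for j
  have if_mult: "(if b then x else 0) * y = (if b then x * y else 0)" for b and x y :: real
    by simp
  have w: "wave (- k) 0 x = wave k 0 x" "wave (- k) (pi/2) x = - wave k (pi/2) x" for x
    by (simp_all add: wave_def cos_add cos_diff)
  have w': "wave k t x = cos t * wave k 0 x + sin t * wave k (pi/2) x" for x
    by (simp add: wave_def cos_add)
  show ?case
  proof (rule exI[of _ "{k, - k}"], rule exI[of _ \<alpha>], rule exI[of _ \<beta>], intro conjI allI impI)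
    fix K x assume K: "finite K" "{k, - k} \<subseteq> K"
    have S: "(\<Sum>j\<in>K. (if j = k then a else 0) * h j) = a * h k"
      "(\<Sum>j\<in>K. (if j = - k then a else 0) * h j) = a * h (- k)" for a and h :: "_ \<Rightarrow> real"
      using K by (simp_all add: if_mult sum.delta)
    show "wave k t x = (\<Sum>j\<in>K. \<alpha> j * wave j 0 x + \<beta> j * wave j (pi/2) x)"
      unfolding \<alpha>_def \<beta>_def distrib_right sum.distrib S w w' by simp
    show "0 = (\<Sum>j\<in>K. \<beta> j * wave j 0 x - \<alpha> j * wave j (pi/2) x)"
      unfolding \<alpha>_def \<beta>_def distrib_right sum_subtractf sum.distrib S w w' by simp
  qed (use trig_wave freqs_uminus[of k] in simp_all)
next
  case (trig_add p q)
  obtain K0 \<alpha> \<beta> where 1: "finite K0" "K0 \<subseteq> freqs" and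
    p: "\<forall>K x. finite K \<longrightarrow> K0 \<subseteq> K \<longrightarrow>
      p x = (\<Sum>k\<in>K. \<alpha> k * wave k 0 x + \<beta> k * wave k (pi/2) x) \<and>
      0 = (\<Sum>k\<in>K. \<beta> k * wave k 0 x - \<alpha> k * wave k (pi/2) x)"
    using trig_add.IH(1) by (elim exE conjE) (rule that)
  obtain K0' \<alpha>' \<beta>' where 2: "finite K0'" "K0' \<subseteq> freqs" and
    q: "\<forall>K x. finite K \<longrightarrow> K0' \<subseteq> K \<longrightarrow>
      q x = (\<Sum>k\<in>K. \<alpha>' k * wave k 0 x + \<beta>' k * wave k (pi/2) x) \<and>
      0 = (\<Sum>k\<in>K. \<beta>' k * wave k 0 x - \<alpha>' k * wave k (pi/2) x)"
    using trig_add.IH(2) by (elim exE conjE) (rule that)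
  show ?case
  proof (rule exI[of _ "K0 \<union> K0'"], rule exI[of _ "\<lambda>k. \<alpha> k + \<alpha>' k"], rule exI[of _ "\<lambda>k. \<beta> k + \<beta>' k"],
      intro conjI allI impI)
    fix K x assume K: "finite K" "K0 \<union> K0' \<subseteq> K"
    then have K': "K0 \<subseteq> K" "K0' \<subseteq> K" by auto
    note pK = p[rule_format, OF K(1) K'(1), of x] and qK = q[rule_format, OF K(1) K'(2), of x]
    show "p x + q x = (\<Sum>k\<in>K. (\<alpha> k + \<alpha>' k) * wave k 0 x + (\<beta> k + \<beta>' k) * wave k (pi/2) x)"
      unfolding pK[THEN conjunct1] qK[THEN conjunct1] sum.distrib[symmetric] by (simp add: algebra_simps)
    have "(\<Sum>k\<in>K. (\<beta> k + \<beta>' k) * wave k 0 x - (\<alpha> k + \<alpha>' k) * wave k (pi/2) x) =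
      (\<Sum>k\<in>K. \<beta> k * wave k 0 x - \<alpha> k * wave k (pi/2) x) + (\<Sum>k\<in>K. \<beta>' k * wave k 0 x - \<alpha>' k * wave k (pi/2) x)"
      unfolding sum.distrib[symmetric] by (simp add: algebra_simps)
    then show "0 = (\<Sum>k\<in>K. (\<beta> k + \<beta>' k) * wave k 0 x - (\<alpha> k + \<alpha>' k) * wave k (pi/2) x)"
      using pK qK by linarith
  qed (use 1 2 in auto)
next
  case (trig_scale p r)
  obtain K0 \<alpha> \<beta> where 1: "finite K0" "K0 \<subseteq> freqs" and
    p: "\<forall>K x. finite K \<longrightarrow> K0 \<subseteq> K \<longrightarrow>
      p x = (\<Sum>k\<in>K. \<alpha> k * wave k 0 x + \<beta> k * wave k (pi/2) x) \<and>
      0 = (\<Sum>k\<in>K. \<beta> k * wave k 0 x - \<alpha> k * wave k (pi/2) x)"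
    using trig_scale.IH by (elim exE conjE) (rule that)
  show ?case
  proof (rule exI[of _ K0], rule exI[of _ "\<lambda>k. r * \<alpha> k"], rule exI[of _ "\<lambda>k. r * \<beta> k"], intro conjI allI impI)
    fix K x assume K: "finite K" "K0 \<subseteq> K"
    note pK = p[rule_format, OF K, of x]
    show "r * p x = (\<Sum>k\<in>K. r * \<alpha> k * wave k 0 x + r * \<beta> k * wave k (pi/2) x)"
      unfolding pK[THEN conjunct1] sum_distrib_left by (simp add: algebra_simps)
    have "(\<Sum>k\<in>K. r * \<beta> k * wave k 0 x - r * \<alpha> k * wave k (pi/2) x) =
      r * (\<Sum>k\<in>K. \<beta> k * wave k 0 x - \<alpha> k * wave k (pi/2) x)"
      unfolding sum_distrib_left by (simp add: algebra_simps)
    then show "0 = (\<Sum>k\<in>K. r * \<beta> k * wave k 0 x - r * \<alpha> k * wave k (pi/2) x)"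
      using pK by simp
  qed (use 1 in auto)
qed

text \<open>Square integrability without the periodicity demanded by \<open>L2_per\<close>:
  integrals over the cell see only the cell, so periodicity need not be carried along for derived
  functions such as \<open>F_gamma\<close>.\<close>

definition sq_int :: "(real^'n \<Rightarrow> 'b::euclidean_space) \<Rightarrow> bool" where
  "sq_int f \<longleftrightarrow> f \<in> borel_measurable cell_measure \<and> integrable cell_measure (\<lambda>x. (norm (f x))\<^sup>2)"

lemma sq_int_measurable: "sq_int f \<Longrightarrow> f \<in> borel_measurable cell_measure"
  by (simp add: sq_int_def)

lemma sq_int_bound:
  fixes f :: "real^'n \<Rightarrow> 'b::euclidean_space"
  assumes "f \<in> borel_measurable cell_measure" "integrable cell_measure h"
    "\<And>x. x \<in> unit_cell \<Longrightarrow> (norm (f x))\<^sup>2 \<le> h x"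
  shows "sq_int f"
  unfolding sq_int_def
proof
  show "integrable cell_measure (\<lambda>x. (norm (f x))\<^sup>2)"
    by (rule Bochner_Integration.integrable_bound[OF assms(2)])
       (use assms(1,3) in \<open>auto intro!: AE_I2 order_trans[OF assms(3)]\<close>)
qed (use assms in auto)

lemma sq_int_inner_integrable:
  fixes f g :: "real^'n \<Rightarrow> 'b::euclidean_space"
  assumes "sq_int f" "sq_int g"
  shows "integrable cell_measure (\<lambda>x. f x \<bullet> g x)"
proof (rule Bochner_Integration.integrable_bound)
  show "integrable cell_measure (\<lambda>x. (norm (f x))\<^sup>2 + (norm (g x))\<^sup>2)"
    using assms by (auto simp: sq_int_def)
  show "(\<lambda>x. f x \<bullet> g x) \<in> borel_measurable cell_measure"
    using assms[THEN sq_int_measurable] by measurable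
  have "\<bar>f x \<bullet> g x\<bar> \<le> (norm (f x))\<^sup>2 + (norm (g x))\<^sup>2" for x
  proof -
    have "\<bar>f x \<bullet> g x\<bar> \<le> norm (f x) * norm (g x)" by (rule Cauchy_Schwarz_ineq2)
    also have "\<dots> \<le> (norm (f x))\<^sup>2 + (norm (g x))\<^sup>2"
      using sum_squares_bound[of "norm (f x)" "norm (g x)"]
        mult_nonneg_nonneg[OF norm_ge_zero norm_ge_zero, of "f x" "g x"]
      unfolding mult.assoc by linarith
    finally show ?thesis .
  qed
  then show "AE x in cell_measure. norm (f x \<bullet> g x) \<le> norm ((norm (f x))\<^sup>2 + (norm (g x))\<^sup>2)"
    by (intro AE_I2) simp
qed

lemma sq_int_mult_integrable:
  fixes f g :: "real^'n \<Rightarrow> real"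
  shows "sq_int f \<Longrightarrow> sq_int g \<Longrightarrow> integrable cell_measure (\<lambda>x. f x * g x)"
  using sq_int_inner_integrable[of f g] by simp

lemma sq_int_add:
  fixes f g :: "real^'n \<Rightarrow> 'b::euclidean_space"
  assumes "sq_int f" "sq_int g" shows "sq_int (\<lambda>x. f x + g x)"
proof (rule sq_int_bound)
  show "integrable cell_measure (\<lambda>x. 2 * ((norm (f x))\<^sup>2 + (norm (g x))\<^sup>2))"
    using assms by (auto simp: sq_int_def)
  show "(norm (f x + g x))\<^sup>2 \<le> 2 * ((norm (f x))\<^sup>2 + (norm (g x))\<^sup>2)" for x
  proof -
    have "(norm (f x + g x))\<^sup>2 \<le> (norm (f x) + norm (g x))\<^sup>2"
      by (intro power_mono norm_triangle_ineq) auto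
    also have "\<dots> \<le> 2 * ((norm (f x))\<^sup>2 + (norm (g x))\<^sup>2)"
      using sum_squares_bound[of "norm (f x)" "norm (g x)"] by (simp add: power2_sum)
    finally show ?thesis .
  qed
  show "(\<lambda>x. f x + g x) \<in> borel_measurable cell_measure"
    using assms[THEN sq_int_measurable] by measurable
qed

lemma sq_int_scaleR:
  fixes f :: "real^'n \<Rightarrow> 'b::euclidean_space"
  assumes "sq_int f" shows "sq_int (\<lambda>x. r *\<^sub>R f x)"
  using assms by (auto simp: sq_int_def power_mult_distrib)

lemma sq_int_cmult:
  fixes f :: "real^'n \<Rightarrow> real"
  shows "sq_int f \<Longrightarrow> sq_int (\<lambda>x. r * f x)"
  using sq_int_scaleR[of f r] by simp

lemma sq_int_diff:
  fixes f g :: "real^'n \<Rightarrow> 'b::euclidean_space"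
  assumes "sq_int f" "sq_int g" shows "sq_int (\<lambda>x. f x - g x)"
  using sq_int_add[OF assms(1) sq_int_scaleR[OF assms(2), of "-1"]] by simp

lemma sq_int_sum:
  fixes f :: "'i \<Rightarrow> real^'n \<Rightarrow> 'b::euclidean_space"
  assumes "\<And>i. i \<in> I \<Longrightarrow> sq_int (f i)" shows "sq_int (\<lambda>x. \<Sum>i\<in>I. f i x)"
  using assms
  proof (induction I rule: infinite_finite_induct)
  case (insert i I)
  then show ?case using sq_int_add[of "f i" "\<lambda>x. \<Sum>i\<in>I. f i x"] by simp
qed (auto simp: sq_int_def)

lemma sq_int_bounded:
  fixes g :: "real^'n \<Rightarrow> 'b::euclidean_space"
  assumes "g \<in> borel_measurable cell_measure" "\<And>x. x \<in> unit_cell \<Longrightarrow> norm (g x) \<le> B"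
  shows "sq_int g"
proof (rule sq_int_bound)
  show "integrable cell_measure (\<lambda>_::real^'n. B\<^sup>2)"
    by (rule continuous_integrable_cell) auto
  show "(norm (g x))\<^sup>2 \<le> B\<^sup>2" if "x \<in> unit_cell" for x
    using assms(2)[OF that] by (intro power_mono) auto
qed (use assms in auto)

lemma sq_int_continuous:
  fixes g :: "real^'n \<Rightarrow> 'b::euclidean_space"
  assumes "continuous_on UNIV g"
  shows "sq_int g"
proof -
  obtain B where "\<And>x. x \<in> cbox 0 (\<chi> i. 2) \<Longrightarrow> norm (g x) \<le> B"
    using continuous_bounded_cell[OF assms] by blast
  then show ?thesis
    using sq_int_bounded[OF continuous_measurable_cell[OF assms]] unit_cell_subset_cbox2 by blast
qed

lemma sq_int_wave: "sq_int (wave k t)"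
  by (intro sq_int_continuous continuous_intros)

section \<open>Density of trigonometric polynomials and Parseval's identity\<close>

text \<open>Squared distances avoid roots; the price is the factor 2 in the weak triangle inequality
  \<open>sq_integral_triangle\<close>.\<close>

definition approximable :: "(real^'n \<Rightarrow> real) \<Rightarrow> bool" where
  "approximable f \<longleftrightarrow> (\<forall>\<epsilon>>0. \<exists>p\<in>trig_polys. (LINT x|cell_measure. (f x - p x)\<^sup>2) < \<epsilon>)"

lemma sq_int_trig: "p \<in> trig_polys \<Longrightarrow> sq_int p"
  by (intro sq_int_continuous trig_continuous)

lemma sq_int_power2_integrable:
  fixes f :: "real^'n \<Rightarrow> real"
  shows "sq_int f \<Longrightarrow> integrable cell_measure (\<lambda>x. (f x)\<^sup>2)"
  by (simp add: sq_int_def)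

lemma sq_integral_triangle:
  fixes f g h :: "real^'n \<Rightarrow> real"
  assumes "sq_int f" "sq_int g" "sq_int h"
  shows "(LINT x|cell_measure. (f x - h x)\<^sup>2) \<le>
    2 * (LINT x|cell_measure. (f x - g x)\<^sup>2) + 2 * (LINT x|cell_measure. (g x - h x)\<^sup>2)"
proof -
  note i = sq_int_power2_integrable[OF sq_int_diff]
  have "(f x - h x)\<^sup>2 \<le> 2 * (f x - g x)\<^sup>2 + 2 * (g x - h x)\<^sup>2" for x
    using sum_squares_bound[of "f x - g x" "g x - h x"] by (simp add: power2_eq_square algebra_simps)
  then have "(LINT x|cell_measure. (f x - h x)\<^sup>2) \<le>
      (LINT x|cell_measure. 2 * (f x - g x)\<^sup>2 + 2 * (g x - h x)\<^sup>2)"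
    using i assms by (intro integral_mono) auto
  then show ?thesis using i[OF assms(1,2)] i[OF assms(2,3)] by simp
qed

lemma approximable_limit:
  assumes f: "sq_int f" and g: "\<And>n. sq_int (g n)" "\<And>n. approximable (g n)"
    and lim: "(\<lambda>n. LINT x|cell_measure. (f x - g n x)\<^sup>2) \<longlonglongrightarrow> 0"
  shows "approximable f"
  unfolding approximable_def
proof (intro allI impI)
  fix \<epsilon> :: real assume e: "\<epsilon> > 0"
  then obtain n where n: "(LINT x|cell_measure. (f x - g n x)\<^sup>2) < \<epsilon> / 4"
    using order_tendstoD(2)[OF lim, of "\<epsilon> / 4"] by (auto simp: eventually_sequentially)
  obtain p where p: "p \<in> trig_polys" "(LINT x|cell_measure. (g n x - p x)\<^sup>2) < \<epsilon> / 4"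
    using g(2)[of n] e unfolding approximable_def by (meson divide_pos_pos zero_less_numeral)
  have "(LINT x|cell_measure. (f x - p x)\<^sup>2) < \<epsilon>"
    using sq_integral_triangle[OF f g(1)[of n] sq_int_trig[OF p(1)]] n p(2) by linarith
  then show "\<exists>p\<in>trig_polys. (LINT x|cell_measure. (f x - p x)\<^sup>2) < \<epsilon>" using p(1) by blast
qed

text \<open>Embeds the torus in complex space as a product of circles. Waves are functions on this
  image and separate its points; on the closed cube they cannot, since they agree on opposite
  faces.\<close>

definition torus_map :: "real^'n \<Rightarrow> complex^'n" where
  "torus_map x = (\<chi> i. cis (2 * pi * x $ i))"

lemma continuous_on_torus_map: "continuous_on S torus_map"
  unfolding torus_map_def by (intro continuous_intros)

text \<open>Coordinates with the same image on the circle differ by an integer, which within the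
  closed cube is -1, 0 or 1; a nonzero difference forces the coordinates to be 0 and 1.\<close>

lemma torus_map_eq_imp_frontier:
  assumes "x \<in> cbox 0 (\<chi> i. 1)" "y \<in> cbox 0 (\<chi> i. 1)" "torus_map x = torus_map y" "x \<noteq> y"
  shows "x \<notin> unit_cell \<and> y \<notin> unit_cell"
proof -
  obtain i where i: "x $ i \<noteq> y $ i" using assms(4) by (auto simp: vec_eq_iff)
  have "cis (2 * pi * x $ i) = cis (2 * pi * y $ i)"
    using assms(3) by (simp add: torus_map_def vec_eq_iff)
  then have "sin (2 * pi * x $ i) = sin (2 * pi * y $ i) \<and> cos (2 * pi * x $ i) = cos (2 * pi * y $ i)"
    by (simp add: complex_eq_iff)
  then obtain n :: int where "2 * pi * x $ i = 2 * pi * y $ i + 2 * pi * n"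
    unfolding sin_cos_eq_iff by blast
  then have "2 * pi * (x $ i - y $ i - n) = 0" by (simp add: algebra_simps)
  then have n: "x $ i - y $ i = of_int n" by simp
  have b: "0 \<le> x $ i" "x $ i \<le> 1" "0 \<le> y $ i" "y $ i \<le> 1"
    using assms(1,2) by (auto simp: mem_box_cart)
  then have "- 1 \<le> real_of_int n" "real_of_int n \<le> 1" using n by linarith+
  then have "n = -1 \<or> n = 0 \<or> n = 1" by linarith
  then have "\<not> (0 < x $ i \<and> x $ i < 1) \<and> \<not> (0 < y $ i \<and> y $ i < 1)"
    using n i b by auto
  then show ?thesis unfolding unit_cell_def by blast
qed

text \<open>Vanishing on the frontier makes \<open>g\<close> constant on the fibres of
  \<open>torus_map\<close>. It therefore descends to the compact image, where Stone-Weierstrass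
  applies.\<close>

lemma uniform_trig_approximation:
  fixes g :: "real^'n \<Rightarrow> real"
  assumes g: "continuous_on (cbox 0 (\<chi> i. 1)) g"
    and g0: "\<And>x. x \<in> cbox 0 (\<chi> i. 1) \<Longrightarrow> x \<notin> unit_cell \<Longrightarrow> g x = 0" and e: "\<epsilon> > 0"
  shows "\<exists>p\<in>trig_polys. \<forall>x\<in>cbox 0 (\<chi> i. 1). \<bar>g x - p x\<bar> < \<epsilon>"
proof -
  let ?Q = "cbox 0 (\<chi> i. 1) :: (real^'n) set"
  let ?q = "torus_map :: real^'n \<Rightarrow> complex^'n"
  let ?T = "?q ` ?Q"
  define R where "R = {h. continuous_on ?T h \<and> (\<exists>p\<in>trig_polys. \<forall>x. h (?q x) = p x)}"
  have T: "compact ?T" by (intro compact_continuous_image continuous_on_torus_map compact_cbox)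
  interpret function_ring_on R ?T
  proof
    fix f g assume fg: "f \<in> R" "g \<in> R"
    then obtain p q where "p \<in> trig_polys" "\<forall>x. f (?q x) = p x" "q \<in> trig_polys" "\<forall>x. g (?q x) = q x"
      unfolding R_def by blast
    then show "(\<lambda>x. f x + g x) \<in> R" "(\<lambda>x. f x * g x) \<in> R"
      using fg trig_add[of p q] trig_mult[of p q] unfolding R_def by (auto intro!: continuous_intros)
  next
    show "(\<lambda>_. c) \<in> R" for c
      using trig_const[of c] unfolding R_def by (auto intro!: continuous_intros)
  next
    fix z z' :: "complex^'n" assume "z \<noteq> z'"
    then obtain i where i: "z $ i \<noteq> z' $ i" by (auto simp: vec_eq_iff)
    \<comment> \<open>Real and imaginary parts of the coordinates are waves of frequency
      \<open>axis i 1\<close>; the phase \<open>- (pi/2)\<close> turns the cosine into a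
      sine.\<close>
    have "wave (axis i 1) 0 \<in> trig_polys" "wave (axis i 1) (- (pi/2)) \<in> trig_polys"
      by (intro trig_wave freqs_axis)+
    moreover have "Re (?q x $ i) = wave (axis i 1) 0 x" "Im (?q x $ i) = wave (axis i 1) (- (pi/2)) x" for x
      by (auto simp: torus_map_def wave_def inner_axis' cos_diff)
    ultimately have "(\<lambda>z. Re (z $ i)) \<in> R" "(\<lambda>z. Im (z $ i)) \<in> R"
      unfolding R_def by (auto intro!: continuous_intros)
    moreover have "Re (z $ i) \<noteq> Re (z' $ i) \<or> Im (z $ i) \<noteq> Im (z' $ i)" using i by (simp add: complex_eq_iff)
    ultimately show "\<exists>f\<in>R. f z \<noteq> f z'"
      by (elim disjE) (rule bexI[of _ "\<lambda>z. Re (z $ i)"], assumption+, rule bexI[of _ "\<lambda>z. Im (z $ i)"], assumption+)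
  next
    show "compact ?T" by (rule T)
    show "continuous_on ?T f" if "f \<in> R" for f using that unfolding R_def by blast
  qed
  \<comment> \<open>The descended function; the next fact shows that the choice of the preimage is
    immaterial.\<close>
  define G where "G z = g (SOME x. x \<in> ?Q \<and> ?q x = z)" for z
  have G: "G (?q x) = g x" if x: "x \<in> ?Q" for x
  proof -
    define y where "y = (SOME y. y \<in> ?Q \<and> ?q y = ?q x)"
    have y: "y \<in> ?Q" "?q y = ?q x"
      using someI[of "\<lambda>y. y \<in> ?Q \<and> ?q y = ?q x" x] x by (simp_all add: y_def)
    have "g y = g x"
    proof (cases "y = x")
      case False
      then have "y \<notin> unit_cell \<and> x \<notin> unit_cell" using torus_map_eq_imp_frontier[of y x] y x by simp
      then show ?thesis using g0[OF x] g0[OF y(1)] by simp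
    qed simp
    then show ?thesis by (simp add: G_def y_def)
  qed
  \<comment> \<open>Continuity of \<open>G\<close> comes from the universal property of quotients: a
    continuous map from a compact space to a Hausdorff space is closed, hence a quotient map onto
    its image.\<close>
  have "quotient_map (top_of_set ?Q) (top_of_set ?T) ?q"
  proof (rule continuous_closed_imp_quotient_map)
    show c: "continuous_map (top_of_set ?Q) (top_of_set ?T) ?q"
      by (simp add: continuous_map_in_subtopology continuous_on_torus_map)
    show "closed_map (top_of_set ?Q) (top_of_set ?T) ?q"
      using c by (intro continuous_imp_closed_map)
        (auto simp: compact_space_subtopology Hausdorff_space_subtopology)
  qed simp
  moreover have "continuous_map (top_of_set ?Q) euclideanreal (G \<circ> ?q)"
    using g G by (auto simp: continuous_map_iff_continuous cong: continuous_on_cong)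
  ultimately have "continuous_map (top_of_set ?T) euclideanreal G"
    by (rule continuous_compose_quotient_map)
  then have "continuous_on ?T G" by simp
  from Stone_Weierstrass_basic[OF this e]
  obtain h where h: "h \<in> R" "\<forall>z\<in>?T. \<bar>G z - h z\<bar> < \<epsilon>" by blast
  then obtain p where "p \<in> trig_polys" "\<forall>x. h (?q x) = p x" unfolding R_def by blast
  then show ?thesis using h G by (intro bexI[of _ p]) auto
qed

lemma approximable_vanishing:
  fixes g :: "real^'n \<Rightarrow> real"
  assumes g: "continuous_on UNIV g" and g0: "\<And>x. x \<notin> unit_cell \<Longrightarrow> g x = 0"
  shows "approximable g"
  unfolding approximable_def
proof (intro allI impI)
  fix \<epsilon> :: real assume e: "\<epsilon> > 0"
  \<comment> \<open>The bound 1 reduces the square to the absolute value, which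
    \<open>\<epsilon> / 2\<close> then bounds; the inequality stays strict after integration because
    the cell has measure 1.\<close>
  have "\<exists>p\<in>trig_polys. \<forall>x\<in>cbox 0 (\<chi> i. 1). \<bar>g x - p x\<bar> < min 1 (\<epsilon> / 2)"
    using e g g0 by (intro uniform_trig_approximation) (auto intro: continuous_on_subset)
  then obtain p where p: "p \<in> trig_polys" "\<And>x. x \<in> cbox 0 (\<chi> i. 1) \<Longrightarrow> \<bar>g x - p x\<bar> < min 1 (\<epsilon> / 2)"
    by blast
  have "(LINT x|cell_measure. (g x - p x)\<^sup>2) \<le> (LINT x|(cell_measure :: (real^'n) measure). \<epsilon> / 2)"
  proof (rule integral_mono)
    show "integrable cell_measure (\<lambda>x. (g x - p x)\<^sup>2)"
      by (intro sq_int_power2_integrable sq_int_diff sq_int_continuous g trig_continuous p)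
    show "integrable (cell_measure :: (real^'n) measure) (\<lambda>_. \<epsilon> / 2)"
      by (rule continuous_integrable_cell) auto
    fix x :: "real^'n" assume "x \<in> space cell_measure"
    then have *: "\<bar>g x - p x\<bar> < min 1 (\<epsilon> / 2)" using p(2) unit_cell_subset_cbox by auto
    have "(g x - p x)\<^sup>2 = \<bar>g x - p x\<bar> * \<bar>g x - p x\<bar>" by (simp add: power2_eq_square)
    also have "\<dots> \<le> 1 * (\<epsilon> / 2)" using * by (intro mult_mono) auto
    finally show "(g x - p x)\<^sup>2 \<le> \<epsilon> / 2" by simp
  qed
  then have "(LINT x|cell_measure. (g x - p x)\<^sup>2) < \<epsilon>" using e by simp
  then show "\<exists>p\<in>trig_polys. (LINT x|cell_measure. (g x - p x)\<^sup>2) < \<epsilon>" using p(1) by blast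
qed

text \<open>Measurability provides continuous \<open>g n\<close> converging almost everywhere.
  Clamping them to the range between \<open>- B\<close> and \<open>B\<close> gives domination, and a
  cutoff makes them vanish outside the cell, as \<open>approximable_vanishing\<close>
  requires.\<close>

lemma approximable_bounded:
  fixes f :: "real^'n \<Rightarrow> real"
  assumes f: "f \<in> borel_measurable cell_measure" and B: "\<And>x. \<bar>f x\<bar> \<le> B"
  shows "approximable f"
proof -
  have sf: "sq_int f" using f B by (intro sq_int_bounded) auto
  obtain N g where N: "negligible N" and g: "\<And>n. continuous_on UNIV (g n)"
    and lim: "\<And>x. x \<notin> N \<Longrightarrow> (\<lambda>n. g n x) \<longlonglongrightarrow> (if x \<in> unit_cell then f x else 0)"
    using f measurable_on_iff_borel_measurable[of "unit_cell :: (real^'n) set" f]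
    unfolding measurable_on_def by auto
  let ?C = "- (unit_cell :: (real^'n) set)"
  have C: "closed ?C" "?C \<noteq> {}"
  proof -
    show "closed ?C" unfolding unit_cell_eq_box by (intro closed_Compl open_box)
    have "0 \<in> ?C" by (simp add: unit_cell_def)
    then show "?C \<noteq> {}" by blast
  qed
  \<comment> \<open>Zero outside the cell, and eventually equal to 1 at each point of the cell,
    since the distance to the closed complement is positive there.\<close>
  define \<chi>' where "\<chi>' n x = min 1 (real n * infdist x ?C)" for n x
  define h where "h n x = \<chi>' n x * max (- B) (min B (g n x))" for n x
  have B0: "B \<ge> 0" using B[of 0] by linarith
  have \<chi>1: "0 \<le> \<chi>' n x" "\<chi>' n x \<le> 1" for n x by (auto simp: \<chi>'_def infdist_nonneg)
  have h: "continuous_on UNIV (h n)" for n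
    unfolding h_def \<chi>'_def by (intro continuous_intros g)
  have hB: "\<bar>h n x\<bar> \<le> B" for n x
  proof -
    have "\<bar>h n x\<bar> = \<chi>' n x * \<bar>max (- B) (min B (g n x))\<bar>" using \<chi>1 by (simp add: h_def abs_mult)
    also have "\<dots> \<le> 1 * B" using \<chi>1[of n x] B0 by (intro mult_mono) auto
    finally show ?thesis by simp
  qed
  have h0: "h n x = 0" if "x \<notin> unit_cell" for n x
    using that by (simp add: h_def \<chi>'_def)
  have hlim: "(\<lambda>n. h n x) \<longlonglongrightarrow> f x" if x: "x \<in> unit_cell" "x \<notin> N" for x
  proof -
    have "infdist x ?C > 0"
      using C x in_closed_iff_infdist_zero[OF C, of x] infdist_nonneg[of x ?C] by auto
    then have "filterlim (\<lambda>n. real n * infdist x ?C) at_top sequentially"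
      using filterlim_at_top_mult_tendsto_pos[OF tendsto_const _ filterlim_real_sequentially, of "infdist x ?C"] by simp
    then have "eventually (\<lambda>n. real n * infdist x ?C \<ge> 1) sequentially"
      by (simp add: filterlim_at_top)
    then have "eventually (\<lambda>n. max (- B) (min B (g n x)) = h n x) sequentially"
      by eventually_elim (simp add: h_def \<chi>'_def)
    moreover have "(\<lambda>n. max (- B) (min B (g n x))) \<longlonglongrightarrow> max (- B) (min B (f x))"
      using lim[OF x(2)] x(1) by (intro tendsto_intros) auto
    ultimately have "(\<lambda>n. h n x) \<longlonglongrightarrow> max (- B) (min B (f x))"
      by (rule Lim_transform_eventually[rotated])
    then show ?thesis using B[of x] by (simp add: min_def max_def abs_le_iff split: if_splits)
  qed
  have "(\<lambda>n. LINT x|cell_measure. (f x - h n x)\<^sup>2) \<longlonglongrightarrow> (LINT x|(cell_measure :: (real^'n) measure). 0)"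
  proof (rule integral_dominated_convergence[where w = "\<lambda>_. (2 * B)\<^sup>2"])
    show "integrable (cell_measure :: (real^'n) measure) (\<lambda>_. (2 * B)\<^sup>2)"
      by (rule continuous_integrable_cell) auto
    have "AE x in lebesgue. x \<notin> N" using N by (simp add: AE_not_in negligible_iff_null_sets)
    then have "AE x in cell_measure. x \<notin> N"
      by (subst AE_restrict_space_iff) (auto elim: eventually_mono)
    then show "AE x in cell_measure. (\<lambda>n. (f x - h n x)\<^sup>2) \<longlonglongrightarrow> 0"
    proof (rule AE_mp, intro AE_I2 impI)
      fix x :: "real^'n" assume "x \<in> space cell_measure" "x \<notin> N"
      then have "(\<lambda>n. (f x - h n x)\<^sup>2) \<longlonglongrightarrow> (f x - f x)\<^sup>2"
        by (intro tendsto_intros hlim) auto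
      then show "(\<lambda>n. (f x - h n x)\<^sup>2) \<longlonglongrightarrow> 0" by simp
    qed
    show "AE x in cell_measure. norm ((f x - h n x)\<^sup>2) \<le> (2 * B)\<^sup>2" for n
    proof (rule AE_I2)
      fix x :: "real^'n"
      have "\<bar>f x - h n x\<bar> \<le> 2 * B" using B[of x] hB[of n x] by linarith
      then show "norm ((f x - h n x)\<^sup>2) \<le> (2 * B)\<^sup>2"
        using power_mono[of "\<bar>f x - h n x\<bar>" "2 * B" 2] by simp
    qed
    show "(\<lambda>x. (f x - h n x)\<^sup>2) \<in> borel_measurable cell_measure" for n
      using f continuous_measurable_cell[OF h] by measurable
  qed auto
  then show ?thesis
    using approximable_limit[OF sf, of h] sq_int_continuous[OF h] approximable_vanishing[OF h] h0 by simp
qed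

text \<open>Truncation at height \<open>n\<close> reduces this to the bounded case; the truncation
  error is dominated by the absolute value of \<open>f\<close>.\<close>

lemma sq_int_approximable:
  fixes f :: "real^'n \<Rightarrow> real"
  assumes f: "sq_int f"
  shows "approximable f"
proof -
  have m [measurable]: "f \<in> borel_measurable cell_measure" using f by (rule sq_int_measurable)
  define g where "g n x = max (- real n) (min (real n) (f x))" for n x
  have gm [measurable]: "g n \<in> borel_measurable cell_measure" for n unfolding g_def by measurable
  have gb: "\<bar>g n x\<bar> \<le> real n" for n x by (auto simp: g_def)
  have "(\<lambda>n. LINT x|cell_measure. (f x - g n x)\<^sup>2) \<longlonglongrightarrow> (LINT x|(cell_measure :: (real^'n) measure). 0)"
  proof (rule integral_dominated_convergence[where w = "\<lambda>x. (f x)\<^sup>2"])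
    show "integrable cell_measure (\<lambda>x. (f x)\<^sup>2)" using f by (rule sq_int_power2_integrable)
    show "AE x in cell_measure. (\<lambda>n. (f x - g n x)\<^sup>2) \<longlonglongrightarrow> 0"
    proof (rule AE_I2)
      fix x :: "real^'n"
      have "eventually (\<lambda>n. \<bar>f x\<bar> \<le> real n) sequentially"
        using eventually_ge_at_top real_arch_simple[of "\<bar>f x\<bar>"]
        by (metis (mono_tags, lifting) eventually_sequentially of_nat_mono order_trans)
      then have "eventually (\<lambda>n. (f x - g n x)\<^sup>2 = 0) sequentially"
        by eventually_elim (auto simp: g_def)
      then show "(\<lambda>n. (f x - g n x)\<^sup>2) \<longlonglongrightarrow> 0" by (rule tendsto_eventually)
    qed
    show "AE x in cell_measure. norm ((f x - g n x)\<^sup>2) \<le> (f x)\<^sup>2" for n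
    proof (rule AE_I2)
      fix x :: "real^'n"
      have "\<bar>f x - g n x\<bar> \<le> \<bar>f x\<bar>" by (auto simp: g_def min_def max_def)
      then show "norm ((f x - g n x)\<^sup>2) \<le> (f x)\<^sup>2"
        by (simp add: abs_le_square_iff)
    qed
  qed measurable
  then show ?thesis
    using gb by (intro approximable_limit[OF f _ approximable_bounded[OF gm gb]] sq_int_bounded[OF gm]) auto
qed

text \<open>The complex Fourier coefficient in real form: phase 0 gives its real part and phase
  \<open>pi/2\<close> its imaginary part.\<close>

definition wave_coeff :: "(real^'n \<Rightarrow> real) \<Rightarrow> real^'n \<Rightarrow> real \<Rightarrow> real" where
  "wave_coeff f k t = (LINT x|cell_measure. f x * wave k t x)"

text \<open>\<open>U\<close> and \<open>V\<close> are the real and imaginary part of a complex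
  trigonometric polynomial, so the integrand is the squared modulus of its difference from
  \<open>f\<close>, and the formula completes the square with respect to an orthonormal system.
  \<open>V\<close> has to be carried along because real waves of frequencies \<open>k\<close> and
  \<open>- k\<close> are not orthogonal to each other, whereas the exponentials are.\<close>

lemma trig_defect:
  fixes f :: "real^'n \<Rightarrow> real" and \<alpha> \<beta> :: "real^'n \<Rightarrow> real"
  assumes K: "finite K" "K \<subseteq> freqs" and f: "sq_int f"
  defines "U \<equiv> \<lambda>x. \<Sum>k\<in>K. \<alpha> k * wave k 0 x + \<beta> k * wave k (pi/2) x"
    and "V \<equiv> \<lambda>x. \<Sum>k\<in>K. \<beta> k * wave k 0 x - \<alpha> k * wave k (pi/2) x"
  shows "(LINT x|cell_measure. (f x - U x)\<^sup>2 + (V x)\<^sup>2) =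
    (LINT x|cell_measure. (f x)\<^sup>2) - (\<Sum>k\<in>K. (wave_coeff f k 0)\<^sup>2 + (wave_coeff f k (pi/2))\<^sup>2)
    + (\<Sum>k\<in>K. (\<alpha> k - wave_coeff f k 0)\<^sup>2 + (\<beta> k - wave_coeff f k (pi/2))\<^sup>2)"
proof -
  \<comment> \<open>The squared modulus of the polynomial, expanded into products of one exponential
    with the conjugate of another. These have frequency \<open>k - l\<close>, so only the diagonal
    survives integration.\<close>
  define P where "P x = (\<Sum>k\<in>K. \<Sum>l\<in>K. (\<alpha> k * \<alpha> l + \<beta> k * \<beta> l) * wave (k - l) 0 x
    + (\<beta> k * \<alpha> l - \<alpha> k * \<beta> l) * wave (k - l) (pi/2) x)" for x
  have wave_diff: "wave (k - l) 0 x = wave k 0 x * wave l 0 x + wave k (pi/2) x * wave l (pi/2) x"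
    "wave (k - l) (pi/2) x = wave k (pi/2) x * wave l 0 x - wave k 0 x * wave l (pi/2) x" for k l x :: "real^'n"
    by (simp_all add: wave_def inner_diff_left right_diff_distrib cos_diff sin_diff cos_add)
  have UV: "(U x)\<^sup>2 + (V x)\<^sup>2 = P x" for x
    unfolding U_def V_def P_def power2_eq_square sum_product sum.distrib[symmetric] wave_diff
    by (intro sum.cong refl) (simp add: algebra_simps)
  have wi: "integrable cell_measure (wave k t)" for t and k :: "real^'n"
    by (intro continuous_integrable_cell continuous_intros)
  have fw: "integrable cell_measure (\<lambda>x. f x * wave k t x)" for t k
    by (intro sq_int_mult_integrable f sq_int_wave)
  have P: "(LINT x|cell_measure. P x) = (\<Sum>k\<in>K. (\<alpha> k)\<^sup>2 + (\<beta> k)\<^sup>2)"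
  proof -
    have "(LINT x|cell_measure. P x) = (\<Sum>k\<in>K. \<Sum>l\<in>K. (\<alpha> k * \<alpha> l + \<beta> k * \<beta> l) * (LINT x|cell_measure. wave (k - l) 0 x)
      + (\<beta> k * \<alpha> l - \<alpha> k * \<beta> l) * (LINT x|cell_measure. wave (k - l) (pi/2) x))"
      unfolding P_def using wi by simp
    also have "\<dots> = (\<Sum>k\<in>K. \<Sum>l\<in>K. if k = l then \<alpha> k * \<alpha> l + \<beta> k * \<beta> l else 0)"
    proof (intro sum.cong refl)
      fix k l assume "k \<in> K" "l \<in> K"
      then have "k - l \<in> freqs" using K(2) freqs_diff by blast
      from cell_integral_wave[OF this]
      show "(\<alpha> k * \<alpha> l + \<beta> k * \<beta> l) * (LINT x|cell_measure. wave (k - l) 0 x)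
        + (\<beta> k * \<alpha> l - \<alpha> k * \<beta> l) * (LINT x|cell_measure. wave (k - l) (pi/2) x) =
        (if k = l then \<alpha> k * \<alpha> l + \<beta> k * \<beta> l else 0)"
        by simp
    qed
    also have "\<dots> = (\<Sum>k\<in>K. (\<alpha> k)\<^sup>2 + (\<beta> k)\<^sup>2)"
      using K(1) by (simp add: sum.delta power2_eq_square)
    finally show ?thesis .
  qed
  have Pi: "integrable cell_measure P" unfolding P_def using wi by simp
  have fU: "integrable cell_measure (\<lambda>x. f x * U x)"
    "(LINT x|cell_measure. f x * U x) = (\<Sum>k\<in>K. \<alpha> k * wave_coeff f k 0 + \<beta> k * wave_coeff f k (pi/2))"
  proof -
    have "f x * U x = (\<Sum>k\<in>K. \<alpha> k * (f x * wave k 0 x) + \<beta> k * (f x * wave k (pi/2) x))" for x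
      unfolding U_def sum_distrib_left by (simp add: algebra_simps)
    then show "integrable cell_measure (\<lambda>x. f x * U x)"
      "(LINT x|cell_measure. f x * U x) = (\<Sum>k\<in>K. \<alpha> k * wave_coeff f k 0 + \<beta> k * wave_coeff f k (pi/2))"
      using fw by (simp_all add: wave_coeff_def)
  qed
  have "(f x - U x)\<^sup>2 + (V x)\<^sup>2 = (f x)\<^sup>2 - 2 * (f x * U x) + P x" for x
    unfolding UV[symmetric] by (simp add: power2_eq_square algebra_simps)
  then have "(LINT x|cell_measure. (f x - U x)\<^sup>2 + (V x)\<^sup>2) =
    (LINT x|cell_measure. (f x)\<^sup>2) - 2 * (LINT x|cell_measure. f x * U x) + (LINT x|cell_measure. P x)"
    using sq_int_power2_integrable[OF f] fU(1) Pi by simp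
  also have "\<dots> = (LINT x|cell_measure. (f x)\<^sup>2) + (\<Sum>k\<in>K. (\<alpha> k)\<^sup>2 + (\<beta> k)\<^sup>2 - 2 * (\<alpha> k * wave_coeff f k 0 + \<beta> k * wave_coeff f k (pi/2)))"
    unfolding fU P by (simp add: sum_subtractf sum_distrib_left)
  also have "(\<Sum>k\<in>K. (\<alpha> k)\<^sup>2 + (\<beta> k)\<^sup>2 - 2 * (\<alpha> k * wave_coeff f k 0 + \<beta> k * wave_coeff f k (pi/2))) =
    (\<Sum>k\<in>K. (\<alpha> k - wave_coeff f k 0)\<^sup>2 + (\<beta> k - wave_coeff f k (pi/2))\<^sup>2)
    - (\<Sum>k\<in>K. (wave_coeff f k 0)\<^sup>2 + (wave_coeff f k (pi/2))\<^sup>2)"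
    unfolding sum_subtractf[symmetric] by (intro sum.cong refl) (simp add: power2_eq_square algebra_simps)
  finally show ?thesis by simp
qed

text \<open>\<open>trig_defect\<close> is used twice for each finite \<open>K\<close> containing the
  frequencies of an approximating \<open>p\<close>: the coefficients of \<open>p\<close> bound the
  mass missing from the partial sum by \<open>\<epsilon>\<close>, and those of \<open>f\<close> show
  that this mass is nonnegative (Bessel).\<close>

lemma parseval_square:
  fixes f :: "real^'n \<Rightarrow> real"
  assumes f: "sq_int f"
  shows "((\<lambda>k. (wave_coeff f k 0)\<^sup>2 + (wave_coeff f k (pi/2))\<^sup>2) has_sum (LINT x|cell_measure. (f x)\<^sup>2)) freqs"
  unfolding has_sum_def tendsto_iff
proof (intro allI impI)
  let ?c = "\<lambda>k. (wave_coeff f k 0)\<^sup>2 + (wave_coeff f k (pi/2))\<^sup>2"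
  fix \<epsilon> :: real assume e: "\<epsilon> > 0"
  then obtain p where p: "p \<in> trig_polys" "(LINT x|cell_measure. (f x - p x)\<^sup>2) < \<epsilon>"
    using sq_int_approximable[OF f] unfolding approximable_def by blast
  obtain K0 \<alpha> \<beta> where K0: "finite K0" "K0 \<subseteq> freqs" and
    p_eq: "\<forall>K x. finite K \<longrightarrow> K0 \<subseteq> K \<longrightarrow>
      p x = (\<Sum>k\<in>K. \<alpha> k * wave k 0 x + \<beta> k * wave k (pi/2) x) \<and>
      0 = (\<Sum>k\<in>K. \<beta> k * wave k 0 x - \<alpha> k * wave k (pi/2) x)"
    using trig_poly_coefficients[OF p(1)] by (elim exE conjE) (rule that)
  have "dist (sum ?c K) (LINT x|cell_measure. (f x)\<^sup>2) < \<epsilon>" if K: "finite K" "K0 \<subseteq> K" "K \<subseteq> freqs" for K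
  proof -
    \<comment> \<open>The added square is zero, because the complex form of \<open>p\<close> has
      vanishing imaginary part.\<close>
    have "(LINT x|cell_measure. (f x - p x)\<^sup>2) = (LINT x|cell_measure.
      (f x - (\<Sum>k\<in>K. \<alpha> k * wave k 0 x + \<beta> k * wave k (pi/2) x))\<^sup>2 + (\<Sum>k\<in>K. \<beta> k * wave k 0 x - \<alpha> k * wave k (pi/2) x)\<^sup>2)"
      using p_eq[rule_format, OF K(1,2), THEN conjunct1] p_eq[rule_format, OF K(1,2), THEN conjunct2, symmetric]
      by simp
    then have "(LINT x|cell_measure. (f x)\<^sup>2) - sum ?c K \<le> (LINT x|cell_measure. (f x - p x)\<^sup>2)"
      unfolding trig_defect[OF K(1,3) f] by (simp add: sum_nonneg)
    moreover have "0 \<le> (LINT x|cell_measure. (f x)\<^sup>2) - sum ?c K"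
    proof -
      let ?\<alpha> = "\<lambda>k. wave_coeff f k 0" and ?\<beta> = "\<lambda>k. wave_coeff f k (pi/2)"
      have "0 \<le> (LINT x|cell_measure. (f x - (\<Sum>k\<in>K. ?\<alpha> k * wave k 0 x + ?\<beta> k * wave k (pi/2) x))\<^sup>2
        + (\<Sum>k\<in>K. ?\<beta> k * wave k 0 x - ?\<alpha> k * wave k (pi/2) x)\<^sup>2)"
        by (rule integral_nonneg_AE) simp
      then show ?thesis unfolding trig_defect[OF K(1,3) f] by simp
    qed
    ultimately show ?thesis using p(2) by (simp add: dist_real_def)
  qed
  then show "\<forall>\<^sub>F K in finite_subsets_at_top freqs. dist (sum ?c K) (LINT x|cell_measure. (f x)\<^sup>2) < \<epsilon>"
    unfolding eventually_finite_subsets_at_top using K0 by blast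
qed

text \<open>Polarization of \<open>parseval_square\<close>: a product is a quarter of the difference
  of the squares of sum and difference.\<close>

theorem parseval:
  fixes f g :: "real^'n \<Rightarrow> real"
  assumes f: "sq_int f" and g: "sq_int g"
  shows "((\<lambda>k. wave_coeff f k 0 * wave_coeff g k 0 + wave_coeff f k (pi/2) * wave_coeff g k (pi/2))
    has_sum (LINT x|cell_measure. f x * g x)) freqs"
proof -
  have i: "integrable cell_measure (\<lambda>x. h x * wave k t x)" if "sq_int h" for h k t
    by (intro sq_int_mult_integrable that sq_int_wave)
  have add: "wave_coeff (\<lambda>x. f x + g x) k t = wave_coeff f k t + wave_coeff g k t"
    and diff: "wave_coeff (\<lambda>x. f x - g x) k t = wave_coeff f k t - wave_coeff g k t" for k t
    unfolding wave_coeff_def using i[OF f, of k t] i[OF g, of k t] by (simp_all add: algebra_simps)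
  have "((\<lambda>k. 1/4 * (((wave_coeff f k 0 + wave_coeff g k 0)\<^sup>2 + (wave_coeff f k (pi/2) + wave_coeff g k (pi/2))\<^sup>2)
      + (- 1) * ((wave_coeff f k 0 - wave_coeff g k 0)\<^sup>2 + (wave_coeff f k (pi/2) - wave_coeff g k (pi/2))\<^sup>2)))
    has_sum (1/4 * ((LINT x|cell_measure. (f x + g x)\<^sup>2) + (- 1) * (LINT x|cell_measure. (f x - g x)\<^sup>2)))) freqs"
    using parseval_square[OF sq_int_add[OF f g]] parseval_square[OF sq_int_diff[OF f g]]
    unfolding add diff by (intro has_sum_cmult_right has_sum_add)
  moreover have "1/4 * ((LINT x|cell_measure. (f x + g x)\<^sup>2) + (- 1) * (LINT x|cell_measure. (f x - g x)\<^sup>2)) =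
    (LINT x|cell_measure. f x * g x)"
  proof -
    have "(LINT x|cell_measure. (f x + g x)\<^sup>2) + (- 1) * (LINT x|cell_measure. (f x - g x)\<^sup>2) =
      (LINT x|cell_measure. (f x + g x)\<^sup>2 - (f x - g x)\<^sup>2)"
      using sq_int_power2_integrable[OF sq_int_add[OF f g]] sq_int_power2_integrable[OF sq_int_diff[OF f g]] by simp
    also have "\<dots> = (LINT x|cell_measure. 4 * (f x * g x))"
      by (rule Bochner_Integration.integral_cong) (auto simp: power2_eq_square algebra_simps)
    finally show ?thesis by simp
  qed
  moreover have "1/4 * (((a + b)\<^sup>2 + (c + d)\<^sup>2) + (- 1) * ((a - b)\<^sup>2 + (c - d)\<^sup>2)) = a * b + c * d" for a b c d :: real
    by (simp add: power2_eq_square algebra_simps)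
  ultimately show ?thesis by (simp only:)
qed

section \<open>Periodic Sobolev functions\<close>

lemma sq_int_nth:
  fixes f :: "real^'n \<Rightarrow> 'b::euclidean_space^'m"
  assumes "sq_int f" shows "sq_int (\<lambda>x. f x $ i)"
proof (rule sq_int_bound)
  have "(\<lambda>v :: 'b^'m. v $ i) \<in> borel_measurable borel"
    by (intro borel_measurable_continuous_onI continuous_intros)
  then show "(\<lambda>x. f x $ i) \<in> borel_measurable cell_measure"
    using sq_int_measurable[OF assms] by simp
  show "integrable cell_measure (\<lambda>x. (norm (f x))\<^sup>2)" using assms by (simp add: sq_int_def)
  show "(norm (f x $ i))\<^sup>2 \<le> (norm (f x))\<^sup>2" for x
    by (intro power_mono Finite_Cartesian_Product.norm_nth_le) auto
qed

lemma vec_eq_sum_axis: "(v :: 'b::comm_monoid_add^'m) = (\<Sum>i\<in>UNIV. axis i (v $ i))"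
  by (simp add: vec_eq_iff axis_def sum.delta)

lemma sq_int_vec:
  fixes f :: "real^'n \<Rightarrow> 'b::euclidean_space^'m"
  assumes "\<And>i. sq_int (\<lambda>x. f x $ i)" shows "sq_int f"
proof -
  have "sq_int (\<lambda>x. axis i (f x $ i) :: 'b^'m)" for i
  proof -
    have "continuous_on UNIV (\<lambda>v. axis i v :: 'b^'m)"
      unfolding axis_def 
    proof (rule continuous_on_vec_lambda)
      show "continuous_on UNIV (\<lambda>v :: 'b. if j = i then v else 0)" for j by (cases "j = i") auto
    qed
    then have "(\<lambda>v. axis i v :: 'b^'m) \<in> borel_measurable borel"
      by (rule borel_measurable_continuous_onI)
    then show ?thesis using assms[of i] measurable_compose[of "\<lambda>x. f x $ i" cell_measure borel "axis i"]
      by (simp add: sq_int_def norm_eq_sqrt_inner inner_axis_axis)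
  qed
  then have "sq_int (\<lambda>x. \<Sum>i\<in>UNIV. axis i (f x $ i) :: 'b^'m)"
    by (rule sq_int_sum)
  then show ?thesis by (simp flip: vec_eq_sum_axis)
qed

lemma AE_zero_if_wave_coeff_zero:
  fixes f :: "real^'n \<Rightarrow> real"
  assumes f: "sq_int f" and z: "\<And>k t. k \<in> freqs \<Longrightarrow> wave_coeff f k t = 0"
  shows "AE x in cell_measure. f x = 0"
proof -
  have "((\<lambda>k :: real^'n. 0::real) has_sum (LINT x|cell_measure. (f x)\<^sup>2)) freqs"
    using parseval_square[OF f] z by (simp cong: has_sum_cong)
  then have "(LINT x|cell_measure. (f x)\<^sup>2) = 0"
    by (rule has_sum_unique) (simp add: has_sum_0)
  then show ?thesis
    using integral_nonneg_eq_0_iff_AE[OF sq_int_power2_integrable[OF f]] by simp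
qed

lemma L2_per_sq_int: "f \<in> L2_per \<Longrightarrow> sq_int f"
  by (simp add: L2_per_def sq_int_def)

lemma C_inf_per_smooth:
  assumes "\<phi> \<in> C_inf_per"
  shows "continuous_on UNIV \<phi>" "\<phi> differentiable (at x)" "continuous_on UNIV (partial_deriv i \<phi>)"
proof -
  have C: "C_k 0 \<phi>" "C_k (Suc 0) \<phi>" using assms by (auto simp: C_inf_per_def simp del: C_k.simps)
  show "continuous_on UNIV \<phi>" using C(1) by simp
  show "\<phi> differentiable (at x)" "continuous_on UNIV (partial_deriv i \<phi>)" using C(2) by simp_all
qed

lemma weak_grad_sq_int: "is_weak_grad u g \<Longrightarrow> sq_int (\<lambda>x. g x $ i)"
  by (intro sq_int_nth L2_per_sq_int) (simp add: is_weak_grad_def)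

lemma is_weak_grad_grad: "u \<in> H1_per \<Longrightarrow> is_weak_grad u (grad u)"
  unfolding H1_per_def grad_def using someI_ex[of "is_weak_grad u"] by blast

lemma H1_sq_int: "u \<in> H1_per \<Longrightarrow> sq_int u"
  by (auto simp: H1_per_def intro: L2_per_sq_int)

lemma grad_sq_int: "u \<in> H1_per \<Longrightarrow> sq_int (grad u)"
  using is_weak_grad_grad[of u] by (auto simp: is_weak_grad_def intro: L2_per_sq_int)

text \<open>A wave is an admissible test function. In complex terms, differentiation multiplies the
  Fourier coefficient by 2 pi times the imaginary unit times a component of the frequency; the
  imaginary unit shows up as the phase shift.\<close>

lemma wave_coeff_weak_grad:
  assumes "is_weak_grad u g" "k \<in> freqs"
  shows "wave_coeff (\<lambda>x. g x $ i) k t = - (2 * pi * k $ i) * wave_coeff u k (t + pi/2)"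
proof -
  have "(\<lambda>x. 1 * wave k t x) \<in> C_inf_per" by (rule C_inf_per_wave[OF assms(2)])
  then have "(LINT y|cell_measure. u y * partial_deriv i (\<lambda>x. 1 * wave k t x) y) = - (LINT y|cell_measure. g y $ i * (1 * wave k t y))"
    using assms(1) unfolding is_weak_grad_def by blast
  then have "wave_coeff (\<lambda>x. g x $ i) k t = - (LINT y|cell_measure. (2 * pi * k $ i) * (u y * wave k (t + pi/2) y))"
    unfolding partial_deriv_wave by (simp add: wave_coeff_def mult_ac)
  then show ?thesis by (simp add: wave_coeff_def)
qed

lemma wave_coeff_pi: "wave_coeff u k pi = - wave_coeff u k 0"
proof -
  have "wave k pi x = - wave k 0 x" for x by (simp add: wave_def)
  then show ?thesis by (simp add: wave_coeff_def)
qed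

text \<open>The Fourier coefficients of a weak gradient are determined by those of \<open>u\<close>,
  and vanishing coefficients force a function to be zero almost everywhere. This makes the arbitrary
  choice in \<open>grad\<close> harmless.\<close>

lemma weak_grad_unique:
  assumes "is_weak_grad u g" "is_weak_grad u g'"
  shows "AE x in cell_measure. g x = g' x"
proof -
  have "AE x in cell_measure. \<forall>i. g x $ i - g' x $ i = 0"
    unfolding AE_all_countable
  proof
    fix i
    note s = weak_grad_sq_int[OF assms(1), of i] weak_grad_sq_int[OF assms(2), of i]
    show "AE x in cell_measure. g x $ i - g' x $ i = 0"
    proof (rule AE_zero_if_wave_coeff_zero[OF sq_int_diff[OF s]])
      fix k :: "real^'a" and t assume k: "k \<in> freqs"
      have "wave_coeff (\<lambda>x. g x $ i - g' x $ i) k t = wave_coeff (\<lambda>x. g x $ i) k t - wave_coeff (\<lambda>x. g' x $ i) k t"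
        using s[THEN sq_int_mult_integrable, OF sq_int_wave, of k t]
        by (simp add: wave_coeff_def left_diff_distrib)
      then show "wave_coeff (\<lambda>x. g x $ i - g' x $ i) k t = 0"
        using assms[THEN wave_coeff_weak_grad[OF _ k]] by simp
    qed
  qed
  then show ?thesis by eventually_elim (simp add: vec_eq_iff)
qed

lemma grad_AE_eq:
  assumes "u \<in> L2_per" "is_weak_grad u g"
  shows "u \<in> H1_per" "AE x in cell_measure. grad u x = g x"
proof -
  show u: "u \<in> H1_per" using assms unfolding H1_per_def by blast
  show "AE x in cell_measure. grad u x = g x"
    using is_weak_grad_grad[OF u] assms(2) by (rule weak_grad_unique)
qed

lemma L2_per_diff:
  fixes f g :: "real^'n \<Rightarrow> 'b::euclidean_space"
  assumes "f \<in> L2_per" "g \<in> L2_per" shows "(\<lambda>x. f x - g x) \<in> L2_per"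
  using sq_int_diff[OF assms[THEN L2_per_sq_int]] assms
  by (simp add: L2_per_def sq_int_def cell_periodic_def)

lemma weak_grad_diff:
  assumes u: "u \<in> H1_per" and v: "v \<in> H1_per"
  shows "(\<lambda>x. u x - v x) \<in> H1_per" "AE x in cell_measure. grad (\<lambda>x. u x - v x) x = grad u x - grad v x"
proof -
  note gu = is_weak_grad_grad[OF u] and gv = is_weak_grad_grad[OF v]
  have "is_weak_grad (\<lambda>x. u x - v x) (\<lambda>x. grad u x - grad v x)"
    unfolding is_weak_grad_def
  proof (intro conjI ballI allI)
    show "(\<lambda>x. grad u x - grad v x) \<in> L2_per"
      using gu gv by (auto simp: is_weak_grad_def intro: L2_per_diff)
    fix \<phi> :: "real^'a \<Rightarrow> real" and i assume \<phi>: "\<phi> \<in> C_inf_per"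
    note s\<phi> = sq_int_continuous[OF C_inf_per_smooth(1)[OF \<phi>]] sq_int_continuous[OF C_inf_per_smooth(3)[OF \<phi>, of i]]
    have 1: "(LINT y|cell_measure. u y * partial_deriv i \<phi> y) = - (LINT y|cell_measure. grad u y $ i * \<phi> y)"
      and 2: "(LINT y|cell_measure. v y * partial_deriv i \<phi> y) = - (LINT y|cell_measure. grad v y $ i * \<phi> y)"
      using gu gv \<phi> by (auto simp: is_weak_grad_def)
    show "(LINT y|cell_measure. (u y - v y) * partial_deriv i \<phi> y) = - (LINT y|cell_measure. (grad u y - grad v y) $ i * \<phi> y)"
      using 1 2 sq_int_mult_integrable[OF H1_sq_int[OF u] s\<phi>(2)] sq_int_mult_integrable[OF H1_sq_int[OF v] s\<phi>(2)]
        sq_int_mult_integrable[OF weak_grad_sq_int[OF gu] s\<phi>(1), of i] sq_int_mult_integrable[OF weak_grad_sq_int[OF gv] s\<phi>(1), of i]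
      by (simp add: left_diff_distrib)
  qed
  moreover have "(\<lambda>x. u x - v x) \<in> L2_per" using u v by (auto simp: H1_per_def intro: L2_per_diff)
  ultimately show "(\<lambda>x. u x - v x) \<in> H1_per" "AE x in cell_measure. grad (\<lambda>x. u x - v x) x = grad u x - grad v x"
    using grad_AE_eq by blast+
qed

lemma partial_deriv_mult:
  assumes "f differentiable (at x)" "g differentiable (at x)"
  shows "partial_deriv i (\<lambda>x. f x * g x) x = f x * partial_deriv i g x + partial_deriv i f x * g x"
  unfolding partial_deriv_def using assms
  by (subst frechet_derivative_at[OF has_derivative_mult, symmetric])
     (auto simp: frechet_derivative_works[symmetric])

text \<open>The classical gradient is a weak one: the product of the wave with a test function is
  periodic, so its partial derivatives have integral zero.\<close>

lemma wave_weak_grad: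
  fixes k :: "real^'n"
  assumes k: "k \<in> freqs"
  shows "(\<lambda>x. r * wave k t x) \<in> H1_per"
    "AE x in cell_measure. grad (\<lambda>x. r * wave k t x) x = (2 * pi * r * wave k (t + pi/2) x) *\<^sub>R k"
proof -
  let ?w = "\<lambda>x. r * wave k t x"
  let ?g = "\<lambda>x. (2 * pi * r * wave k (t + pi/2) x) *\<^sub>R k"
  have L2: "?w \<in> L2_per"
    using cell_periodic_wave[OF k, of t] sq_int_cmult[OF sq_int_wave, of r k t]
    by (simp add: L2_per_def sq_int_def cell_periodic_def)
  have cg: "continuous_on UNIV ?g" by (intro continuous_intros)
  have "is_weak_grad ?w ?g"
    unfolding is_weak_grad_def
  proof (intro conjI ballI allI)
    show "?g \<in> L2_per"
      using cell_periodic_wave[OF k, of "t + pi/2"] sq_int_continuous[OF cg]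
      by (simp add: L2_per_def sq_int_def cell_periodic_def)
    fix \<phi> :: "real^'n \<Rightarrow> real" and i assume \<phi>: "\<phi> \<in> C_inf_per"
    note s\<phi> = C_inf_per_smooth[OF \<phi>]
    have pd: "partial_deriv i (\<lambda>x. ?w x * \<phi> x) = (\<lambda>x. ?w x * partial_deriv i \<phi> x + ?g x $ i * \<phi> x)"
    proof
      fix x
      show "partial_deriv i (\<lambda>x. ?w x * \<phi> x) x = ?w x * partial_deriv i \<phi> x + ?g x $ i * \<phi> x"
        using partial_deriv_mult[OF wave_differentiable[of r k t x] s\<phi>(2)[of x], of i]
        unfolding partial_deriv_wave by (simp add: mult_ac)
    qed
    have "(LINT x|cell_measure. partial_deriv i (\<lambda>x. ?w x * \<phi> x) x) = 0"
    proof (rule cell_integral_partial_deriv_zero)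
      show "cell_periodic (\<lambda>x. ?w x * \<phi> x)"
        using cell_periodic_wave[OF k, of t] \<phi> by (simp add: cell_periodic_def C_inf_per_def)
      show "(\<lambda>x. ?w x * \<phi> x) differentiable at x" for x
        using wave_differentiable s\<phi>(2) by (rule differentiable_mult)
      show "continuous_on UNIV (partial_deriv i (\<lambda>x. ?w x * \<phi> x))"
        unfolding pd by (intro continuous_intros s\<phi>)
    qed
    moreover have "integrable cell_measure (\<lambda>x. ?w x * partial_deriv i \<phi> x)"
      "integrable cell_measure (\<lambda>x. ?g x $ i * \<phi> x)"
      by (intro continuous_integrable_cell continuous_intros s\<phi>)+
    ultimately show "(LINT y|cell_measure. ?w y * partial_deriv i \<phi> y) = - (LINT y|cell_measure. ?g y $ i * \<phi> y)"
      unfolding pd by simp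
  qed
  then show "?w \<in> H1_per" "AE x in cell_measure. grad ?w x = ?g x"
    using grad_AE_eq[OF L2] by blast+
qed

text \<open>Weak gradients are defined with smooth test functions only, whereas \<open>v\<close> is
  merely in \<open>H1_per\<close>. Parseval bridges this: differentiation acts on coefficients by an
  imaginary factor, and moving such a factor across the product changes the sign.\<close>

lemma H1_integration_by_parts:
  assumes u: "u \<in> H1_per" and v: "v \<in> H1_per"
  shows "(LINT x|cell_measure. grad u x $ i * v x) = - (LINT x|cell_measure. u x * grad v x $ i)"
proof -
  note g = is_weak_grad_grad[OF u] is_weak_grad_grad[OF v]
  note c = g[THEN wave_coeff_weak_grad]
  have "((\<lambda>k. - (wave_coeff u k 0 * wave_coeff (\<lambda>x. grad v x $ i) k 0 + wave_coeff u k (pi/2) * wave_coeff (\<lambda>x. grad v x $ i) k (pi/2)))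
    has_sum - (LINT x|cell_measure. u x * grad v x $ i)) freqs"
    using parseval[OF H1_sq_int[OF u] weak_grad_sq_int[OF g(2)]] by (simp only: has_sum_uminus minus_minus)
  also have "?this \<longleftrightarrow> ((\<lambda>k. wave_coeff (\<lambda>x. grad u x $ i) k 0 * wave_coeff v k 0 + wave_coeff (\<lambda>x. grad u x $ i) k (pi/2) * wave_coeff v k (pi/2))
    has_sum - (LINT x|cell_measure. u x * grad v x $ i)) freqs"
    by (intro has_sum_cong) (simp add: c wave_coeff_pi algebra_simps)
  finally show ?thesis
    using parseval[OF weak_grad_sq_int[OF g(1), of i] H1_sq_int[OF v]] has_sum_unique by blast
qed

text \<open>After Parseval both sides carry the same factor \<open>k $ i * k $ j\<close>. Two
  integrations by parts would need second derivatives, which do not exist here in general.\<close>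

lemma H1_swap_derivatives:
  assumes u: "u \<in> H1_per" and v: "v \<in> H1_per"
  shows "(LINT x|cell_measure. grad u x $ i * grad v x $ j) = (LINT x|cell_measure. grad u x $ j * grad v x $ i)"
proof -
  note g = is_weak_grad_grad[OF u] is_weak_grad_grad[OF v]
  define q where "q i j k = wave_coeff (\<lambda>x. grad u x $ i) k 0 * wave_coeff (\<lambda>x. grad v x $ j) k 0
      + wave_coeff (\<lambda>x. grad u x $ i) k (pi/2) * wave_coeff (\<lambda>x. grad v x $ j) k (pi/2)" for i j k
  have P: "(q i j has_sum (LINT x|cell_measure. grad u x $ i * grad v x $ j)) freqs" for i j
    unfolding q_def by (rule parseval[OF weak_grad_sq_int[OF g(1)] weak_grad_sq_int[OF g(2)]])
  have "q j i k = q i j k" if k: "k \<in> freqs" for k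
    unfolding q_def g[THEN wave_coeff_weak_grad, OF k] by simp
  then have "(q i j has_sum (LINT x|cell_measure. grad u x $ j * grad v x $ i)) freqs"
    using P[of j i] has_sum_cong[of freqs "q j i" "q i j"] by simp
  then show ?thesis using P has_sum_unique by blast
qed

lemma has_sum_finite_sum:
  fixes f :: "'i \<Rightarrow> 'a \<Rightarrow> 'b::topological_comm_monoid_add"
  assumes "\<And>i. i \<in> I \<Longrightarrow> (f i has_sum s i) A"
  shows "((\<lambda>x. \<Sum>i\<in>I. f i x) has_sum (\<Sum>i\<in>I. s i)) A"
  using assms
proof (induction I rule: infinite_finite_induct)
  case (insert i I)
  then show ?case using has_sum_add[of "f i" A "s i" "\<lambda>x. \<Sum>i\<in>I. f i x"] by simp
qed (simp_all add: has_sum_0)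

text \<open>Mean value zero removes the frequency 0, and every other integer vector has squared
  length at least 1; \<open>4 * pi\<^sup>2\<close> is the square of the factor \<open>2 * pi\<close>
  that differentiation produces.\<close>

lemma poincare:
  fixes v :: "real^'n \<Rightarrow> real"
  assumes v: "v \<in> W_per"
  shows "4 * pi\<^sup>2 * (LINT x|cell_measure. (v x)\<^sup>2) \<le> (LINT x|cell_measure. (norm (grad v x))\<^sup>2)"
proof -
  have vH: "v \<in> H1_per" and v0: "(LINT x|cell_measure. v x) = 0" using v by (auto simp: W_per_def)
  note g = is_weak_grad_grad[OF vH]
  note c = wave_coeff_weak_grad[OF g]
  let ?c = "\<lambda>k. (wave_coeff v k 0)\<^sup>2 + (wave_coeff v k (pi/2))\<^sup>2"
  have "((\<lambda>k. \<Sum>i\<in>UNIV. (wave_coeff (\<lambda>x. grad v x $ i) k 0)\<^sup>2 + (wave_coeff (\<lambda>x. grad v x $ i) k (pi/2))\<^sup>2)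
    has_sum (\<Sum>i\<in>UNIV. LINT x|cell_measure. (grad v x $ i)\<^sup>2)) freqs"
    by (intro has_sum_finite_sum parseval_square weak_grad_sq_int[OF g])
  moreover have "(\<Sum>i\<in>UNIV. LINT x|cell_measure. (grad v x $ i)\<^sup>2) = (LINT x|cell_measure. (norm (grad v x))\<^sup>2)"
    using sq_int_power2_integrable[OF weak_grad_sq_int[OF g]]
    by (simp add: norm_vec_def L2_set_def sum_nonneg)
  ultimately have 1: "((\<lambda>k. \<Sum>i\<in>UNIV. (wave_coeff (\<lambda>x. grad v x $ i) k 0)\<^sup>2 + (wave_coeff (\<lambda>x. grad v x $ i) k (pi/2))\<^sup>2)
    has_sum (LINT x|cell_measure. (norm (grad v x))\<^sup>2)) freqs" by simp
  have 2: "((\<lambda>k. 4 * pi\<^sup>2 * ?c k) has_sum 4 * pi\<^sup>2 * (LINT x|cell_measure. (v x)\<^sup>2)) freqs"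
    by (intro has_sum_cmult_right parseval_square H1_sq_int vH)
  show ?thesis
  proof (rule has_sum_mono[OF 2 1])
    fix k :: "real^'n" assume k: "k \<in> freqs"
    have "(\<Sum>i\<in>UNIV. (wave_coeff (\<lambda>x. grad v x $ i) k 0)\<^sup>2 + (wave_coeff (\<lambda>x. grad v x $ i) k (pi/2))\<^sup>2)
      = (\<Sum>i\<in>UNIV. (k $ i)\<^sup>2 * (4 * pi\<^sup>2 * ?c k))"
      by (intro sum.cong refl) (simp add: c[OF k] wave_coeff_pi power_mult_distrib algebra_simps)
    also have "\<dots> = (\<Sum>i\<in>UNIV. (k $ i)\<^sup>2) * (4 * pi\<^sup>2 * ?c k)" by (simp add: sum_distrib_right)
    also have "4 * pi\<^sup>2 * ?c k \<le> \<dots>"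
    proof (cases "k = 0")
      case True
      have "wave_coeff v 0 t = 0" for t using v0 by (simp add: wave_coeff_def wave_def)
      then show ?thesis using True by simp
    next
      case False
      then obtain i where i: "k $ i \<noteq> 0" by (auto simp: vec_eq_iff)
      have "k $ i \<in> \<int>" using k by (simp add: freqs_def)
      with i have "\<bar>k $ i\<bar> \<ge> 1" by (rule Ints_nonzero_abs_ge1[rotated])
      then have "1 \<le> (k $ i)\<^sup>2" using one_le_power[of "\<bar>k $ i\<bar>" 2] by simp
      also have "\<dots> \<le> (\<Sum>i\<in>UNIV. (k $ i)\<^sup>2)" by (rule member_le_sum) auto
      finally show ?thesis using mult_right_mono[of 1 "\<Sum>i\<in>UNIV. (k $ i)\<^sup>2" "4 * pi\<^sup>2 * ?c k"] by simp
    qed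
    finally show "4 * pi\<^sup>2 * ?c k \<le> (\<Sum>i\<in>UNIV. (wave_coeff (\<lambda>x. grad v x $ i) k 0)\<^sup>2 + (wave_coeff (\<lambda>x. grad v x $ i) k (pi/2))\<^sup>2)" .
  qed
qed

section \<open>Divergence and rotation\<close>

lemma norm_matrix_power2: "(norm (J :: real^'m^'k))\<^sup>2 = (\<Sum>i\<in>UNIV. \<Sum>j\<in>UNIV. (J $ i $ j)\<^sup>2)"
  unfolding power2_norm_eq_inner by (simp add: inner_vec_def power2_eq_square)

lemma norm_vector_power2: "(norm (v :: real^'m))\<^sup>2 = (\<Sum>i\<in>UNIV. (v $ i)\<^sup>2)"
  unfolding power2_norm_eq_inner by (simp add: inner_vec_def power2_eq_square)

lemma UNIV_card_2:
  assumes "CARD('n::{finite,comm_ring_1}) = 2"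
  shows "(UNIV :: 'n set) = {1, 2}" "(1::'n) \<noteq> 2"
proof -
  show ne: "(1::'n) \<noteq> 2" using one_neq_zero[where 'a='n] by (metis add_cancel_left_left one_add_one)
  have "{1, 2} = (UNIV :: 'n set)"
    by (rule card_subset_eq) (use assms ne in auto)
  then show "(UNIV :: 'n set) = {1, 2}" by simp
qed

lemma UNIV_card_3:
  assumes "CARD('n::{finite,comm_ring_1}) = 3"
  shows "(UNIV :: 'n set) = {1, 2, 3}" "(1::'n) \<noteq> 2" "(2::'n) \<noteq> 3" "(1::'n) \<noteq> 3"
proof -
  show ne12: "(1::'n) \<noteq> 2" using one_neq_zero[where 'a='n] by (metis add_cancel_left_left one_add_one)
  have three: "(3::'n) = 2 + 1" by simp
  show ne23: "(2::'n) \<noteq> 3" unfolding three by (metis add_cancel_left_right one_neq_zero)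
  \<comment> \<open>If 2 were 0, adding 1 would be an involution without fixed points, so an element
    \<open>x\<close> outside 0 and 1 would bring a fourth element \<open>x + 1\<close>.\<close>
  have "(2::'n) \<noteq> 0"
  proof
    assume two: "(2::'n) = 0"
    have "\<exists>x::'n. x \<notin> {0, 1}"
    proof (rule ccontr)
      assume "\<not> (\<exists>x::'n. x \<notin> {0, 1})"
      then have "(UNIV :: 'n set) \<subseteq> {0, 1}" by blast
      then have "CARD('n) \<le> card {0, 1 :: 'n}" by (intro card_mono) auto
      also have "\<dots> \<le> 2" by (simp add: card_insert_if)
      finally show False using assms by simp
    qed
    then obtain x :: 'n where x: "x \<noteq> 0" "x \<noteq> 1" by auto
    have "x + 1 \<noteq> 0"
    proof
      assume "x + 1 = 0"
      then have "x + 2 = 1" by (metis add.assoc add_0 one_add_one)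
      then show False using two x by simp
    qed
    moreover have "x + 1 \<noteq> 1" "x + 1 \<noteq> x" using x by auto
    ultimately have "card {0, 1, x, x + 1} = 4" using x by (simp add: card_insert_if)
    moreover have "card {0, 1, x, x + 1} \<le> CARD('n)" by (intro card_mono) auto
    ultimately show False using assms by simp
  qed
  then show ne13: "(1::'n) \<noteq> 3" unfolding three by (metis add_cancel_left_left)
  have "{1, 2, 3} = (UNIV :: 'n set)"
    by (rule card_subset_eq) (use assms ne12 ne23 ne13 in auto)
  then show "(UNIV :: 'n set) = {1, 2, 3}" by simp
qed

text \<open>In both dimensions the left side sums \<open>(J $ i $ j - J $ j $ i)\<^sup>2\<close>
  over the unordered pairs of distinct indices, which is half the squared norm of \<open>J\<close>
  minus its transpose.\<close>

lemma norm_rot_power2: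
  fixes w :: "real^'n::{finite,comm_ring_1} \<Rightarrow> real^'n::{finite,comm_ring_1}"
  assumes "CARD('n) \<in> {2, 3}"
  shows "(norm (rot w y))\<^sup>2 =
    (norm (Jac w y))\<^sup>2 - (\<Sum>i\<in>UNIV. \<Sum>j\<in>UNIV. Jac w y $ i $ j * Jac w y $ j $ i)"
proof (cases "CARD('n) = 2")
  case True
  have sum: "(\<Sum>i\<in>UNIV. h i) = h 1 + h 2" for h :: "'n \<Rightarrow> real"
    unfolding UNIV_card_2(1)[OF True] using UNIV_card_2(2)[OF True] by simp
  have R: "rot w y = vector [0, 0, Jac w y $ 1 $ 2 - Jac w y $ 2 $ 1]"
    using True by (simp add: rot_def Let_def)
  show ?thesis
    unfolding R norm_matrix_power2 norm_vector_power2[where 'm=3] sum sum_3 vector_3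
    by (simp add: power2_eq_square algebra_simps)
next
  case False
  then have 3: "CARD('n) = 3" using assms by auto
  have sum: "(\<Sum>i\<in>UNIV. h i) = h 1 + h 2 + h 3" for h :: "'n \<Rightarrow> real"
    unfolding UNIV_card_3(1)[OF 3] using UNIV_card_3(2-4)[OF 3] by simp
  have R: "rot w y = vector [Jac w y $ 3 $ 2 - Jac w y $ 2 $ 3, Jac w y $ 1 $ 3 - Jac w y $ 3 $ 1,
      Jac w y $ 2 $ 1 - Jac w y $ 1 $ 2]"
    using 3 by (simp add: rot_def Let_def)
  show ?thesis
    unfolding R norm_matrix_power2 norm_vector_power2[where 'm=3] sum sum_3 vector_3
    by (simp add: power2_eq_square algebra_simps)
qed

lemma rot_diff:
  assumes "Jac w y = Jac v y - Jac z y"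
  shows "rot w y = rot v y - rot z y"
  by (simp add: rot_def Let_def assms vec_eq_iff forall_3)

lemma rot_symmetric:
  assumes "\<And>i j. Jac w y $ i $ j = Jac w y $ j $ i"
  shows "rot w y = 0"
  using assms[of 1 2] assms[of 1 3] assms[of 2 3] by (simp add: rot_def Let_def vec_eq_iff forall_3)

lemma W_per_vec_nth: "w \<in> W_per_vec \<Longrightarrow> (\<lambda>x. w x $ i) \<in> H1_per"
  by (simp add: W_per_vec_def W_per_def)

lemma W_per_vec_sq_int: "w \<in> W_per_vec \<Longrightarrow> sq_int w"
  by (intro sq_int_vec H1_sq_int W_per_vec_nth)

lemma Jac_nth: "Jac w y $ i = grad (\<lambda>x. w x $ i) y"
  by (simp add: Jac_def)

lemma Jac_sq_int: "w \<in> W_per_vec \<Longrightarrow> sq_int (Jac w)"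
  by (rule sq_int_vec) (simp add: Jac_nth grad_sq_int W_per_vec_nth)

lemma Jac_entry_sq_int: "w \<in> W_per_vec \<Longrightarrow> sq_int (\<lambda>y. Jac w y $ i $ j)"
  by (intro sq_int_nth[of "\<lambda>y. Jac w y $ i"] sq_int_nth Jac_sq_int)

lemma divergence_sq_int: "w \<in> W_per_vec \<Longrightarrow> sq_int (divergence w)"
  unfolding divergence_def[abs_def] trace_def by (intro sq_int_sum Jac_entry_sq_int)

lemma rot_sq_int:
  fixes w :: "real^'n::{finite,comm_ring_1} \<Rightarrow> real^'n::{finite,comm_ring_1}"
  assumes "w \<in> W_per_vec" shows "sq_int (rot w)"
proof (rule sq_int_vec)
  have z: "sq_int (\<lambda>y::real^'n::{finite,comm_ring_1}. 0::real)" by (intro sq_int_continuous) auto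
  have "\<forall>i. sq_int (\<lambda>y. rot w y $ i)"
    unfolding forall_3
    by (cases "CARD('n) = 2") (simp_all add: rot_def Let_def z sq_int_diff Jac_entry_sq_int assms)
  then show "sq_int (\<lambda>y. rot w y $ i)" for i by blast
qed

lemma W_per_vec_diff:
  fixes w v :: "real^'n \<Rightarrow> real^'n"
  assumes "w \<in> W_per_vec" "v \<in> W_per_vec"
  shows "(\<lambda>x. w x - v x) \<in> W_per_vec" "AE y in cell_measure. Jac (\<lambda>x. w x - v x) y = Jac w y - Jac v y"
proof -
  note d = weak_grad_diff[OF W_per_vec_nth[OF assms(1)] W_per_vec_nth[OF assms(2)]]
  have sc: "integrable cell_measure f" if "sq_int f" for f :: "real^'n \<Rightarrow> real"
    using sq_int_mult_integrable[OF that sq_int_continuous[of "\<lambda>x. 1"]] by simp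
  have "(LINT y|cell_measure. w y $ i - v y $ i) = 0" for i
    using assms sc[OF H1_sq_int[OF W_per_vec_nth[OF assms(1)]]] sc[OF H1_sq_int[OF W_per_vec_nth[OF assms(2)]]]
    by (simp add: W_per_vec_def W_per_def)
  then show "(\<lambda>x. w x - v x) \<in> W_per_vec" using d(1) by (simp add: W_per_vec_def W_per_def)
  have "AE y in cell_measure. \<forall>i. grad (\<lambda>x. w x $ i - v x $ i) y = grad (\<lambda>x. w x $ i) y - grad (\<lambda>x. v x $ i) y"
    unfolding AE_all_countable using d(2) by blast
  then show "AE y in cell_measure. Jac (\<lambda>x. w x - v x) y = Jac w y - Jac v y"
    by eventually_elim (simp add: vec_eq_iff[of "Jac _ _"] Jac_nth)
qed

text \<open>After integration of \<open>norm_rot_power2\<close>, swapping derivatives turns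
  \<open>J $ i $ j * J $ j $ i\<close> into \<open>J $ i $ i * J $ j $ j\<close>, and the double sum
  of these is the squared divergence.\<close>

lemma div_rot_identity:
  fixes w :: "real^'n::{finite,comm_ring_1} \<Rightarrow> real^'n::{finite,comm_ring_1}"
  assumes dim: "CARD('n) \<in> {2, 3}" and w: "w \<in> W_per_vec"
  shows "(LINT y|cell_measure. (norm (Jac w y))\<^sup>2) =
    (LINT y|cell_measure. (divergence w y)\<^sup>2) + (LINT y|cell_measure. (norm (rot w y))\<^sup>2)"
proof -
  note e = Jac_entry_sq_int[OF w]
  have i: "integrable cell_measure (\<lambda>y. Jac w y $ i $ j * Jac w y $ k $ l)" for i j k l
    by (intro sq_int_mult_integrable e)
  have "(LINT y|cell_measure. (norm (rot w y))\<^sup>2) = (LINT y|cell_measure. (norm (Jac w y))\<^sup>2)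
      - (LINT y|cell_measure. (\<Sum>i\<in>UNIV. \<Sum>j\<in>UNIV. Jac w y $ i $ j * Jac w y $ j $ i))"
    unfolding norm_rot_power2[OF dim] using Jac_sq_int[OF w] i
    by (intro Bochner_Integration.integral_diff Bochner_Integration.integrable_sum) (auto simp: sq_int_def)
  also have "(LINT y|cell_measure. (\<Sum>i\<in>UNIV. \<Sum>j\<in>UNIV. Jac w y $ i $ j * Jac w y $ j $ i))
    = (\<Sum>i\<in>UNIV. \<Sum>j\<in>UNIV. LINT y|cell_measure. Jac w y $ i $ j * Jac w y $ j $ i)"
    using i by simp
  also have "\<dots> = (\<Sum>i\<in>UNIV. \<Sum>j\<in>UNIV. LINT y|cell_measure. Jac w y $ i $ i * Jac w y $ j $ j)"
    unfolding Jac_nth by (intro sum.cong refl H1_swap_derivatives W_per_vec_nth w)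
  also have "\<dots> = (LINT y|cell_measure. (\<Sum>i\<in>UNIV. \<Sum>j\<in>UNIV. Jac w y $ i $ i * Jac w y $ j $ j))"
    using i by simp
  also have "\<dots> = (LINT y|cell_measure. (divergence w y)\<^sup>2)"
    by (simp add: divergence_def trace_def power2_eq_square sum_product)
  finally show ?thesis by simp
qed

lemma divergence_by_parts:
  fixes w :: "real^'n \<Rightarrow> real^'n"
  assumes w: "w \<in> W_per_vec" and u: "u \<in> H1_per"
  shows "(LINT y|cell_measure. divergence w y * u y) = - (LINT y|cell_measure. w y \<bullet> grad u y)"
proof -
  have i: "integrable cell_measure (\<lambda>y. grad (\<lambda>x. w x $ i) y $ i * u y)"
    "integrable cell_measure (\<lambda>y. w y $ i * grad u y $ i)" for i
    by (intro sq_int_mult_integrable H1_sq_int W_per_vec_nth w u sq_int_nth[OF grad_sq_int])+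
  have "(LINT y|cell_measure. divergence w y * u y) = (\<Sum>i\<in>UNIV. LINT y|cell_measure. grad (\<lambda>x. w x $ i) y $ i * u y)"
    unfolding divergence_def trace_def Jac_nth sum_distrib_right using i by simp
  also have "\<dots> = (\<Sum>i\<in>UNIV. - (LINT y|cell_measure. w y $ i * grad u y $ i))"
    by (intro sum.cong refl H1_integration_by_parts W_per_vec_nth w u)
  also have "\<dots> = - (LINT y|cell_measure. w y \<bullet> grad u y)"
    unfolding inner_vec_def sum_negf using i by simp
  finally show ?thesis .
qed

lemma poincare_vec:
  fixes w :: "real^'n \<Rightarrow> real^'n"
  assumes w: "w \<in> W_per_vec"
  shows "4 * pi\<^sup>2 * (LINT x|cell_measure. (norm (w x))\<^sup>2) \<le> (LINT x|cell_measure. (norm (Jac w x))\<^sup>2)"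
proof -
  have i: "integrable cell_measure (\<lambda>x. (w x $ i)\<^sup>2)" for i
    by (intro sq_int_power2_integrable H1_sq_int W_per_vec_nth w)
  have j: "integrable cell_measure (\<lambda>x. (norm (grad (\<lambda>x. w x $ i) x))\<^sup>2)" for i
    using grad_sq_int[OF W_per_vec_nth[OF w]] by (simp add: sq_int_def)
  have "4 * pi\<^sup>2 * (LINT x|cell_measure. (norm (w x))\<^sup>2) = (\<Sum>i\<in>UNIV. 4 * pi\<^sup>2 * (LINT x|cell_measure. (w x $ i)\<^sup>2))"
    unfolding norm_vector_power2 using i by (simp add: sum_distrib_left)
  also have "\<dots> \<le> (\<Sum>i\<in>UNIV. LINT x|cell_measure. (norm (grad (\<lambda>x. w x $ i) x))\<^sup>2)"
    using w by (intro sum_mono poincare) (simp add: W_per_vec_def)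
  also have "\<dots> = (LINT x|cell_measure. (norm (Jac w x))\<^sup>2)"
    unfolding norm_matrix_power2 Jac_nth norm_vector_power2[symmetric] using j by simp
  finally show ?thesis .
qed

section \<open>The Cordes condition\<close>

lemma compact_countable_dense:
  fixes S :: "'l::metric_space set"
  assumes "compact S"
  obtains D where "countable D" "D \<subseteq> S" "S \<subseteq> closure D"
proof -
  have "\<forall>n::nat. \<exists>k. finite k \<and> k \<subseteq> S \<and> S \<subseteq> (\<Union>x\<in>k. ball x (inverse (Suc n)))"
    using seq_compact_imp_totally_bounded[OF compact_imp_seq_compact[OF assms]] by simp
  then obtain k where k: "\<And>n::nat. finite (k n)" "\<And>n. k n \<subseteq> S" "\<And>n. S \<subseteq> (\<Union>x\<in>k n. ball x (inverse (Suc n)))"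
    by metis
  show thesis
  proof (rule that[of "\<Union>n. k n"])
    show "countable (\<Union>n. k n)" using k(1) by (simp add: countable_finite)
    show "S \<subseteq> closure (\<Union>n. k n)"
    proof
      fix x assume x: "x \<in> S"
      show "x \<in> closure (\<Union>n. k n)"
        unfolding closure_approachable
      proof (intro allI impI)
        fix e :: real assume "e > 0"
        then obtain n where n: "inverse (real (Suc n)) < e" using reals_Archimedean by blast
        obtain z where "z \<in> k n" "dist z x < inverse (Suc n)" using k(3)[of n] x by auto
        then show "\<exists>y\<in>\<Union>n. k n. dist y x < e" using n by (intro bexI[of _ z]) auto
      qed
    qed
  qed (use k(2) in blast)
qed

text \<open>Continuity in the control makes the supremum over a countable dense subset the same, and
  countable suprema preserve measurability.\<close>

lemma borel_measurable_SUP_compact: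
  fixes h :: "'a \<Rightarrow> 'l::metric_space \<Rightarrow> real"
  assumes S: "compact S" "S \<noteq> {}"
    and c: "\<And>x. x \<in> space M \<Longrightarrow> continuous_on S (h x)"
    and m: "\<And>\<alpha>. \<alpha> \<in> S \<Longrightarrow> (\<lambda>x. h x \<alpha>) \<in> borel_measurable M"
  shows "(\<lambda>x. SUP \<alpha>\<in>S. h x \<alpha>) \<in> borel_measurable M"
proof -
  obtain D where D: "countable D" "D \<subseteq> S" "S \<subseteq> closure D"
    using compact_countable_dense[OF S(1)] .
  have cl: "closure D = S"
    using D closure_minimal[OF D(2) compact_imp_closed[OF S(1)]] by blast
  have D0: "D \<noteq> {}" using S(2) cl by auto
  have b: "bdd_above (h x ` S)" if "x \<in> space M" for x
    by (intro bounded_imp_bdd_above compact_imp_bounded compact_continuous_image c that S)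
  have eq: "(SUP \<alpha>\<in>S. h x \<alpha>) = (SUP \<alpha>\<in>D. h x \<alpha>)" if x: "x \<in> space M" for x
  proof (rule antisym)
    have bD: "bdd_above (h x ` D)" using b[OF x] D(2) by (meson bdd_above_mono image_mono)
    show "(SUP \<alpha>\<in>S. h x \<alpha>) \<le> (SUP \<alpha>\<in>D. h x \<alpha>)"
    proof (rule cSUP_least[OF S(2)])
      fix \<alpha> assume "\<alpha> \<in> S"
      then have \<alpha>: "\<alpha> \<in> closure D" using cl by simp
      have cD: "continuous_on (closure D) (h x)" using c[OF x] cl by simp
      show "h x \<alpha> \<le> (SUP \<alpha>\<in>D. h x \<alpha>)"
        by (rule continuous_le_on_closure[OF cD \<alpha>]) (rule cSUP_upper[OF _ bD])
    qed
    show "(SUP \<alpha>\<in>D. h x \<alpha>) \<le> (SUP \<alpha>\<in>S. h x \<alpha>)"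
      by (rule cSUP_subset_mono[OF D0 b[OF x] D(2)]) simp
  qed
  have "(\<lambda>x. SUP \<alpha>\<in>D. h x \<alpha>) \<in> borel_measurable M"
  proof (rule borel_measurable_cSUP)
    show "bdd_above ((\<lambda>\<alpha>. h x \<alpha>) ` D)" if "x \<in> space M" for x
      using b[OF that] D(2) by (meson bdd_above_mono image_mono)
  qed (use D m in auto)
  then show ?thesis by (subst measurable_cong[OF eq])
qed

text \<open>Since \<open>d\<close> does not depend on \<open>\<alpha>\<close>, a bound uniform in
  \<open>\<alpha>\<close> survives the supremum. In the application \<open>d\<close> is
  \<open>L\<close> applied to a difference: all the linear operators, after scaling by
  \<open>gamma_fun\<close>, are close to one and the same \<open>L\<close>.\<close>

lemma SUP_diff_bound:
  fixes h k :: "'l \<Rightarrow> real"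
  assumes "S \<noteq> {}" "bdd_above (h ` S)" "bdd_above (k ` S)"
    and "\<And>\<alpha>. \<alpha> \<in> S \<Longrightarrow> \<bar>h \<alpha> - k \<alpha> - d\<bar> \<le> e"
  shows "\<bar>(SUP \<alpha>\<in>S. h \<alpha>) - (SUP \<alpha>\<in>S. k \<alpha>) - d\<bar> \<le> e"
proof -
  have "(SUP \<alpha>\<in>S. h \<alpha>) \<le> (SUP \<alpha>\<in>S. k \<alpha>) + d + e"
  proof (rule cSUP_least[OF assms(1)])
    fix \<alpha> assume a: "\<alpha> \<in> S"
    show "h \<alpha> \<le> (SUP \<alpha>\<in>S. k \<alpha>) + d + e"
      using assms(4)[OF a] cSUP_upper[OF a assms(3)] by linarith
  qed
  moreover have "(SUP \<alpha>\<in>S. k \<alpha>) \<le> (SUP \<alpha>\<in>S. h \<alpha>) - d + e"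
  proof (rule cSUP_least[OF assms(1)])
    fix \<alpha> assume a: "\<alpha> \<in> S"
    show "k \<alpha> \<le> (SUP \<alpha>\<in>S. h \<alpha>) - d + e"
      using assms(4)[OF a] cSUP_upper[OF a assms(2)] by linarith
  qed
  ultimately show ?thesis by linarith
qed

lemma trace_eq_inner: "trace (D :: real^'n^'n) = mat 1 \<bullet> D"
proof -
  have "(\<Sum>j\<in>UNIV. mat 1 $ i $ j * D $ i $ j) = D $ i $ i" for i
  proof -
    have "(\<Sum>j\<in>UNIV. mat 1 $ i $ j * D $ i $ j) = (\<Sum>j\<in>UNIV. if i = j then D $ i $ j else 0)"
      by (intro sum.cong) (auto simp: mat_def)
    then show ?thesis by (simp add: sum.delta)
  qed
  then show ?thesis by (simp add: trace_def inner_vec_def)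
qed

text \<open>
  Cauchy-Schwarz in the product space, with the gradient scaled by \<open>sqrt (2 * lam)\<close> and the
  function value by \<open>lam\<close>; the factor \<open>g = S / q\<close> minimizes the norm of the first vector.
\<close>

lemma cordes_pointwise:
  fixes A D :: "real^'n^'n" and b p :: "real^'n" and c r lam \<delta> :: real
  defines "q \<equiv> (norm A)\<^sup>2 + (norm b)\<^sup>2 / (2 * lam) + c\<^sup>2 / lam\<^sup>2" and "S \<equiv> trace A + c / lam"
  assumes lam: "lam > 0" and \<delta>: "0 < \<delta>" and q: "q > 0"
    and cordes: "q \<le> 1 / (real CARD('n) + \<delta>) * S\<^sup>2"
  shows "\<bar>inverse q * S * (- (A \<bullet> D) - b \<bullet> p + c * r) - (- trace D + lam * r)\<bar>
    \<le> sqrt (1 - \<delta>) * sqrt ((norm D)\<^sup>2 + 2 * lam * (norm p)\<^sup>2 + lam\<^sup>2 * r\<^sup>2)"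
proof -
  define g where "g = inverse q * S"
  define E where "E = (mat 1 - g *\<^sub>R A, - (g / sqrt (2 * lam)) *\<^sub>R b, g * c / lam - 1)"
  define Y where "Y = (D, sqrt (2 * lam) *\<^sub>R p, lam * r)"
  have gq: "g * q = S" using q by (simp add: g_def)
  have I: "(mat 1 :: real^'n^'n) \<bullet> mat 1 = real CARD('n)"
    unfolding trace_eq_inner[symmetric] by (simp add: trace_I)
  have "(norm E)\<^sup>2 = (norm (mat 1 - g *\<^sub>R A))\<^sup>2 + g\<^sup>2 * (norm b)\<^sup>2 / (2 * lam) + (g * c / lam - 1)\<^sup>2"
    using lam by (simp add: E_def norm_Pair power_mult_distrib power_divide)
  also have "(norm (mat 1 - g *\<^sub>R A))\<^sup>2 = real CARD('n) - 2 * g * trace A + g\<^sup>2 * (norm A)\<^sup>2"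
    unfolding power2_norm_eq_inner trace_eq_inner using I
    by (simp add: inner_diff_left inner_diff_right inner_commute power2_eq_square algebra_simps)
  also have "real CARD('n) - 2 * g * trace A + g\<^sup>2 * (norm A)\<^sup>2 + g\<^sup>2 * (norm b)\<^sup>2 / (2 * lam) + (g * c / lam - 1)\<^sup>2
    = real CARD('n) + 1 - 2 * g * S + g * (g * q)"
    using lam unfolding q_def S_def by (simp add: power2_eq_square field_simps)
  also have "\<dots> = real CARD('n) + 1 - g * S" unfolding gq by simp
  also have "\<dots> \<le> 1 - \<delta>"
  \<comment> \<open>The Cordes condition says precisely that \<open>g * S\<close>, which is
    \<open>S\<^sup>2 / q\<close>, is at least the dimension plus \<open>\<delta>\<close>.\<close>
  proof -
    have "(real CARD('n) + \<delta>) * q \<le> S\<^sup>2"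
      using mult_left_mono[OF cordes, of "real CARD('n) + \<delta>"] \<delta> by simp
    then have "real CARD('n) + \<delta> \<le> S\<^sup>2 / q" using q by (simp add: pos_le_divide_eq)
    also have "S\<^sup>2 / q = g * S" by (simp add: g_def power2_eq_square divide_inverse)
    finally show ?thesis by simp
  qed
  finally have E: "norm E \<le> sqrt (1 - \<delta>)" by (rule real_le_rsqrt)
  have "E \<bullet> Y = g * (- (A \<bullet> D) - b \<bullet> p + c * r) - (- trace D + lam * r)"
    using lam unfolding E_def Y_def trace_eq_inner by (simp add: inner_diff_left algebra_simps)
  then have "\<bar>g * (- (A \<bullet> D) - b \<bullet> p + c * r) - (- trace D + lam * r)\<bar> \<le> norm E * norm Y"
    using Cauchy_Schwarz_ineq2[of E Y] by simp
  also have "\<dots> \<le> sqrt (1 - \<delta>) * norm Y" using E by (rule mult_right_mono) simp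
  also have "norm Y = sqrt ((norm D)\<^sup>2 + 2 * lam * (norm p)\<^sup>2 + lam\<^sup>2 * r\<^sup>2)"
    using lam by (simp add: Y_def norm_Pair power_mult_distrib add.assoc)
  finally show ?thesis unfolding g_def .
qed

section \<open>The continuous problem\<close>

lemma L_op_sq_int:
  assumes "w \<in> W_per_vec" "u \<in> H1_per" shows "sq_int (L_op lam (w, u))"
proof -
  have "sq_int (\<lambda>y. (- 1) * divergence w y + lam * u y)"
    by (intro sq_int_add sq_int_cmult divergence_sq_int H1_sq_int assms)
  then show ?thesis by (simp add: L_op_def[abs_def])
qed

lemma wave_shift_pi: "wave k (t + pi/2 + pi/2) x = - wave k t x"
proof -
  have "2 * pi * (k \<bullet> x) + (t + pi/2 + pi/2) = (2 * pi * (k \<bullet> x) + t) + pi" by simp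
  then show ?thesis unfolding wave_def by (simp only: cos_periodic_pi)
qed

text \<open>\<open>z\<close> is an explicit formula for the gradient, since \<open>grad v\<close>
  itself is fixed only up to null sets. Its components have mean zero also for \<open>k = 0\<close>,
  where the factor \<open>k $ i\<close> vanishes; its Jacobian is a multiple of the symmetric matrix
  with entries \<open>k $ i * k $ j\<close>.\<close>

lemma gradient_wave_pair:
  fixes k :: "real^'n::{finite,comm_ring_1}" and t lam :: real
  assumes k: "k \<in> freqs"
  defines "v \<equiv> \<lambda>x. 1 * wave k t x" and "z \<equiv> \<lambda>x. \<chi> i. (2 * pi * k $ i) * wave k (t + pi/2) x"
  shows "v \<in> H1_per" "z \<in> W_per_vec"
    "AE y in cell_measure. grad v y = z y" "AE y in cell_measure. rot z y = 0"
    "AE y in cell_measure. L_op lam (z, v) y = (4 * pi\<^sup>2 * (norm k)\<^sup>2 + lam) * wave k t y"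
proof -
  show "v \<in> H1_per" unfolding v_def by (rule wave_weak_grad[OF k])
  show "z \<in> W_per_vec"
    unfolding W_per_vec_def W_per_def z_def
    using wave_weak_grad(1)[OF k] cell_integral_wave[OF k] by auto
  show "AE y in cell_measure. grad v y = z y"
    using wave_weak_grad(2)[OF k, of 1 t] unfolding v_def z_def
    by eventually_elim (simp add: vec_eq_iff)
  have "AE y in cell_measure. \<forall>i. grad (\<lambda>x. z x $ i) y = (- (4 * pi\<^sup>2) * k $ i * wave k t y) *\<^sub>R k"
    unfolding AE_all_countable
  proof
    fix i
    show "AE y in cell_measure. grad (\<lambda>x. z x $ i) y = (- (4 * pi\<^sup>2) * k $ i * wave k t y) *\<^sub>R k"
      using wave_weak_grad(2)[OF k, of "2 * pi * k $ i" "t + pi/2"] unfolding z_def wave_shift_pi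
      by eventually_elim (simp add: power2_eq_square mult_ac)
  qed
  then have J: "AE y in cell_measure. \<forall>i j. Jac z y $ i $ j = - (4 * pi\<^sup>2) * wave k t y * (k $ i * k $ j)"
    by eventually_elim (simp add: Jac_nth)
  then show "AE y in cell_measure. rot z y = 0"
    by eventually_elim (rule rot_symmetric, simp add: mult_ac)
  show "AE y in cell_measure. L_op lam (z, v) y = (4 * pi\<^sup>2 * (norm k)\<^sup>2 + lam) * wave k t y"
    using J
  proof eventually_elim
    case (elim y)
    have "trace (Jac z y) = (\<Sum>i\<in>UNIV. - (4 * pi\<^sup>2) * wave k t y * (k $ i)\<^sup>2)"
      unfolding trace_def using elim by (simp add: power2_eq_square)
    also have "\<dots> = - (4 * pi\<^sup>2) * wave k t y * (norm k)\<^sup>2"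
      unfolding norm_vector_power2 sum_distrib_left ..
    finally show ?case
      by (simp add: L_op_def divergence_def v_def algebra_simps)
  qed
qed

section \<open>The Hamilton-Jacobi-Bellman operator as a pointwise map\<close>

locale hjb_coefficients =
  fixes \<Lambda> :: "'l::metric_space set"
    and A :: "real^'n \<Rightarrow> 'l \<Rightarrow> real^'n^'n" and b :: "real^'n \<Rightarrow> 'l \<Rightarrow> real^'n"
    and c f :: "real^'n \<Rightarrow> 'l \<Rightarrow> real" and \<zeta> lam \<delta> :: real
  assumes \<Lambda>: "compact \<Lambda>" "\<Lambda> \<noteq> {}"
    and cont: "continuous_on (UNIV \<times> \<Lambda>) (\<lambda>(y, \<alpha>). A y \<alpha>)" "continuous_on (UNIV \<times> \<Lambda>) (\<lambda>(y, \<alpha>). b y \<alpha>)"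
      "continuous_on (UNIV \<times> \<Lambda>) (\<lambda>(y, \<alpha>). c y \<alpha>)" "continuous_on (UNIV \<times> \<Lambda>) (\<lambda>(y, \<alpha>). f y \<alpha>)"
    and ellipticity: "\<zeta> > 0" "\<And>y \<alpha> \<xi>. \<alpha> \<in> \<Lambda> \<Longrightarrow> \<zeta> * (norm \<xi>)\<^sup>2 \<le> (A y \<alpha> *v \<xi>) \<bullet> \<xi>"
    and lam: "lam > 0" and \<delta>: "0 < \<delta>" "\<delta> < 1"
    and cordes: "\<And>y \<alpha>. \<alpha> \<in> \<Lambda> \<Longrightarrow>
         (norm (A y \<alpha>))\<^sup>2 + (norm (b y \<alpha>))\<^sup>2 / (2 * lam) + (c y \<alpha>)\<^sup>2 / lam\<^sup>2
           \<le> 1 / (real CARD('n) + \<delta>) * (trace (A y \<alpha>) + c y \<alpha> / lam)\<^sup>2"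
begin

abbreviation "\<gamma> \<equiv> gamma_fun A b c lam"

text \<open>\<open>D\<close>, \<open>p\<close> and \<open>r\<close> stand for the values of
  Jacobian, gradient and function at \<open>y\<close>; freezing them separates the pointwise
  estimates from the function spaces.\<close>

definition integrand :: "real^'n^'n \<Rightarrow> real^'n \<Rightarrow> real \<Rightarrow> real^'n \<Rightarrow> 'l \<Rightarrow> real" where
  "integrand D p r y \<alpha> = \<gamma> y \<alpha> * (- (A y \<alpha> \<bullet> D) - b y \<alpha> \<bullet> p + c y \<alpha> * r - f y \<alpha>)"

lemma F_gamma_eq: "F_gamma \<Lambda> A b c f lam (w, u) y = (SUP \<alpha>\<in>\<Lambda>. integrand (Jac w y) (grad u y) (u y) y \<alpha>)"
  by (simp add: F_gamma_def integrand_def)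

text \<open>Ellipticity excludes \<open>A y \<alpha> = 0\<close>. Positivity makes the inverse in
  \<open>gamma_fun\<close> a genuine reciprocal, hence continuous.\<close>

lemma cordes_sum_pos:
  assumes "\<alpha> \<in> \<Lambda>" shows "cordes_sum A b c lam y \<alpha> > 0"
proof -
  have "A y \<alpha> \<noteq> 0"
  proof
    assume "A y \<alpha> = 0"
    then show False
      using ellipticity(2)[OF assms, of "axis undefined 1" y] ellipticity(1) by simp
  qed
  then have "(norm (A y \<alpha>))\<^sup>2 > 0" by simp
  moreover have "(norm (b y \<alpha>))\<^sup>2 / (2 * lam) + (c y \<alpha>)\<^sup>2 / lam\<^sup>2 \<ge> 0" using lam by simp
  ultimately show ?thesis unfolding cordes_sum_def by linarith
qed

lemma continuous_on_coefficients:
  "continuous_on (UNIV \<times> \<Lambda>) (\<lambda>z. A (fst z) (snd z))" "continuous_on (UNIV \<times> \<Lambda>) (\<lambda>z. b (fst z) (snd z))"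
  "continuous_on (UNIV \<times> \<Lambda>) (\<lambda>z. c (fst z) (snd z))" "continuous_on (UNIV \<times> \<Lambda>) (\<lambda>z. f (fst z) (snd z))"
  "continuous_on (UNIV \<times> \<Lambda>) (\<lambda>z. \<gamma> (fst z) (snd z))"
proof -
  show *: "continuous_on (UNIV \<times> \<Lambda>) (\<lambda>z. A (fst z) (snd z))" "continuous_on (UNIV \<times> \<Lambda>) (\<lambda>z. b (fst z) (snd z))"
    "continuous_on (UNIV \<times> \<Lambda>) (\<lambda>z. c (fst z) (snd z))" "continuous_on (UNIV \<times> \<Lambda>) (\<lambda>z. f (fst z) (snd z))"
    using cont by (simp_all add: case_prod_beta')
  have "continuous_on (UNIV \<times> \<Lambda>) (\<lambda>z. cordes_sum A b c lam (fst z) (snd z))"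
    unfolding cordes_sum_def using lam by (intro continuous_intros *) auto
  moreover have "\<forall>z\<in>UNIV \<times> \<Lambda>. cordes_sum A b c lam (fst z) (snd z) \<noteq> 0"
    using cordes_sum_pos by (auto simp: less_imp_neq[THEN not_sym])
  ultimately show "continuous_on (UNIV \<times> \<Lambda>) (\<lambda>z. \<gamma> (fst z) (snd z))"
    unfolding gamma_fun_def trace_eq_inner using lam by (intro continuous_intros *) auto
qed

lemma continuous_on_slice:
  assumes "continuous_on (UNIV \<times> \<Lambda>) (\<lambda>z. h (fst z) (snd z))"
  shows "continuous_on \<Lambda> (h y)" "\<alpha> \<in> \<Lambda> \<Longrightarrow> continuous_on UNIV (\<lambda>y. h y \<alpha>)"
proof -
  have "continuous_on \<Lambda> (\<lambda>\<alpha>. (y, \<alpha>))" by (intro continuous_on_Pair continuous_on_const continuous_on_id)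
  from continuous_on_compose2[OF assms this] show "continuous_on \<Lambda> (h y)" by auto
  show "continuous_on UNIV (\<lambda>y. h y \<alpha>)" if "\<alpha> \<in> \<Lambda>"
  proof -
    have "continuous_on UNIV (\<lambda>y. (y, \<alpha>))" by (intro continuous_on_Pair continuous_on_const continuous_on_id)
    from continuous_on_compose2[OF assms this] show ?thesis using that by auto
  qed
qed

lemma continuous_on_integrand:
  "continuous_on (UNIV \<times> \<Lambda>) (\<lambda>z. integrand D p r (fst z) (snd z))"
  unfolding integrand_def by (intro continuous_intros continuous_on_coefficients)

lemma bdd_integrand: "bdd_above (integrand D p r y ` \<Lambda>)"
  by (intro bounded_imp_bdd_above compact_imp_bounded compact_continuous_image \<Lambda>
      continuous_on_slice(1) continuous_on_integrand)

definition F_op :: "real^'n \<Rightarrow> real^'n^'n \<Rightarrow> real^'n \<Rightarrow> real \<Rightarrow> real" where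
  "F_op y D p r = (SUP \<alpha>\<in>\<Lambda>. integrand D p r y \<alpha>)"

text \<open>For fixed \<open>\<alpha>\<close> the source term \<open>f\<close> cancels and the
  difference is linear in the differences of the arguments, so \<open>cordes_pointwise\<close> gives
  a bound that is uniform in \<open>\<alpha>\<close>.\<close>

lemma F_op_diff_bound:
  "\<bar>F_op y D p r - F_op y D' p' r' - (- trace (D - D') + lam * (r - r'))\<bar>
    \<le> sqrt (1 - \<delta>) * sqrt ((norm (D - D'))\<^sup>2 + 2 * lam * (norm (p - p'))\<^sup>2 + lam\<^sup>2 * (r - r')\<^sup>2)"
  unfolding F_op_def
proof (rule SUP_diff_bound[OF \<Lambda>(2) bdd_integrand bdd_integrand])
  fix \<alpha> assume \<alpha>: "\<alpha> \<in> \<Lambda>"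
  have "integrand D p r y \<alpha> - integrand D' p' r' y \<alpha> =
      \<gamma> y \<alpha> * (- (A y \<alpha> \<bullet> (D - D')) - b y \<alpha> \<bullet> (p - p') + c y \<alpha> * (r - r'))"
    unfolding integrand_def by (simp add: inner_diff_right algebra_simps)
  then show "\<bar>integrand D p r y \<alpha> - integrand D' p' r' y \<alpha> - (- trace (D - D') + lam * (r - r'))\<bar>
    \<le> sqrt (1 - \<delta>) * sqrt ((norm (D - D'))\<^sup>2 + 2 * lam * (norm (p - p'))\<^sup>2 + lam\<^sup>2 * (r - r')\<^sup>2)"
    using cordes_pointwise[OF lam \<delta>(1) cordes_sum_pos[OF \<alpha>, of y, unfolded cordes_sum_def] cordes[OF \<alpha>, of y],
        of "D - D'" "p - p'" "r - r'"]
    unfolding gamma_fun_def cordes_sum_def by (simp add: mult.assoc)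
qed

lemma F_op_zero_bounded: "\<exists>B. \<forall>y\<in>unit_cell. \<bar>F_op y 0 0 0\<bar> \<le> B"
proof -
  let ?Q = "cbox 0 (\<chi> i. 1) :: (real^'n) set"
  have "bounded ((\<lambda>z. integrand 0 0 0 (fst z) (snd z)) ` (?Q \<times> \<Lambda>))"
    by (intro compact_imp_bounded compact_continuous_image compact_Times compact_cbox \<Lambda>
        continuous_on_subset[OF continuous_on_integrand]) auto
  then obtain B where B: "\<And>y \<alpha>. y \<in> ?Q \<Longrightarrow> \<alpha> \<in> \<Lambda> \<Longrightarrow> \<bar>integrand 0 0 0 y \<alpha>\<bar> \<le> B"
    unfolding bounded_iff by (metis (no_types, lifting) SigmaI fst_conv imageI real_norm_def snd_conv)
  have "\<bar>F_op y 0 0 0\<bar> \<le> B" if "y \<in> unit_cell" for y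
  proof -
    have "y \<in> ?Q" using that unit_cell_subset_cbox by blast
    then show ?thesis
      unfolding F_op_def using \<Lambda>(2) B by (intro cSup_abs_le) auto
  qed
  then show ?thesis by blast
qed

text \<open>Comparison with the arguments 0: \<open>F_op y 0 0 0\<close> is bounded because the
  closed cell times \<open>\<Lambda>\<close> is compact, and \<open>F_op_diff_bound\<close> controls
  the rest by square-integrable functions.\<close>

lemma F_gamma_sq_int:
  assumes w: "w \<in> W_per_vec" and u: "u \<in> H1_per"
  shows "sq_int (F_gamma \<Lambda> A b c f lam (w, u))"
proof -
  note s = Jac_sq_int[OF w] grad_sq_int[OF u] H1_sq_int[OF u]
  note [measurable] = s[THEN sq_int_measurable]
  let ?N = "\<lambda>y. sqrt ((norm (Jac w y))\<^sup>2 + 2 * lam * (norm (grad u y))\<^sup>2 + lam\<^sup>2 * (u y)\<^sup>2)"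
  have "(\<lambda>y. SUP \<alpha>\<in>\<Lambda>. integrand (Jac w y) (grad u y) (u y) y \<alpha>) \<in> borel_measurable cell_measure"
  proof (rule borel_measurable_SUP_compact[OF \<Lambda>])
    show "continuous_on \<Lambda> (integrand (Jac w y) (grad u y) (u y) y)" for y
      by (intro continuous_on_slice(1) continuous_on_integrand)
    fix \<alpha> assume \<alpha>: "\<alpha> \<in> \<Lambda>"
    note [measurable] = continuous_on_coefficients[THEN continuous_on_slice(2), OF \<alpha>, THEN continuous_measurable_cell]
    show "(\<lambda>y. integrand (Jac w y) (grad u y) (u y) y \<alpha>) \<in> borel_measurable cell_measure"
      unfolding integrand_def by measurable
  qed
  then have m: "F_gamma \<Lambda> A b c f lam (w, u) \<in> borel_measurable cell_measure"
    by (simp add: F_gamma_eq[abs_def])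
  obtain B where B: "\<And>y. y \<in> unit_cell \<Longrightarrow> \<bar>F_op y 0 0 0\<bar> \<le> B" using F_op_zero_bounded by blast
  have N: "sq_int ?N"
    using s lam unfolding sq_int_def by (simp add: add_nonneg_nonneg) 
  have La: "sq_int (\<lambda>y. \<bar>L_op lam (w, u) y\<bar>)"
    using L_op_sq_int[OF w u, of lam] borel_measurable_abs[OF sq_int_measurable[OF L_op_sq_int[OF w u]]]
    by (simp add: sq_int_def)
  have bound: "sq_int (\<lambda>y. B + (\<bar>L_op lam (w, u) y\<bar> + sqrt (1 - \<delta>) * ?N y))"
    by (intro sq_int_add sq_int_cmult N La sq_int_continuous[of "\<lambda>y. B"] continuous_on_const)
  show ?thesis
  proof (rule sq_int_bound[OF m])
    show "integrable cell_measure (\<lambda>y. (norm (B + (\<bar>L_op lam (w, u) y\<bar> + sqrt (1 - \<delta>) * ?N y)))\<^sup>2)"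
      using bound by (simp add: sq_int_def)
    fix y :: "real^'n" assume y: "y \<in> unit_cell"
    have "\<bar>F_op y (Jac w y) (grad u y) (u y)\<bar> \<le> B + (\<bar>L_op lam (w, u) y\<bar> + sqrt (1 - \<delta>) * ?N y)"
      using F_op_diff_bound[of y "Jac w y" "grad u y" "u y" 0 0 0] B[OF y]
      by (simp add: L_op_def divergence_def)
    then show "(norm (F_gamma \<Lambda> A b c f lam (w, u) y))\<^sup>2
        \<le> (norm (B + (\<bar>L_op lam (w, u) y\<bar> + sqrt (1 - \<delta>) * ?N y)))\<^sup>2"
      unfolding F_gamma_eq F_op_def[symmetric] by (intro power_mono) auto
  qed
qed

end

section \<open>Residual estimates\<close>

text \<open>The cross term in the square of \<open>L_op\<close>, integrated by parts, cancels the
  mixed part of the last integral, and \<open>div_rot_identity\<close> trades the divergence for the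
  Jacobian. The triple norm is thereby expressed through residual quantities, except for one factor
  \<open>grad q\<close>.\<close>

lemma energy_identity:
  fixes v :: "real^'n::{finite,comm_ring_1} \<Rightarrow> real^'n::{finite,comm_ring_1}"
  assumes dim: "CARD('n) \<in> {2, 3}" and v: "v \<in> W_per_vec" and q: "q \<in> H1_per"
  shows "(LINT y|cell_measure. (norm (Jac v y))\<^sup>2 + 2 * lam * (norm (grad q y))\<^sup>2 + lam\<^sup>2 * (q y)\<^sup>2) =
    (LINT y|cell_measure. (L_op lam (v, q) y)\<^sup>2) + (LINT y|cell_measure. (norm (rot v y))\<^sup>2)
    + 2 * lam * (LINT y|cell_measure. (grad q y - v y) \<bullet> grad q y)"
proof -
  note s = Jac_sq_int[OF v] grad_sq_int[OF q] H1_sq_int[OF q] divergence_sq_int[OF v] W_per_vec_sq_int[OF v]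
  note i = sq_int_mult_integrable[OF s(4) s(3)] sq_int_inner_integrable[OF s(5) s(2)] s[unfolded sq_int_def, THEN conjunct2]
  have "(L_op lam (v, q) y)\<^sup>2 = (divergence v y)\<^sup>2 - 2 * lam * (divergence v y * q y) + lam\<^sup>2 * (q y)\<^sup>2" for y
    by (simp add: L_op_def power2_eq_square algebra_simps)
  then have L: "(LINT y|cell_measure. (L_op lam (v, q) y)\<^sup>2) = (LINT y|cell_measure. (divergence v y)\<^sup>2)
    + 2 * lam * (LINT y|cell_measure. v y \<bullet> grad q y) + lam\<^sup>2 * (LINT y|cell_measure. (q y)\<^sup>2)"
    using i divergence_by_parts[OF v q] by simp
  have G: "(LINT y|cell_measure. (grad q y - v y) \<bullet> grad q y) =
    (LINT y|cell_measure. (norm (grad q y))\<^sup>2) - (LINT y|cell_measure. v y \<bullet> grad q y)"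
  proof -
    have "(grad q y - v y) \<bullet> grad q y = (norm (grad q y))\<^sup>2 - v y \<bullet> grad q y" for y
      by (simp add: inner_diff_left power2_norm_eq_inner)
    then show ?thesis using i by simp
  qed
  have "(LINT y|cell_measure. (norm (Jac v y))\<^sup>2 + 2 * lam * (norm (grad q y))\<^sup>2 + lam\<^sup>2 * (q y)\<^sup>2) =
    (LINT y|cell_measure. (norm (Jac v y))\<^sup>2) + 2 * lam * (LINT y|cell_measure. (norm (grad q y))\<^sup>2)
    + lam\<^sup>2 * (LINT y|cell_measure. (q y)\<^sup>2)"
    using i by simp
  then show ?thesis
    unfolding L G div_rot_identity[OF dim v] by (simp add: right_diff_distrib)
qed

text \<open>Here \<open>x\<close> is \<open>L\<close> of the error, \<open>z\<close> the operator
  residual, \<open>N\<close> the root of the triple norm density, \<open>G\<close> and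
  \<open>P\<close> the lengths of defect and gradient error, and \<open>gp\<close> their inner
  product. Both products are split with weights built from \<open>1 - s\<close>, so that the
  coefficient of \<open>N\<^sup>2\<close> stays below 1 and can be absorbed.\<close>

lemma young_reliability:
  fixes x z N G P gp s lam :: real
  assumes "\<bar>z + x\<bar> \<le> s * N" "0 \<le> s" "s < 1" "lam > 0" "gp \<le> G * P" "2 * lam * P\<^sup>2 \<le> N\<^sup>2" "N \<ge> 0"
  shows "x\<^sup>2 + 2 * lam * gp \<le>
    (1 + 2 * s / (1 - s)) * z\<^sup>2 + lam / (1 - s) * G\<^sup>2 + (s\<^sup>2 + (1 - s) * s / 2 + (1 - s) / 2) * N\<^sup>2"
proof -
  define e where "e = 1 - s"
  have e: "e > 0" using assms(3) by (simp add: e_def)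
  have "\<bar>x\<bar> \<le> \<bar>z\<bar> + s * N" using assms(1) by linarith
  then have "x\<^sup>2 \<le> (\<bar>z\<bar> + s * N)\<^sup>2" using power_mono[of "\<bar>x\<bar>" _ 2] by simp
  also have "\<dots> = z\<^sup>2 + s * (2 * \<bar>z\<bar> * N) + s\<^sup>2 * N\<^sup>2" by (simp add: power2_sum power_mult_distrib)
  finally have 1: "x\<^sup>2 \<le> z\<^sup>2 + s * (2 * \<bar>z\<bar> * N) + s\<^sup>2 * N\<^sup>2" .
  have "0 \<le> (2 * \<bar>z\<bar> - e * N)\<^sup>2 / (2 * e)" using e by simp
  also have "\<dots> = 2 * z\<^sup>2 / e + e * N\<^sup>2 / 2 - 2 * \<bar>z\<bar> * N"
    using e by (simp add: power2_diff power_mult_distrib field_simps) (simp add: power2_eq_square)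
  finally have "s * (2 * \<bar>z\<bar> * N) \<le> s * (2 * z\<^sup>2 / e + e * N\<^sup>2 / 2)"
    using assms(2) by (intro mult_left_mono) auto
  then have 2: "s * (2 * \<bar>z\<bar> * N) \<le> 2 * s / e * z\<^sup>2 + e * s / 2 * N\<^sup>2" by (simp add: algebra_simps)
  have "0 \<le> lam * (G - e * P)\<^sup>2 / e" using e assms(4) by simp
  also have "\<dots> = lam * G\<^sup>2 / e + e * (lam * P\<^sup>2) - 2 * lam * (G * P)"
    using e by (simp add: power2_diff power_mult_distrib field_simps) (simp add: power2_eq_square)
  finally have "2 * lam * (G * P) \<le> lam / e * G\<^sup>2 + e * (lam * P\<^sup>2)" by simp
  moreover have "e * (lam * P\<^sup>2) \<le> e / 2 * N\<^sup>2" using e assms(6) by simp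
  moreover have "2 * lam * gp \<le> 2 * lam * (G * P)" using assms(4,5) by simp
  ultimately have 3: "2 * lam * gp \<le> lam / e * G\<^sup>2 + e / 2 * N\<^sup>2" by linarith
  show ?thesis using 1 2 3 unfolding e_def[symmetric] by (simp add: algebra_simps)
qed

text \<open>The weight \<open>sqrt 2\<close> balances the two terms: the integral of
  \<open>x\<^sup>2\<close> will be at most twice that of \<open>N\<^sup>2\<close>, so each
  contributes \<open>sqrt 2 / 2\<close>. This is the origin of
  \<open>sqrt 2 * sqrt (1 - \<delta>)\<close> in \<open>C_L\<close>.\<close>

lemma young_efficiency:
  fixes x z N s :: real
  assumes "\<bar>z + x\<bar> \<le> s * N" "0 \<le> s" "N \<ge> 0"
  shows "1/2 * z\<^sup>2 \<le> 1/2 * x\<^sup>2 + s * (x\<^sup>2 / (2 * sqrt 2) + sqrt 2 / 2 * N\<^sup>2) + 1/2 * s\<^sup>2 * N\<^sup>2"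
proof -
  have "\<bar>z\<bar> \<le> \<bar>x\<bar> + s * N" using assms(1) by linarith
  then have "z\<^sup>2 \<le> (\<bar>x\<bar> + s * N)\<^sup>2" using power_mono[of "\<bar>z\<bar>" _ 2] by simp
  also have "\<dots> = x\<^sup>2 + 2 * (s * (\<bar>x\<bar> * N)) + s\<^sup>2 * N\<^sup>2" by (simp add: power2_sum power_mult_distrib)
  finally have 1: "z\<^sup>2 \<le> x\<^sup>2 + 2 * (s * (\<bar>x\<bar> * N)) + s\<^sup>2 * N\<^sup>2" .
  have "0 \<le> (\<bar>x\<bar> - sqrt 2 * N)\<^sup>2 / (2 * sqrt 2)" by simp
  also have "\<dots> = x\<^sup>2 / (2 * sqrt 2) + sqrt 2 / 2 * N\<^sup>2 - \<bar>x\<bar> * N"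
    by (simp add: power2_diff power_mult_distrib field_simps)
  finally have "s * (\<bar>x\<bar> * N) \<le> s * (x\<^sup>2 / (2 * sqrt 2) + sqrt 2 / 2 * N\<^sup>2)"
    using assms(2) by (intro mult_left_mono) auto
  then show ?thesis using 1 by linarith
qed

text \<open>To be applied with \<open>s = sqrt (1 - \<delta>)\<close>, the error
  \<open>(v, q)\<close> and the operator residual \<open>z\<close> of the discrete solution. The
  first bound combines the energy identity with Young's inequality; the other three treat the
  residual quantities one at a time.\<close>

lemma residual_bounds:
  fixes v :: "real^'n::{finite,comm_ring_1} \<Rightarrow> real^'n::{finite,comm_ring_1}"
  assumes dim: "CARD('n) \<in> {2, 3}" and v: "v \<in> W_per_vec" and q: "q \<in> H1_per" and z: "sq_int z"
    and lam: "lam > 0" and s: "0 \<le> s" "s < 1"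
  defines "T \<equiv> \<lambda>y. (norm (Jac v y))\<^sup>2 + 2 * lam * (norm (grad q y))\<^sup>2 + lam\<^sup>2 * (q y)\<^sup>2"
  assumes close: "AE y in cell_measure. \<bar>z y + L_op lam (v, q) y\<bar> \<le> s * sqrt (T y)"
  shows "(1 - s) / 2 * (LINT y|cell_measure. T y) \<le> (1 + 2 * s / (1 - s)) * (LINT y|cell_measure. (z y)\<^sup>2)
      + (LINT y|cell_measure. (norm (rot v y))\<^sup>2) + lam / (1 - s) * (LINT y|cell_measure. (norm (grad q y - v y))\<^sup>2)"
    and "1/2 * (LINT y|cell_measure. (z y)\<^sup>2) \<le> (1 + sqrt 2 * s + s\<^sup>2 / 2) * (LINT y|cell_measure. T y)"
    and "(LINT y|cell_measure. (norm (rot v y))\<^sup>2) \<le> (LINT y|cell_measure. T y)"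
    and "lam * (LINT y|cell_measure. (norm (grad q y - v y))\<^sup>2) \<le>
      (1/2 + real CARD('n) / pi\<^sup>2 * lam) * (LINT y|cell_measure. T y)"
proof -
  note sq = Jac_sq_int[OF v] grad_sq_int[OF q] H1_sq_int[OF q] divergence_sq_int[OF v] W_per_vec_sq_int[OF v]
    L_op_sq_int[OF v q, of lam] rot_sq_int[OF v] sq_int_diff[OF grad_sq_int[OF q] W_per_vec_sq_int[OF v]]
  note i = sq[unfolded sq_int_def, THEN conjunct2, unfolded real_norm_def power2_abs]
    sq_int_power2_integrable[OF z] sq_int_inner_integrable[OF sq(8) sq(2)]
  have T: "integrable cell_measure T" unfolding T_def using i by simp
  have T_eq: "(LINT y|cell_measure. T y) = (LINT y|cell_measure. (norm (Jac v y))\<^sup>2)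
    + 2 * lam * (LINT y|cell_measure. (norm (grad q y))\<^sup>2) + lam\<^sup>2 * (LINT y|cell_measure. (q y)\<^sup>2)"
    unfolding T_def using i by simp
  have nn: "0 \<le> (LINT y|cell_measure. (h y)\<^sup>2)" for h :: "real^'n::{finite,comm_ring_1} \<Rightarrow> real" by simp
  have T0: "0 \<le> T y" for y using lam by (simp add: T_def)
  note dr = div_rot_identity[OF dim v]
  have J_le: "(LINT y|cell_measure. (norm (Jac v y))\<^sup>2) \<le> (LINT y|cell_measure. T y)"
    unfolding T_eq using lam by (simp add: add_nonneg_nonneg)
  show rot_le: "(LINT y|cell_measure. (norm (rot v y))\<^sup>2) \<le> (LINT y|cell_measure. T y)"
    using J_le dr nn[of "divergence v"] by linarith

  have "(LINT y|cell_measure. (L_op lam (v, q) y)\<^sup>2 + 2 * lam * ((grad q y - v y) \<bullet> grad q y)) \<le>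
    (LINT y|cell_measure. (1 + 2 * s / (1 - s)) * (z y)\<^sup>2 + lam / (1 - s) * (norm (grad q y - v y))\<^sup>2
      + (s\<^sup>2 + (1 - s) * s / 2 + (1 - s) / 2) * T y)"
  proof (rule integral_mono_AE)
    show "AE y in cell_measure. (L_op lam (v, q) y)\<^sup>2 + 2 * lam * ((grad q y - v y) \<bullet> grad q y) \<le>
      (1 + 2 * s / (1 - s)) * (z y)\<^sup>2 + lam / (1 - s) * (norm (grad q y - v y))\<^sup>2
      + (s\<^sup>2 + (1 - s) * s / 2 + (1 - s) / 2) * T y"
      using close
    proof eventually_elim
      case (elim y)
      have "2 * lam * (norm (grad q y))\<^sup>2 \<le> (sqrt (T y))\<^sup>2"
        using T0 by (simp add: T_def)
      from young_reliability[OF elim s lam norm_cauchy_schwarz this] show ?case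
        using T0 by simp
    qed
  qed (use i T in simp_all)
  then have "(LINT y|cell_measure. (L_op lam (v, q) y)\<^sup>2) + 2 * lam * (LINT y|cell_measure. (grad q y - v y) \<bullet> grad q y) \<le>
    (1 + 2 * s / (1 - s)) * (LINT y|cell_measure. (z y)\<^sup>2) + lam / (1 - s) * (LINT y|cell_measure. (norm (grad q y - v y))\<^sup>2)
      + (s\<^sup>2 + (1 - s) * s / 2 + (1 - s) / 2) * (LINT y|cell_measure. T y)"
    using i T by simp
  moreover have "(LINT y|cell_measure. T y) = (LINT y|cell_measure. (L_op lam (v, q) y)\<^sup>2)
    + (LINT y|cell_measure. (norm (rot v y))\<^sup>2) + 2 * lam * (LINT y|cell_measure. (grad q y - v y) \<bullet> grad q y)"
    unfolding T_def by (rule energy_identity[OF dim v q])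
  ultimately have "(1 - (s\<^sup>2 + (1 - s) * s / 2 + (1 - s) / 2)) * (LINT y|cell_measure. T y) \<le>
    (1 + 2 * s / (1 - s)) * (LINT y|cell_measure. (z y)\<^sup>2)
      + (LINT y|cell_measure. (norm (rot v y))\<^sup>2) + lam / (1 - s) * (LINT y|cell_measure. (norm (grad q y - v y))\<^sup>2)"
    unfolding left_diff_distrib by linarith
  \<comment> \<open>What remains of the coefficient after absorption is \<open>(1 - s) / 2\<close>
    plus the nonnegative \<open>s * (1 - s) / 2\<close>.\<close>
  moreover have "(1 - s) / 2 * (LINT y|cell_measure. T y) \<le> (1 - (s\<^sup>2 + (1 - s) * s / 2 + (1 - s) / 2)) * (LINT y|cell_measure. T y)"
  proof (rule mult_right_mono)
    have "1 - (s\<^sup>2 + (1 - s) * s / 2 + (1 - s) / 2) - (1 - s) / 2 = s * (1 - s) / 2"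
      by (simp add: power2_eq_square field_simps)
    moreover have "0 \<le> s * (1 - s) / 2" using s by simp
    ultimately show "(1 - s) / 2 \<le> 1 - (s\<^sup>2 + (1 - s) * s / 2 + (1 - s) / 2)" by linarith
  qed (use T0 in simp)
  ultimately show "(1 - s) / 2 * (LINT y|cell_measure. T y) \<le> (1 + 2 * s / (1 - s)) * (LINT y|cell_measure. (z y)\<^sup>2)
      + (LINT y|cell_measure. (norm (rot v y))\<^sup>2) + lam / (1 - s) * (LINT y|cell_measure. (norm (grad q y - v y))\<^sup>2)"
    by linarith

  \<comment> \<open>The factor 2 stems from squaring a sum of two terms. The divergence costs no
    dimensional constant, as it would pointwise, because \<open>div_rot_identity\<close> is used
    after integration.\<close>
  have L_le: "(LINT y|cell_measure. (L_op lam (v, q) y)\<^sup>2) \<le> 2 * (LINT y|cell_measure. T y)"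
  proof -
    have "(L_op lam (v, q) y)\<^sup>2 \<le> 2 * (divergence v y)\<^sup>2 + 2 * (lam\<^sup>2 * (q y)\<^sup>2)" for y
      using zero_le_power2[of "divergence v y + lam * q y"] by (simp add: L_op_def power2_eq_square algebra_simps)
    then have "(LINT y|cell_measure. (L_op lam (v, q) y)\<^sup>2) \<le> (LINT y|cell_measure. 2 * (divergence v y)\<^sup>2 + 2 * (lam\<^sup>2 * (q y)\<^sup>2))"
      using i by (intro integral_mono) simp_all
    also have "\<dots> = 2 * (LINT y|cell_measure. (divergence v y)\<^sup>2) + 2 * (lam\<^sup>2 * (LINT y|cell_measure. (q y)\<^sup>2))"
      using i by simp
    also have "\<dots> \<le> 2 * (LINT y|cell_measure. T y)"
    proof -
      have "0 \<le> (LINT y|cell_measure. (norm (rot v y))\<^sup>2)" "0 \<le> 2 * lam * (LINT y|cell_measure. (norm (grad q y))\<^sup>2)"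
        using lam by simp_all
      moreover have "2 * (LINT y|cell_measure. T y) - (2 * (LINT y|cell_measure. (divergence v y)\<^sup>2) + 2 * (lam\<^sup>2 * (LINT y|cell_measure. (q y)\<^sup>2)))
        = 2 * (LINT y|cell_measure. (norm (rot v y))\<^sup>2) + 2 * (2 * lam * (LINT y|cell_measure. (norm (grad q y))\<^sup>2))"
        unfolding T_eq dr by (simp only: distrib_left)
      ultimately show ?thesis by linarith
    qed
    finally show ?thesis .
  qed
  have "(LINT y|cell_measure. 1/2 * (z y)\<^sup>2) \<le> (LINT y|cell_measure. 1/2 * (L_op lam (v, q) y)\<^sup>2
      + s * ((L_op lam (v, q) y)\<^sup>2 / (2 * sqrt 2) + sqrt 2 / 2 * T y) + 1/2 * s\<^sup>2 * T y)"
  proof (rule integral_mono_AE)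
    show "AE y in cell_measure. 1/2 * (z y)\<^sup>2 \<le> 1/2 * (L_op lam (v, q) y)\<^sup>2
      + s * ((L_op lam (v, q) y)\<^sup>2 / (2 * sqrt 2) + sqrt 2 / 2 * T y) + 1/2 * s\<^sup>2 * T y"
      using close
    proof eventually_elim
      case (elim y)
      from young_efficiency[OF this s(1)] show ?case using T0 by simp
    qed
  qed (use i T in simp_all)
  also have "\<dots> = 1/2 * (LINT y|cell_measure. (L_op lam (v, q) y)\<^sup>2) + s * ((LINT y|cell_measure. (L_op lam (v, q) y)\<^sup>2) / (2 * sqrt 2)
      + sqrt 2 / 2 * (LINT y|cell_measure. T y)) + 1/2 * s\<^sup>2 * (LINT y|cell_measure. T y)"
    using i T by simp
  also have "\<dots> \<le> 1/2 * (2 * (LINT y|cell_measure. T y)) + s * ((2 * (LINT y|cell_measure. T y)) / (2 * sqrt 2)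
      + sqrt 2 / 2 * (LINT y|cell_measure. T y)) + 1/2 * s\<^sup>2 * (LINT y|cell_measure. T y)"
    using s by (intro add_mono mult_left_mono divide_right_mono L_le order_refl) auto
  also have "\<dots> = (1 + sqrt 2 * s + s\<^sup>2 / 2) * (LINT y|cell_measure. T y)"
  proof -
    have half: "2 * X / (2 * sqrt 2) = sqrt 2 / 2 * X" for X :: real
      by (simp add: field_simps)
    show ?thesis unfolding half by (simp add: algebra_simps)
  qed
  finally show "1/2 * (LINT y|cell_measure. (z y)\<^sup>2) \<le> (1 + sqrt 2 * s + s\<^sup>2 / 2) * (LINT y|cell_measure. T y)"
    by simp

  \<comment> \<open>The squared diameter of the unit cube over \<open>pi\<^sup>2\<close>, the
    Poincare constant of a convex domain that enters \<open>C_L\<close>; the periodic constant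
    \<open>1 / (4 * pi\<^sup>2)\<close> lies below it.\<close>
  define P where "P = real CARD('n) / pi\<^sup>2"
  \<comment> \<open>Chosen so that, after multiplication by \<open>lam\<close>, the gradient and
    Jacobian terms carry the common factor \<open>1/2 + P * lam\<close> relative to their weights
    \<open>2 * lam\<close> and 1 in \<open>T\<close>.\<close>
  define \<theta> where "\<theta> = 2 * lam * P"
  have P: "P > 0" "1 / (4 * pi\<^sup>2) \<le> P"
  proof -
    show "P > 0" unfolding P_def by simp
    have "1 / (4 * pi\<^sup>2) \<le> 1 / pi\<^sup>2" by (simp add: field_simps)
    also have "\<dots> \<le> P" unfolding P_def using dim by (intro divide_right_mono) auto
    finally show "1 / (4 * pi\<^sup>2) \<le> P" .
  qed
  have \<theta>: "\<theta> > 0" unfolding \<theta>_def using lam P by simp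
  have "(norm (p - x))\<^sup>2 \<le> (1 + \<theta>) * (norm p)\<^sup>2 + (1 + 1 / \<theta>) * (norm x)\<^sup>2" for p x :: "real^'n::{finite,comm_ring_1}"
  proof -
    have "(norm (p - x))\<^sup>2 \<le> (norm p + norm x)\<^sup>2" by (intro power_mono norm_triangle_ineq4) simp
    also have "\<dots> = (norm p)\<^sup>2 + 2 * (norm p * norm x) + (norm x)\<^sup>2" by (simp add: power2_sum)
    finally have 1: "(norm (p - x))\<^sup>2 \<le> (norm p)\<^sup>2 + 2 * (norm p * norm x) + (norm x)\<^sup>2" .
    have "0 \<le> (\<theta> * norm p - norm x)\<^sup>2 / \<theta>" using \<theta> by simp
    also have "\<dots> = \<theta> * (norm p)\<^sup>2 + (norm x)\<^sup>2 / \<theta> - 2 * (norm p * norm x)"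
      using \<theta> by (simp add: power2_eq_square field_simps)
    finally show ?thesis using 1 by (simp add: algebra_simps)
  qed
  then have "(LINT y|cell_measure. (norm (grad q y - v y))\<^sup>2) \<le>
      (LINT y|cell_measure. (1 + \<theta>) * (norm (grad q y))\<^sup>2 + (1 + 1 / \<theta>) * (norm (v y))\<^sup>2)"
    using i by (intro integral_mono) simp_all
  also have "\<dots> = (1 + \<theta>) * (LINT y|cell_measure. (norm (grad q y))\<^sup>2) + (1 + 1 / \<theta>) * (LINT y|cell_measure. (norm (v y))\<^sup>2)"
    using i by simp
  also have "\<dots> \<le> (1 + \<theta>) * (LINT y|cell_measure. (norm (grad q y))\<^sup>2) + (1 + 1 / \<theta>) * (P * (LINT y|cell_measure. (norm (Jac v y))\<^sup>2))"
  proof (intro add_left_mono mult_left_mono)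
    have "(LINT y|cell_measure. (norm (v y))\<^sup>2) \<le> 1 / (4 * pi\<^sup>2) * (LINT y|cell_measure. (norm (Jac v y))\<^sup>2)"
      using poincare_vec[OF v] by (simp add: field_simps)
    also have "\<dots> \<le> P * (LINT y|cell_measure. (norm (Jac v y))\<^sup>2)" by (intro mult_right_mono P) simp
    finally show "(LINT y|cell_measure. (norm (v y))\<^sup>2) \<le> P * (LINT y|cell_measure. (norm (Jac v y))\<^sup>2)" .
  qed (use \<theta> in simp)
  finally have "lam * (LINT y|cell_measure. (norm (grad q y - v y))\<^sup>2) \<le> lam * ((1 + \<theta>) * (LINT y|cell_measure. (norm (grad q y))\<^sup>2)
      + (1 + 1 / \<theta>) * (P * (LINT y|cell_measure. (norm (Jac v y))\<^sup>2)))"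
    using lam by (intro mult_left_mono) auto
  also have "\<dots> = (1/2 + P * lam) * ((LINT y|cell_measure. (norm (Jac v y))\<^sup>2) + 2 * lam * (LINT y|cell_measure. (norm (grad q y))\<^sup>2))"
    using lam P unfolding \<theta>_def by (simp add: field_simps)
  also have "\<dots> \<le> (1/2 + P * lam) * (LINT y|cell_measure. T y)"
    unfolding T_eq using lam P by (intro mult_left_mono) auto
  finally show "lam * (LINT y|cell_measure. (norm (grad q y - v y))\<^sup>2) \<le>
      (1/2 + real CARD('n) / pi\<^sup>2 * lam) * (LINT y|cell_measure. T y)"
    unfolding P_def .
qed

section \<open>From the residual bounds to the triple norm\<close>

lemma L2_norm_power2: "(L2_norm f)\<^sup>2 = (LINT y|cell_measure. (norm (f y))\<^sup>2)"
  by (simp add: L2_norm_def)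

lemma triple_norm_power2:
  fixes v :: "real^'n \<Rightarrow> real^'n"
  assumes "v \<in> W_per_vec" "q \<in> H1_per" "lam > 0"
  shows "(triple_norm lam (v, q))\<^sup>2 =
    (LINT y|cell_measure. (norm (Jac v y))\<^sup>2 + 2 * lam * (norm (grad q y))\<^sup>2 + lam\<^sup>2 * (q y)\<^sup>2)"
proof -
  have "0 \<le> (L2_norm (Jac v))\<^sup>2 + 2 * lam * (L2_norm (grad q))\<^sup>2 + lam\<^sup>2 * (L2_norm q)\<^sup>2"
    using assms(3) by simp
  then show ?thesis
    unfolding triple_norm_def
    using Jac_sq_int[OF assms(1)] grad_sq_int[OF assms(2)] H1_sq_int[OF assms(2)]
    by (simp add: L2_norm_power2 sq_int_def)
qed

lemma exact_solution:
  fixes A :: "real^'n::{finite,comm_ring_1} \<Rightarrow> 'l::metric_space \<Rightarrow> real^'n::{finite,comm_ring_1}^'n::{finite,comm_ring_1}"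
  assumes "hjb_coefficients \<Lambda> A b c f \<zeta> lam \<delta>"
    and w: "w \<in> W_per_vec" and u: "u \<in> H1_per"
    and eq: "\<And>w' u'. w' \<in> W_per_vec \<Longrightarrow> u' \<in> H1_per \<Longrightarrow>
      a_form \<Lambda> A b c f lam \<delta> (w, u) (w', u') + b_form m (w', u') = 0"
    and b0: "b_form m (w, u) = 0"
  shows "AE y in cell_measure. F_gamma \<Lambda> A b c f lam (w, u) y = 0"
    and "AE y in cell_measure. rot w y = 0" and "AE y in cell_measure. grad u y = w y"
proof -
  interpret hjb_coefficients \<Lambda> A b c f \<zeta> lam \<delta> by fact
  let ?F = "F_gamma \<Lambda> A b c f lam (w, u)"
  have F: "sq_int ?F" using w u by (rule F_gamma_sq_int)
  show F0: "AE y in cell_measure. ?F y = 0"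
  proof (rule AE_zero_if_wave_coeff_zero[OF F])
    fix k :: "real^'n::{finite,comm_ring_1}" and t assume k: "k \<in> freqs"
    define v where "v = (\<lambda>x. 1 * wave k t x)"
    define z where "z = (\<lambda>x. \<chi> i. (2 * pi * k $ i) * wave k (t + pi/2) x)"
    note p = gradient_wave_pair[OF k, where t = t, folded v_def z_def]
    have gz: "AE y in cell_measure. grad v y = z y"
      using gradient_wave_pair(3)[OF k, of t] by (simp add: v_def z_def)
    have "(LINT y|cell_measure. ?F y * L_op lam (z, v) y) =
        (LINT y|cell_measure. (4 * pi\<^sup>2 * (norm k)\<^sup>2 + lam) * (?F y * wave k t y))"
    proof (rule integral_cong_AE)
      show "AE y in cell_measure. ?F y * L_op lam (z, v) y = (4 * pi\<^sup>2 * (norm k)\<^sup>2 + lam) * (?F y * wave k t y)"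
        using p(5)[of lam] by eventually_elim simp
      show "(\<lambda>y. ?F y * L_op lam (z, v) y) \<in> borel_measurable cell_measure"
        by (intro borel_measurable_times sq_int_measurable F L_op_sq_int p)
      show "(\<lambda>y. (4 * pi\<^sup>2 * (norm k)\<^sup>2 + lam) * (?F y * wave k t y)) \<in> borel_measurable cell_measure"
        by (intro borel_measurable_times borel_measurable_const sq_int_measurable F sq_int_wave)
    qed
    moreover have "(LINT y|cell_measure. rot w y \<bullet> rot z y) = 0"
      using p(4) by (intro integral_eq_zero_AE) (auto elim: eventually_mono)
    \<comment> \<open>One statement for two terms: \<open>h\<close> is the defect
      \<open>grad u - w\<close> in the \<open>sigma2\<close> term of \<open>a_form\<close>, and
      \<open>grad m\<close> in \<open>b_form\<close>.\<close>
    moreover have "(LINT y|cell_measure. h y \<bullet> (grad v y - z y)) = 0" for h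
      using gz by (intro integral_eq_zero_AE) (auto elim: eventually_mono)
    ultimately have "(4 * pi\<^sup>2 * (norm k)\<^sup>2 + lam) * wave_coeff ?F k t = 0"
      using eq[OF p(2,1)] by (simp add: a_form_def b_form_def wave_coeff_def)
    moreover have "4 * pi\<^sup>2 * (norm k)\<^sup>2 + lam > 0" using lam by (simp add: add_nonneg_pos)
    ultimately show "wave_coeff ?F k t = 0" by simp
  qed
  have "(LINT y|cell_measure. ?F y * L_op lam (w, u) y) = 0"
    using F0 by (intro integral_eq_zero_AE) (auto elim: eventually_mono)
  then have e: "sigma1 \<delta> * (LINT y|cell_measure. (norm (rot w y))\<^sup>2)
      + sigma2 \<delta> lam * (LINT y|cell_measure. (norm (grad u y - w y))\<^sup>2) = 0"
    using eq[OF w u] b0 by (simp add: a_form_def power2_norm_eq_inner)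
  have s: "sqrt (1 - \<delta>) < 1" using \<delta> by simp
  have s1: "sigma1 \<delta> > 0" unfolding sigma1_def using s by linarith
  have s2: "sigma2 \<delta> lam > 0"
    using s lam by (simp add: sigma2_def sigma2_tilde_def add_pos_pos)
  have i: "integrable cell_measure (\<lambda>y. (norm (rot w y))\<^sup>2)" "integrable cell_measure (\<lambda>y. (norm (grad u y - w y))\<^sup>2)"
    using rot_sq_int[OF w] sq_int_diff[OF grad_sq_int[OF u] W_per_vec_sq_int[OF w]] by (auto simp: sq_int_def)
  have nn: "0 \<le> sigma1 \<delta> * (LINT y|cell_measure. (norm (rot w y))\<^sup>2)"
    "0 \<le> sigma2 \<delta> lam * (LINT y|cell_measure. (norm (grad u y - w y))\<^sup>2)"
    using s1 s2 by simp_all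
  have "sigma1 \<delta> * (LINT y|cell_measure. (norm (rot w y))\<^sup>2) = 0"
    "sigma2 \<delta> lam * (LINT y|cell_measure. (norm (grad u y - w y))\<^sup>2) = 0"
    using e nn by linarith+
  then have z: "(LINT y|cell_measure. (norm (rot w y))\<^sup>2) = 0" "(LINT y|cell_measure. (norm (grad u y - w y))\<^sup>2) = 0"
    using s1 s2 by simp_all
  show "AE y in cell_measure. rot w y = 0"
    using integral_nonneg_eq_0_iff_AE[OF i(1)] z(1) by simp
  show "AE y in cell_measure. grad u y = w y"
    using integral_nonneg_eq_0_iff_AE[OF i(2)] z(2) by simp
qed

theorem theorem2p4:
  fixes \<Lambda> :: "'l::metric_space set"
    and A :: "real^'n::{finite,comm_ring_1} \<Rightarrow> 'l \<Rightarrow> real^'n::{finite,comm_ring_1}^'n::{finite,comm_ring_1}"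
    and b :: "real^'n::{finite,comm_ring_1} \<Rightarrow> 'l \<Rightarrow> real^'n::{finite,comm_ring_1}"
    and c f :: "real^'n::{finite,comm_ring_1} \<Rightarrow> 'l \<Rightarrow> real"
    and \<zeta>1 \<zeta>2 lam \<delta> :: real
    and M U\<^sub>h M\<^sub>h :: "(real^'n::{finite,comm_ring_1} \<Rightarrow> real) set"
    and W\<^sub>h :: "(real^'n::{finite,comm_ring_1} \<Rightarrow> real^'n::{finite,comm_ring_1}) set"
    and w w\<^sub>h :: "real^'n::{finite,comm_ring_1} \<Rightarrow> real^'n::{finite,comm_ring_1}"
    and m u m\<^sub>h u\<^sub>h :: "real^'n::{finite,comm_ring_1} \<Rightarrow> real"
  assumes dim: "CARD('n) \<in> {2, 3}"
    and \<Lambda>: "compact \<Lambda>" "\<Lambda> \<noteq> {}"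
    and sym: "\<And>y \<alpha>. \<alpha> \<in> \<Lambda> \<Longrightarrow> transpose (A y \<alpha>) = A y \<alpha>"
    and per: "\<And>\<alpha>. \<alpha> \<in> \<Lambda> \<Longrightarrow> cell_periodic (\<lambda>y. A y \<alpha>)"
      "\<And>\<alpha>. \<alpha> \<in> \<Lambda> \<Longrightarrow> cell_periodic (\<lambda>y. b y \<alpha>)"
      "\<And>\<alpha>. \<alpha> \<in> \<Lambda> \<Longrightarrow> cell_periodic (\<lambda>y. c y \<alpha>)"
      "\<And>\<alpha>. \<alpha> \<in> \<Lambda> \<Longrightarrow> cell_periodic (\<lambda>y. f y \<alpha>)"
    and unif: "uniformly_continuous_on (UNIV \<times> \<Lambda>) (\<lambda>(y, \<alpha>). A y \<alpha>)"
      "uniformly_continuous_on (UNIV \<times> \<Lambda>) (\<lambda>(y, \<alpha>). b y \<alpha>)"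
      "uniformly_continuous_on (UNIV \<times> \<Lambda>) (\<lambda>(y, \<alpha>). c y \<alpha>)"
      "uniformly_continuous_on (UNIV \<times> \<Lambda>) (\<lambda>(y, \<alpha>). f y \<alpha>)"
    and c_pos: "(INF (y, \<alpha>)\<in>UNIV \<times> \<Lambda>. c y \<alpha>) > 0"
    and ellipticity: "\<zeta>1 > 0" "\<zeta>2 > 0"
      "\<And>y \<alpha> \<xi>. \<alpha> \<in> \<Lambda> \<Longrightarrow> \<zeta>1 * (norm \<xi>)\<^sup>2 \<le> (A y \<alpha> *v \<xi>) \<bullet> \<xi>"
      "\<And>y \<alpha> \<xi>. \<alpha> \<in> \<Lambda> \<Longrightarrow> (A y \<alpha> *v \<xi>) \<bullet> \<xi> \<le> \<zeta>2 * (norm \<xi>)\<^sup>2"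
    and cordes: "lam > 0" "0 < \<delta>" "\<delta> < 1"
      "\<And>y \<alpha>. \<alpha> \<in> \<Lambda> \<Longrightarrow>
         (norm (A y \<alpha>))\<^sup>2 + (norm (b y \<alpha>))\<^sup>2 / (2 * lam) + (c y \<alpha>)\<^sup>2 / lam\<^sup>2
           \<le> 1 / (real CARD('n) + \<delta>) * (trace (A y \<alpha>) + c y \<alpha> / lam)\<^sup>2"
    and M: "closed_linear_subspace W_per H1_norm M"
    and W\<^sub>h: "closed_linear_subspace W_per_vec H1_norm_vec W\<^sub>h"
    and U\<^sub>h: "closed_linear_subspace H1_per H1_norm U\<^sub>h"
    and M\<^sub>h: "closed_linear_subspace H1_per H1_norm M\<^sub>h" "M\<^sub>h \<subseteq> U\<^sub>h \<inter> M"
    and sol_mem: "(m, (w, u)) \<in> M \<times> X_space"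
    and sol1: "\<forall>(w', u')\<in>X_space.
      a_form \<Lambda> A b c f lam \<delta> (w, u) (w', u') + b_form m (w', u') = 0"
    and sol2: "\<forall>m'\<in>M. b_form m' (w, u) = 0"
    and dsol_mem: "(m\<^sub>h, (w\<^sub>h, u\<^sub>h)) \<in> M\<^sub>h \<times> (W\<^sub>h \<times> U\<^sub>h)"
    and dsol1: "\<forall>(w\<^sub>h', u\<^sub>h')\<in>W\<^sub>h \<times> U\<^sub>h.
      a_form \<Lambda> A b c f lam \<delta> (w\<^sub>h, u\<^sub>h) (w\<^sub>h', u\<^sub>h') + b_form m\<^sub>h (w\<^sub>h', u\<^sub>h') = 0"
    and dsol2: "\<forall>m\<^sub>h'\<in>M\<^sub>h. b_form m\<^sub>h' (w\<^sub>h, u\<^sub>h) = 0"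
  shows "(triple_norm lam (\<lambda>y. w y - w\<^sub>h y, \<lambda>y. u y - u\<^sub>h y))\<^sup>2
      \<le> 2 * inverse (C_M \<delta>) *
        (inverse (C_M \<delta>) * (L2_norm (F_gamma \<Lambda> A b c f lam (w\<^sub>h, u\<^sub>h)))\<^sup>2
         + sigma1 \<delta> * (L2_norm (rot w\<^sub>h))\<^sup>2
         + sigma2 \<delta> lam * (L2_norm (\<lambda>y. w\<^sub>h y - grad u\<^sub>h y))\<^sup>2)
    \<and> 1/2 * (L2_norm (F_gamma \<Lambda> A b c f lam (w\<^sub>h, u\<^sub>h)))\<^sup>2
        + sigma1 \<delta> * (L2_norm (rot w\<^sub>h))\<^sup>2
        + sigma2 \<delta> lam * (L2_norm (\<lambda>y. w\<^sub>h y - grad u\<^sub>h y))\<^sup>2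
      \<le> (C_L CARD('n) \<delta> lam + (1 - \<delta>) / 2) *
        (triple_norm lam (\<lambda>y. w y - w\<^sub>h y, \<lambda>y. u y - u\<^sub>h y))\<^sup>2"
proof -
  let ?s = "sqrt (1 - \<delta>)"
  have s: "0 \<le> ?s" "?s < 1" "?s\<^sup>2 = 1 - \<delta>" using cordes(2,3) by auto
  have coeffs: "hjb_coefficients \<Lambda> A b c f \<zeta>1 lam \<delta>"
    by unfold_locales (use \<Lambda> unif ellipticity cordes in \<open>auto intro: uniformly_continuous_imp_continuous\<close>)
  interpret hjb: hjb_coefficients \<Lambda> A b c f \<zeta>1 lam \<delta> by (rule coeffs)
  have w: "w \<in> W_per_vec" and u: "u \<in> H1_per" and m: "m \<in> M"
    using sol_mem by (auto simp: X_space_def)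
  have wh: "w\<^sub>h \<in> W_per_vec" and uh: "u\<^sub>h \<in> H1_per"
    using dsol_mem W\<^sub>h U\<^sub>h by (auto simp: closed_linear_subspace_def)
  have eq: "a_form \<Lambda> A b c f lam \<delta> (w, u) (w', u') + b_form m (w', u') = 0" if "w' \<in> W_per_vec" "u' \<in> H1_per" for w' u'
    using sol1 that unfolding X_space_def by blast
  have ex: "AE y in cell_measure. F_gamma \<Lambda> A b c f lam (w, u) y = 0"
    "AE y in cell_measure. rot w y = 0" "AE y in cell_measure. grad u y = w y"
    by (rule exact_solution[OF coeffs w u _ sol2[rule_format, OF m]]; rule eq; assumption)+

  define v where "v = (\<lambda>y. w y - w\<^sub>h y)"
  define q where "q = (\<lambda>y. u y - u\<^sub>h y)"
  have v: "v \<in> W_per_vec" and q: "q \<in> H1_per"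
    unfolding v_def q_def using W_per_vec_diff(1)[OF w wh] weak_grad_diff(1)[OF u uh] by auto
  have Jv: "AE y in cell_measure. Jac v y = Jac w y - Jac w\<^sub>h y"
    unfolding v_def by (rule W_per_vec_diff(2)[OF w wh])
  have gq: "AE y in cell_measure. grad q y = grad u y - grad u\<^sub>h y"
    unfolding q_def by (rule weak_grad_diff(2)[OF u uh])
  let ?F = "F_gamma \<Lambda> A b c f lam (w\<^sub>h, u\<^sub>h)"
  let ?T = "\<lambda>y. (norm (Jac v y))\<^sup>2 + 2 * lam * (norm (grad q y))\<^sup>2 + lam\<^sup>2 * (q y)\<^sup>2"
  \<comment> \<open>As the exact solution annihilates the operator, the difference in
    \<open>F_op_diff_bound\<close> reduces to minus \<open>?F\<close>, which accounts for the plus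
    sign in front of \<open>L_op\<close>.\<close>
  have "AE y in cell_measure. \<bar>?F y + L_op lam (v, q) y\<bar> \<le> ?s * sqrt (?T y)"
    using ex(1) Jv gq
  proof eventually_elim
    case (elim y)
    then show ?case
      using hjb.F_op_diff_bound[of y "Jac w y" "grad u y" "u y" "Jac w\<^sub>h y" "grad u\<^sub>h y" "u\<^sub>h y"]
      unfolding hjb.F_gamma_eq hjb.F_op_def[symmetric] L_op_def divergence_def
      by (simp add: q_def abs_if split: if_splits)
  qed
  note R = residual_bounds[OF dim v q hjb.F_gamma_sq_int[OF wh uh] cordes(1) s(1,2) this]
  define Z where "Z = (L2_norm ?F)\<^sup>2"
  define E where "E = (L2_norm (rot w\<^sub>h))\<^sup>2"
  define G where "G = (L2_norm (\<lambda>y. w\<^sub>h y - grad u\<^sub>h y))\<^sup>2"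
  define T where "T = (triple_norm lam (v, q))\<^sup>2"
  have Z: "(LINT y|cell_measure. (?F y)\<^sup>2) = Z" by (simp add: Z_def L2_norm_power2)
  have T: "(LINT y|cell_measure. ?T y) = T"
    unfolding T_def using triple_norm_power2[OF v q cordes(1)] by simp
  have E: "(LINT y|cell_measure. (norm (rot v y))\<^sup>2) = E"
    unfolding E_def L2_norm_power2
  proof (rule integral_cong_AE)
    show "AE y in cell_measure. (norm (rot v y))\<^sup>2 = (norm (rot w\<^sub>h y))\<^sup>2"
      using ex(2) Jv by eventually_elim (simp add: rot_diff)
  qed (use rot_sq_int[OF v] rot_sq_int[OF wh] in \<open>auto simp: sq_int_def\<close>)
  have G: "(LINT y|cell_measure. (norm (grad q y - v y))\<^sup>2) = G"
    unfolding G_def L2_norm_power2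
  proof (rule integral_cong_AE)
    show "AE y in cell_measure. (norm (grad q y - v y))\<^sup>2 = (norm (w\<^sub>h y - grad u\<^sub>h y))\<^sup>2"
      using ex(3) gq by eventually_elim (simp add: v_def)
  qed (use sq_int_diff[OF grad_sq_int[OF q] W_per_vec_sq_int[OF v]]
      sq_int_diff[OF W_per_vec_sq_int[OF wh] grad_sq_int[OF uh]] in \<open>auto simp: sq_int_def\<close>)
  note R = R[unfolded Z T E G]
  define e where "e = 1 - ?s"
  have e: "0 < e" "e \<le> 1" "?s = 1 - e" using s by (auto simp: e_def)
  have nn: "0 \<le> Z" "0 \<le> E" "0 \<le> G" "0 \<le> T" by (simp_all add: Z_def E_def G_def T_def)
  have reliability: "T \<le> 2 * inverse (C_M \<delta>) * (inverse (C_M \<delta>) * Z + sigma1 \<delta> * E + sigma2 \<delta> lam * G)"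
  proof -
    have "T = (2 / e) * (e / 2 * T)" using e by simp
    also have "\<dots> \<le> (2 / e) * ((1 + 2 * ?s / e) * Z + E + lam / e * G)"
      using R(1) e unfolding e_def[symmetric] by (intro mult_left_mono) auto
    \<comment> \<open>Since \<open>C_M \<delta>\<close> is \<open>e / 4\<close>, the claimed bound
      has exactly these coefficients: \<open>16 / e\<close> is the squared inverse of
      \<open>C_M\<close> times \<open>e\<close>, and each 4 is one inverse times
      \<open>e\<close>.\<close>
    also have "\<dots> \<le> (2 / e) * (16 / e * Z + 4 * sigma1 \<delta> * E + 4 * sigma2 \<delta> lam * G)"
    proof (intro mult_left_mono add_mono mult_right_mono nn)
      have "1 + 2 * ?s / e = (e + 2 * ?s) / e" using e(1) by (simp add: add_divide_distrib)
      also have "\<dots> \<le> 16 / e"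
      proof (rule divide_right_mono)
        show "e + 2 * ?s \<le> 16" using e(2) s(2) by linarith
      qed (use e in simp)
      finally show "1 + 2 * ?s / e \<le> 16 / e" .
      have "1 \<le> 4 * sigma1 \<delta>" unfolding sigma1_def e(3) using e(1) by simp
      then show "E \<le> 4 * sigma1 \<delta> * E" using mult_right_mono[of 1 _ E] nn by simp
      have "4 * sigma2 \<delta> lam = 2 * lam * e + lam / e"
        using e by (simp add: sigma2_def sigma2_tilde_def e_def[symmetric] field_simps)
      then show "lam / e \<le> 4 * sigma2 \<delta> lam" using e cordes(1) by simp
    qed (use e in auto)
    also have "\<dots> = 2 * inverse (C_M \<delta>) * (inverse (C_M \<delta>) * Z + sigma1 \<delta> * E + sigma2 \<delta> lam * G)"
      using e by (simp add: C_M_def e_def[symmetric] field_simps)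
    finally show ?thesis .
  qed
  have efficiency: "1/2 * Z + sigma1 \<delta> * E + sigma2 \<delta> lam * G \<le> (C_L CARD('n) \<delta> lam + (1 - \<delta>) / 2) * T"
  proof -
    have s1: "sigma1 \<delta> * E \<le> sigma1 \<delta> * T"
      using R(3) e(1) unfolding sigma1_def e(3) by (intro mult_left_mono) auto
    have "sigma2_tilde \<delta> * (lam * G) \<le> sigma2_tilde \<delta> * ((1/2 + real CARD('n) / pi\<^sup>2 * lam) * T)"
      using R(4) e by (intro mult_left_mono) (auto simp: sigma2_tilde_def e_def[symmetric])
    then have s2: "sigma2 \<delta> lam * G \<le> sigma2_tilde \<delta> * (1/2 + real CARD('n) / pi\<^sup>2 * lam) * T"
      by (simp add: sigma2_def mult_ac)
    \<comment> \<open>With \<open>?s\<^sup>2 / 2\<close> equal to \<open>(1 - \<delta>) / 2\<close>,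
      splitting off 1 leaves exactly the factor of \<open>R(2)\<close>; the separate summand
      \<open>T\<close> is nonnegative.\<close>
    have "C_L CARD('n) \<delta> lam + (1 - \<delta>) / 2 = 1 + (1 + sqrt 2 * ?s + ?s\<^sup>2 / 2) + sigma1 \<delta>
        + sigma2_tilde \<delta> * (1/2 + real CARD('n) / pi\<^sup>2 * lam)"
      unfolding C_L_def s(3) by simp
    then have "(C_L CARD('n) \<delta> lam + (1 - \<delta>) / 2) * T = T + (1 + sqrt 2 * ?s + ?s\<^sup>2 / 2) * T + sigma1 \<delta> * T
        + sigma2_tilde \<delta> * (1/2 + real CARD('n) / pi\<^sup>2 * lam) * T"
      by (simp only: distrib_right mult_1)
    then show ?thesis using R(2) s1 s2 nn by linarith
  qed
  show ?thesis
    using reliability efficiency unfolding T_def Z_def E_def G_def v_def q_def by blast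
qed

end
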